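(* Let $\beta<0$, $\gamma>0$ and $s_1<-\frac12$. The Cauchy problem $$u_t-\beta\partial_x^3u+\partial_x(u^2)+\partial_x^{-1}\partial_y^2u-\gamma\partial_x^{-1}u=0,\qquad u(x,y,0)=u_0(x,y)$$ is ill-posed in $H^{s_1,0}(\mathbb{R}^2)$ in the sense that there is no $T>0$ for which the solution map $u_0\mapsto u(t)$, $t\in[0,T]$, is $C^3$ at zero from $H^{s_1,0}(\mathbb{R}^2)$ to $H^{s_1,0}(\mathbb{R}^2)$.
   Context: With $\langle\cdot\rangle=1+|\cdot|$ and $\mathscr{F}_{xy}$ the Fourier transform in $(x,y)$ (dual variables $(\xi,\eta)$), $H^{s_1,0}(\mathbb{R}^2)$ has norm $\|\langle\xi\rangle^{s_1}\mathscr{F}_{xy}u_0\|_{L^2_{\xi\eta}}$. The Cauchy problem is understood through the equivalent integral equation $$u(t)=W(t)u_0-\int_0^tW(t-\tau)\partial_x(u^2)(\tau)\,d\tau,$$ where $W(t)$ is the Fourier multiplier operator with symbol $\exp\big(it(-\beta\xi^3-\frac{\eta^2+\gamma}{\xi})\big)$. *)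

theory Defs
  imports "HOL-Analysis.Analysis" "HOL-Library.Function_Algebras"
begin

section \<open>Pointwise real vector space structure on functions\<close>

instantiation "fun" :: (type, real_vector) real_vector
begin

definition scaleR_fun :: "real \<Rightarrow> ('a \<Rightarrow> 'b) \<Rightarrow> 'a \<Rightarrow> 'b"
  where "scaleR_fun c f = (\<lambda>x. c *\<^sub>R f x)"

instance
  by standard (auto simp: scaleR_fun_def plus_fun_def fun_eq_iff scaleR_add_left scaleR_add_right)

end


section \<open>Tempered distributions on the plane and their Fourier transform\<close>

type_synonym plane = "real \<times> real"

text \<open>The function \<open>D j k\<close> is the partial derivative of order \<open>j\<close> in \<open>x\<close> and \<open>k\<close> in \<open>y\<close>.
  All of them being bounded, each is Lipschitz, so \<open>\<phi>\<close> is smooth.\<close>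

definition schwartz :: "(plane \<Rightarrow> complex) set" where
  "schwartz = {\<phi>. \<exists>D :: nat \<Rightarrow> nat \<Rightarrow> plane \<Rightarrow> complex. D 0 0 = \<phi> \<and>
     (\<forall>j k x y. ((\<lambda>s. D j k (s, y)) has_vector_derivative D (Suc j) k (x, y)) (at x)) \<and>
     (\<forall>j k x y. ((\<lambda>s. D j k (x, s)) has_vector_derivative D j (Suc k) (x, y)) (at y)) \<and>
     (\<forall>j k m n. bounded (range (\<lambda>(x, y). complex_of_real (x ^ m * y ^ n) * D j k (x, y))))}"

text \<open>A distribution is a functional on test functions, normalised to be \<open>0\<close> off the Schwartz
  space, so that equality of functionals is equality of distributions.\<close>

type_synonym distr = "(plane \<Rightarrow> complex) \<Rightarrow> complex"

definition regular :: "(plane \<Rightarrow> complex) \<Rightarrow> distr" where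
  "regular v = (\<lambda>\<phi>. if \<phi> \<in> schwartz then (LINT z|lborel. v z * \<phi> z) else 0)"

definition ddx :: "distr \<Rightarrow> distr" where
  "ddx u = (\<lambda>\<phi>. if \<phi> \<in> schwartz
     then - u (\<lambda>(x, y). vector_derivative (\<lambda>s. \<phi> (s, y)) (at x)) else 0)"

text \<open>Unitary normalisation of the Fourier transform:
  \<open>(1/2\<pi>) \<integral> e\<^sup>-\<^sup>i\<^sup>z\<^sup>\<zeta> \<phi>(z) dz\<close> has the inverse \<open>(1/2\<pi>) \<integral> e\<^sup>i\<^sup>z\<^sup>\<zeta> \<phi>(\<zeta>) d\<zeta>\<close>.\<close>

definition inv_fourier_fun :: "(plane \<Rightarrow> complex) \<Rightarrow> plane \<Rightarrow> complex" where
  "inv_fourier_fun \<phi> z = (LINT \<zeta>|lborel. cis (z \<bullet> \<zeta>) * \<phi> \<zeta>) / complex_of_real (2 * pi)"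

text \<open>The inverse Fourier transform of the distribution given by a function \<open>g\<close>, by duality.\<close>

definition inv_fourier :: "(plane \<Rightarrow> complex) \<Rightarrow> distr" where
  "inv_fourier g = (\<lambda>\<phi>. if \<phi> \<in> schwartz
     then (LINT \<zeta>|lborel. g \<zeta> * inv_fourier_fun \<phi> \<zeta>) else 0)"

text \<open>\<open>u\<close> is a tempered distribution whose Fourier transform is the function \<open>g\<close>;
  such a \<open>g\<close> is unique up to a null set.\<close>

definition has_fourier :: "distr \<Rightarrow> (plane \<Rightarrow> complex) \<Rightarrow> bool" where
  "has_fourier u g \<longleftrightarrow> g \<in> borel_measurable lborel \<and>
     (\<forall>\<phi>\<in>schwartz. integrable lborel (\<lambda>\<zeta>. g \<zeta> * inv_fourier_fun \<phi> \<zeta>)) \<and>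
     u = inv_fourier g"

definition fourier :: "distr \<Rightarrow> plane \<Rightarrow> complex" where
  "fourier u = (SOME g. has_fourier u g)"

definition multiplier :: "(plane \<Rightarrow> complex) \<Rightarrow> distr \<Rightarrow> distr" where
  "multiplier m u = inv_fourier (\<lambda>\<zeta>. m \<zeta> * fourier u \<zeta>)"


section \<open>Sobolev spaces\<close>

definition sob_space :: "real \<Rightarrow> distr set" where
  "sob_space s = {u. (\<exists>g. has_fourier u g) \<and>
     integrable lborel (\<lambda>(\<xi>, \<eta>). ((1 + \<bar>\<xi>\<bar>) powr s * cmod (fourier u (\<xi>, \<eta>)))\<^sup>2)}"

definition sob_norm :: "real \<Rightarrow> distr \<Rightarrow> real" where
  "sob_norm s u =
     sqrt (LINT (\<xi>, \<eta>)|lborel. ((1 + \<bar>\<xi>\<bar>) powr s * cmod (fourier u (\<xi>, \<eta>)))\<^sup>2)"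

text \<open>The isotropic norms of \<open>H\<^sup>n\<close>, and the space of functions lying in every \<open>H\<^sup>n\<close>. By Sobolev
  embedding such a function has a unique continuous representative, which is bounded.\<close>

definition iso_norm :: "nat \<Rightarrow> distr \<Rightarrow> real" where
  "iso_norm n u = sqrt (LINT \<zeta>|lborel. ((1 + norm \<zeta>) ^ n * cmod (fourier u \<zeta>))\<^sup>2)"

definition H_inf :: "(plane \<Rightarrow> complex) set" where
  "H_inf = {v. continuous_on UNIV v \<and> bounded (range v) \<and> (\<exists>g. has_fourier (regular v) g) \<and>
     (\<forall>n. integrable lborel (\<lambda>\<zeta>. ((1 + norm \<zeta>) ^ n * cmod (fourier (regular v) \<zeta>))\<^sup>2))}"


section \<open>The integral equation and its solution map\<close>

definition W :: "real \<Rightarrow> real \<Rightarrow> real \<Rightarrow> distr \<Rightarrow> distr" where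
  "W \<beta> \<gamma> t = multiplier (\<lambda>(\<xi>, \<eta>). exp (\<i> * complex_of_real (t * (- \<beta> * \<xi> ^ 3 - (\<eta>\<^sup>2 + \<gamma>) / \<xi>))))"

text \<open>Solutions in \<open>C([0,T]; H\<^sup>\<infinity>)\<close>, for which \<open>u\<^sup>2\<close> is the pointwise square. The time integral
  is the weak one, i.e. taken after pairing with test functions.\<close>

definition smooth_solution ::
    "real \<Rightarrow> real \<Rightarrow> real \<Rightarrow> (plane \<Rightarrow> complex) \<Rightarrow> (real \<Rightarrow> plane \<Rightarrow> complex) \<Rightarrow> bool" where
  "smooth_solution \<beta> \<gamma> T u0 u \<longleftrightarrow>
     (\<forall>t\<in>{0..T}. u t \<in> H_inf) \<and>
     (\<forall>n. \<forall>t\<in>{0..T}.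
        ((\<lambda>\<tau>. iso_norm n (regular (u \<tau>) - regular (u t))) \<longlongrightarrow> 0) (at t within {0..T})) \<and>
     (\<forall>t\<in>{0..T}. \<forall>\<phi>\<in>schwartz.
        set_integrable lborel {0..t}
          (\<lambda>\<tau>. W \<beta> \<gamma> (t - \<tau>) (ddx (regular (\<lambda>z. (u \<tau> z)\<^sup>2))) \<phi>) \<and>
        regular (u t) \<phi> = W \<beta> \<gamma> t (regular u0) \<phi> -
          (LINT \<tau>:{0..t}|lborel. W \<beta> \<gamma> (t - \<tau>) (ddx (regular (\<lambda>z. (u \<tau> z)\<^sup>2))) \<phi>))"

text \<open>For \<open>s < 0\<close> the square of a general element of \<open>H\<^sup>s\<^sup>,\<^sup>0\<close> is undefined, so \<open>S u0 t\<close> is pinned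
  down on the \<open>H\<^sup>\<infinity>\<close> data in a ball of \<open>H\<^sup>s\<^sup>,\<^sup>0\<close>, which are dense there: such data have a solution
  on \<open>[0,T]\<close>, it is unique, and \<open>S u0 t\<close> is its value at time \<open>t\<close>. A map that is continuous on a
  ball of \<open>H\<^sup>s\<^sup>,\<^sup>0\<close> is determined there by these values.\<close>

definition solution_map ::
    "real \<Rightarrow> real \<Rightarrow> real \<Rightarrow> real \<Rightarrow> (distr \<Rightarrow> real \<Rightarrow> distr) \<Rightarrow> bool" where
  "solution_map \<beta> \<gamma> s T S \<longleftrightarrow>
     (\<exists>r>0. \<forall>u0\<in>H_inf. regular u0 \<in> sob_space s \<and> sob_norm s (regular u0) < r \<longrightarrow>
        (\<exists>u. smooth_solution \<beta> \<gamma> T u0 u) \<and>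
        (\<forall>u. smooth_solution \<beta> \<gamma> T u0 u \<longrightarrow> (\<forall>t\<in>{0..T}. S (regular u0) t = regular (u t))))"


section \<open>Frechet derivatives on normed spaces given by a carrier and a norm\<close>

definition bounded_linear_maps ::
    "'a::real_vector set \<Rightarrow> ('a \<Rightarrow> real) \<Rightarrow> 'b::real_vector set \<Rightarrow> ('b \<Rightarrow> real) \<Rightarrow> ('a \<Rightarrow> 'b) set" where
  "bounded_linear_maps V N Y M = {A. (\<forall>x\<in>V. A x \<in> Y) \<and>
     (\<forall>x\<in>V. \<forall>y\<in>V. A (x + y) = A x + A y) \<and> (\<forall>c. \<forall>x\<in>V. A (c *\<^sub>R x) = c *\<^sub>R A x) \<and>
     (\<exists>C. \<forall>x\<in>V. M (A x) \<le> C * N x)}"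

definition op_norm :: "'a set \<Rightarrow> ('a \<Rightarrow> real) \<Rightarrow> ('b \<Rightarrow> real) \<Rightarrow> ('a \<Rightarrow> 'b) \<Rightarrow> real" where
  "op_norm V N M A = Inf {C. 0 \<le> C \<and> (\<forall>x\<in>V. M (A x) \<le> C * N x)}"

definition has_frechet ::
    "'a::real_vector set \<Rightarrow> ('a \<Rightarrow> real) \<Rightarrow> 'b::real_vector set \<Rightarrow> ('b \<Rightarrow> real) \<Rightarrow>
     ('a \<Rightarrow> 'b) \<Rightarrow> ('a \<Rightarrow> 'b) \<Rightarrow> 'a \<Rightarrow> bool" where
  "has_frechet V N Y M f A x \<longleftrightarrow> A \<in> bounded_linear_maps V N Y M \<and>
     (\<forall>e>0. \<exists>d>0. \<forall>h\<in>V. N h < d \<longrightarrow> M (f (x + h) - f x - A h) \<le> e * N h)"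

text \<open>The derivatives up to order three exist near zero and the third is continuous at zero;
  in particular this holds if the map is of class \<open>C\<^sup>3\<close> in a neighbourhood of zero.\<close>

definition C3_at_zero :: "'a::real_vector set \<Rightarrow> ('a \<Rightarrow> real) \<Rightarrow> ('a \<Rightarrow> 'a) \<Rightarrow> bool" where
  "C3_at_zero V N f \<longleftrightarrow>
     (let L1 = bounded_linear_maps V N V N; N1 = op_norm V N N;
          L2 = bounded_linear_maps V N L1 N1; N2 = op_norm V N N1;
          N3 = op_norm V N N2
      in \<exists>r>0. \<exists>D1 D2 D3.
        (\<forall>x\<in>V. N x < r \<longrightarrow> f x \<in> V \<and>
           has_frechet V N V N f (D1 x) x \<and>
           has_frechet V N L1 N1 D1 (D2 x) x \<and>
           has_frechet V N L2 N2 D2 (D3 x) x) \<and>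
        (\<forall>e>0. \<exists>d>0. \<forall>x\<in>V. N x < d \<longrightarrow> N3 (D3 x - D3 0) \<le> e))"

end

theory Submission
  imports Defs "HOL-Probability.Probability"
begin

text \<open>
  Assume that for some \<open>T\<close> the solution map at time \<open>T\<close> is of class \<open>C\<^sup>3\<close> at zero. Its third derivative
  there is a bounded trilinear map, so along every line \<open>\<delta> v\<close> the third-order coefficient of the
  solution, tested against an element of the dual weighted space, is at most a constant times
  \<open>\<parallel>v\<parallel>\<^sup>3\<close> (\<open>C3_at_zero_coefficient_bound\<close>). The proof exhibits data that violate this bound.

  Everything is computed on the Fourier side. For a bounded, compactly supported transform \<open>f\<close> the
  solution with data \<open>\<delta> f\<close> is a power series in \<open>\<delta>\<close> whose coefficients are the Picard iterates
  \<open>iterate p f n\<close>. The derivative in the nonlinearity costs a factor proportional to \<open>n\<close>, because the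
  \<open>n\<close>-th iterate lives at frequencies up to \<open>n R\<close>; but the \<open>n\<close>-th iterate contains \<open>n - 1\<close> time
  integrations and the last one returns a factor \<open>1 / (n - 1)\<close>. The iterates therefore grow only
  geometrically (\<open>iterate_bound\<close>), and for small \<open>\<delta>\<close> the series converges on all of \<open>[0, T]\<close> to a
  smooth solution (\<open>sol_duhamel\<close>, \<open>smooth_solution_inv_fourier\<close>). A solution map takes the value of
  every smooth solution, so it is given by this series, and the third-order coefficient is
  the third Picard iterate (\<open>third_coefficient_upper_bound\<close>).

  With \<open>b = - \<beta>\<close>, the phase mismatch of two interacting waves with frequencies \<open>(x\<^sub>1, y\<^sub>1)\<close> and
  \<open>(x\<^sub>2, y\<^sub>2)\<close>, where \<open>x = x\<^sub>1 + x\<^sub>2\<close>, is minus the quotient of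
  \<open>3 b (x\<^sub>1 x\<^sub>2 x)\<^sup>2 + (y\<^sub>1 x\<^sub>2 - y\<^sub>2 x\<^sub>1)\<^sup>2 + \<gamma> (x\<^sub>1\<^sup>2 + x\<^sub>1 x\<^sub>2 + x\<^sub>2\<^sup>2)\<close> by \<open>x\<^sub>1 x\<^sub>2 x\<close>. For \<open>\<beta> < 0 < \<gamma>\<close> all terms
  of the numerator have the same sign, so its size can be bounded from both sides. The data are the
  indicator of a box near \<open>N\<close> and of a box near \<open>- N\<close>, of width \<open>\<epsilon> / sqrt N\<close> and height \<open>h sqrt N\<close>.
  On the output box near \<open>N\<close> the third iterate has two kinds of contributions. If the two waves
  near \<open>N\<close> interact first and then meet the one near \<open>- N\<close>, the total phase stays
  bounded, because both the cubic part \<open>N \<epsilon>\<^sup>2 / N\<close> and the part \<open>h\<^sup>2 N / N\<close> are small, and the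
  contributions add up coherently to a multiple of \<open>1 / N\<close> (\<open>kernel_high\<close>). If waves of opposite sign
  interact first, the separation of the boxes in the second variable makes the mismatch so large that
  the contribution is smaller by the factor \<open>(\<epsilon> / h)\<^sup>2\<close> (\<open>kernel_low\<close>). Hence the third coefficient
  is at least a multiple of \<open>1 / N\<close>. As the product of width and height does not depend on \<open>N\<close>, the
  upper bound is a multiple of \<open>N\<^sup>-\<^sup>s N\<^sup>3\<^sup>s\<close>, and \<open>1 / N \<le> K N\<^sup>2\<^sup>s\<close> fails for large \<open>N\<close> when \<open>s < - 1 / 2\<close>.
\<close>

section \<open>Uniqueness for Fourier transforms of integrable functions\<close>


lemma cis_measurable [measurable]: "cis \<in> borel_measurable borel"
  by (intro borel_measurable_continuous_onI continuous_intros)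

lemma cnj_measurable [measurable]: "cnj \<in> borel_measurable borel"
  by (intro borel_measurable_continuous_onI continuous_intros)

lemma plane_fst_measurable [measurable]:
  "(fst :: real \<times> real \<Rightarrow> real) \<in> borel_measurable borel"
  by (intro borel_measurable_continuous_onI continuous_intros)

lemma plane_snd_measurable [measurable]:
  "(snd :: real \<times> real \<Rightarrow> real) \<in> borel_measurable borel"
  by (intro borel_measurable_continuous_onI continuous_intros)

text \<open>The positive and the negative part of the function have the same transform. Divided by
  their common mass they are densities of probability measures with equal characteristic
  functions, and Levy's uniqueness theorem applies.\<close>

lemma fourier_L1_unique_real_fun:
  fixes f :: "real \<Rightarrow> real"
  assumes f: "integrable lborel f"
    and zero: "\<And>t. (LINT x|lborel. cis (t * x) * complex_of_real (f x)) = 0"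
  shows "AE x in lborel. f x = 0"
proof -
  have [measurable]: "f \<in> borel_measurable borel"
    using f by (simp add: borel_measurable_integrable)
  define P where "P = (\<lambda>x. max 0 (f x))"
  define Q where "Q = (\<lambda>x. max 0 (- f x))"
  have [measurable]: "P \<in> borel_measurable borel" "Q \<in> borel_measurable borel"
    unfolding P_def Q_def by measurable
  have PQ: "f x = P x - Q x" "0 \<le> P x" "0 \<le> Q x" for x
    by (auto simp: P_def Q_def)
  have iP: "integrable lborel P" and iQ: "integrable lborel Q"
    unfolding P_def Q_def using f by auto
  have icP: "integrable lborel (\<lambda>x. cis (t * x) * complex_of_real (P x))" for t
    by (rule Bochner_Integration.integrable_bound[OF iP]) (auto simp: norm_mult PQ)
  have icQ: "integrable lborel (\<lambda>x. cis (t * x) * complex_of_real (Q x))" for t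
    by (rule Bochner_Integration.integrable_bound[OF iQ]) (auto simp: norm_mult PQ)
  have eq: "(LINT x|lborel. cis (t * x) * complex_of_real (P x)) =
      (LINT x|lborel. cis (t * x) * complex_of_real (Q x))" for t
    using zero[of t] icP[of t] icQ[of t] by (simp add: PQ algebra_simps)
  define m where "m = (LINT x|lborel. P x)"
  have mQ: "m = (LINT x|lborel. Q x)"
    using eq[of 0] by (simp add: m_def of_real_eq_iff integral_complex_of_real)
  show ?thesis
  proof (cases "m = 0")
    case True
    have "AE x in lborel. P x = 0"
      using integral_nonneg_eq_0_iff_AE[OF iP] True PQ by (auto simp: m_def)
    moreover have "AE x in lborel. Q x = 0"
      using integral_nonneg_eq_0_iff_AE[OF iQ] True PQ by (auto simp: mQ)
    ultimately show ?thesis by eventually_elim (simp add: PQ)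
  next
    case False
    then have m: "m > 0"
      using PQ by (simp add: m_def less_le)
    define D where "D = (\<lambda>g :: real \<Rightarrow> real. density lborel (\<lambda>x. ennreal (g x / m)))"
    have rd: "real_distribution (D g)" if [measurable]: "g \<in> borel_measurable borel"
      and g: "integrable lborel g" "(LINT x|lborel. g x) = m" "\<And>x. 0 \<le> g x" for g
    proof -
      have "emeasure (D g) (space (D g)) = (\<integral>\<^sup>+ x. ennreal (g x / m) \<partial>lborel)"
        by (simp add: D_def emeasure_density)
      also have "\<dots> = ennreal (LINT x|lborel. g x / m)"
        using g m by (intro nn_integral_eq_integral) auto
      finally have "prob_space (D g)" using g m by (intro prob_spaceI) simp
      then show ?thesis
        unfolding real_distribution_def real_distribution_axioms_def
        by (simp add: D_def)
    qed
    have ch: "char (D g) t = (LINT x|lborel. cis (t * x) * complex_of_real (g x)) / m"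
      if [measurable]: "g \<in> borel_measurable borel" and g: "\<And>x. 0 \<le> g x" for g t
    proof -
      have "char (D g) t = (LINT x|lborel. (g x / m) *\<^sub>R iexp (t * x))"
        unfolding char_def D_def using g m by (subst integral_density) auto
      also have "\<dots> = (LINT x|lborel. cis (t * x) * complex_of_real (g x) / m)"
        by (simp add: scaleR_conv_of_real cis_conv_exp mult.commute)
      finally show ?thesis by simp
    qed
    have "D P = D Q"
    proof (rule Levy_uniqueness)
      show "real_distribution (D P)" "real_distribution (D Q)"
        using iP iQ PQ mQ by (auto intro!: rd simp: m_def)
      show "char (D P) = char (D Q)"
        by (rule ext) (simp add: ch PQ eq)
    qed
    then have "AE x in lborel. ennreal (P x / m) = ennreal (Q x / m)"
      unfolding D_def by (subst (asm) sigma_finite_measure.density_unique_iff[OF sigma_finite_lborel]) auto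
    then show ?thesis
      
    proof eventually_elim
      case (elim x)
      have "P x / m = Q x / m" using elim m PQ(2,3)[of x] by (subst (asm) ennreal_inj) auto
      then show "f x = 0" using m PQ(1)[of x] by simp
    qed
  qed
qed

text \<open>Complex conjugation shows that the transforms of the real and of the imaginary part
  vanish as well.\<close>

lemma fourier_L1_unique_line:
  fixes f :: "real \<Rightarrow> complex"
  assumes f: "integrable lborel f"
    and zero: "\<And>t. (LINT x|lborel. cis (t * x) * f x) = 0"
  shows "AE x in lborel. f x = 0"
proof -
  have [measurable]: "f \<in> borel_measurable borel"
    using f by (simp add: borel_measurable_integrable)
  have i: "integrable lborel (\<lambda>x. cis (t * x) * f x)" for t
    by (rule Bochner_Integration.integrable_bound[OF f]) (auto simp: norm_mult)
  have i': "integrable lborel (\<lambda>x. cis (t * x) * cnj (f x))" for t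
    by (rule Bochner_Integration.integrable_bound[OF f]) (auto simp: norm_mult)
  have c: "(LINT x|lborel. cis (t * x) * cnj (f x)) = 0" for t
  proof -
    have "(LINT x|lborel. cis (t * x) * cnj (f x)) = cnj (LINT x|lborel. cis (- t * x) * f x)"
      using integral_bounded_linear[OF bounded_linear_cnj i[of "- t"]] by (simp add: cis_cnj)
    then show ?thesis using zero[of "- t"] by simp
  qed
  have "AE x in lborel. Re (f x) = 0"
  proof (rule fourier_L1_unique_real_fun)
    fix t
    have "(LINT x|lborel. cis (t * x) * complex_of_real (Re (f x)))
       = (LINT x|lborel. (cis (t * x) * f x + cis (t * x) * cnj (f x)) / 2)"
      by (intro Bochner_Integration.integral_cong refl)
         (simp add: complex_add_cnj flip: distrib_left)
    then show "(LINT x|lborel. cis (t * x) * complex_of_real (Re (f x))) = 0"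
      using i i' zero c by simp
  qed (use f in auto)
  moreover have "AE x in lborel. Im (f x) = 0"
  proof (rule fourier_L1_unique_real_fun)
    fix t
    have k: "complex_of_real (Im z) = (z - cnj z) / (2 * \<i>)" for z
      by (simp add: complex_diff_cnj complex_eq_iff)
    have "(LINT x|lborel. cis (t * x) * complex_of_real (Im (f x)))
       = (LINT x|lborel. (cis (t * x) * f x - cis (t * x) * cnj (f x)) / (2 * \<i>))"
      by (intro Bochner_Integration.integral_cong refl)
         (simp add: k right_diff_distrib)
    then show "(LINT x|lborel. cis (t * x) * complex_of_real (Im (f x))) = 0"
      using i i' zero c by simp
  qed (use f in auto)
  ultimately show ?thesis by eventually_elim (simp add: complex_eq_iff)
qed

lemma integral_plane_iterated:
  fixes f :: "real \<times> real \<Rightarrow> complex"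
  assumes "integrable lborel f"
  shows "(LINT z|lborel. f z) = (LINT x|lborel. LINT y|lborel. f (x, y))"
    and "(LINT z|lborel. f z) = (LINT y|lborel. LINT x|lborel. f (x, y))"
    and "integrable lborel (\<lambda>x. LINT y|lborel. f (x, y))"
    and "integrable lborel (\<lambda>y. LINT x|lborel. f (x, y))"
proof -
  have *: "integrable (lborel \<Otimes>\<^sub>M lborel) (case_prod (\<lambda>x y. f (x, y)))"
    using assms by (simp add: lborel_prod)
  show "(LINT z|lborel. f z) = (LINT x|lborel. LINT y|lborel. f (x, y))"
    using lborel_pair.integral_fst[OF *] by (simp add: lborel_prod)
  show "(LINT z|lborel. f z) = (LINT y|lborel. LINT x|lborel. f (x, y))"
    using lborel_pair.integral_snd[OF *] by (simp add: lborel_prod)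
  show "integrable lborel (\<lambda>x. LINT y|lborel. f (x, y))"
    using lborel_pair.integrable_fst[OF *] by simp
  show "integrable lborel (\<lambda>y. LINT x|lborel. f (x, y))"
    using lborel_pair.integrable_snd[OF *] by simp
qed

text \<open>The measurable rectangles are closed under intersection and generate the Borel sets of
  the plane, so the integral over every Borel set vanishes.\<close>

lemma AE_zero_if_rectangles:
  fixes h :: "real \<times> real \<Rightarrow> real"
  assumes h: "integrable lborel h"
    and rect: "\<And>A B. A \<in> sets borel \<Longrightarrow> B \<in> sets borel \<Longrightarrow> (LINT z:A \<times> B|lborel. h z) = 0"
  shows "AE z in lborel. h z = 0"
proof (rule density_unique_real[OF h, where f' = "\<lambda>_. 0"])
  have [measurable]: "h \<in> borel_measurable borel"
    using h by (simp add: borel_measurable_integrable)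
  have si: "set_integrable lborel A h" if "A \<in> sets borel" for A
    unfolding set_integrable_def using h that by (intro integrable_mult_indicator) auto
  fix A :: "(real \<times> real) set" assume "A \<in> sets lborel"
  let ?R = "{a \<times> b |a b. a \<in> sets (borel :: real measure) \<and> b \<in> sets (borel :: real measure)}"
  have R: "Int_stable ?R" "?R \<subseteq> Pow UNIV"
    by (auto simp: Int_stable_def Times_Int_Times) (metis sets.Int)
  have "A \<in> sigma_sets UNIV ?R"
    using \<open>A \<in> sets lborel\<close> sets_pair_measure[of "borel :: real measure" "borel :: real measure"]
    by (simp add: borel_prod[symmetric])
  from R this have "A \<in> sets borel \<and> (LINT z:A|lborel. h z) = 0"
  proof (induction rule: sigma_sets_induct_disjoint)
    case (basic A)
    then show ?case using rect by (auto simp: borel_prod[symmetric])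
  next
    case empty
    then show ?case by (simp add: set_lebesgue_integral_def)
  next
    case (compl A)
    have "(LINT z:UNIV|lborel. h z) = (LINT z:UNIV - A|lborel. h z) + (LINT z:A|lborel. h z)"
    proof -
      have "set_integrable lborel (UNIV - A) h" "set_integrable lborel A h"
        using compl by (intro si; auto)+
      then show ?thesis using set_integral_Un[of "UNIV - A" A lborel h] by (simp add: Int_commute)
    qed
    moreover have "(LINT z:UNIV|lborel. h z) = 0"
      using rect[of UNIV UNIV] by simp
    ultimately show ?case using compl by auto
  next
    case (union A)
    have "(LINT z:(\<Union>i. A i)|lborel. h z) = (\<Sum>i. (LINT z:A i|lborel. h z))"
      using union by (intro lebesgue_integral_countable_add si) (auto simp: disjoint_family_on_def)
    with union show ?case by auto
  qed
  then show "(LINT z:A|lborel. h z) = (LINT z:A|lborel. 0)"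
    by (simp add: set_lebesgue_integral_def)
qed auto

text \<open>One variable at a time: with the second frequency \<open>b\<close> fixed, the partial
  transform in \<open>y\<close> vanishes for almost every \<open>x\<close>. Integrating it over a
  set \<open>A\<close> of values of \<open>x\<close> gives a function of \<open>y\<close> alone
  whose transform vanishes at every \<open>b\<close>.\<close>

lemma fourier_L1_unique_plane:
  fixes h :: "real \<times> real \<Rightarrow> complex"
  assumes h: "integrable lborel h"
    and zero: "\<And>b. (LINT z|lborel. cis (b \<bullet> z) * h z) = 0"
  shows "AE z in lborel. h z = 0"
proof -
  have [measurable]: "h \<in> borel_measurable borel"
    using h by (simp add: borel_measurable_integrable)
  have strip: "AE x in lborel. (LINT y|lborel. cis (b * y) * h (x, y)) = 0" for b
  proof (rule fourier_L1_unique_line)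
    have i: "integrable lborel (\<lambda>z. cis (b * snd z) * h z)"
      by (rule Bochner_Integration.integrable_bound[OF h]) (auto simp: norm_mult)
    from integral_plane_iterated(3)[OF this]
    show "integrable lborel (\<lambda>x. LINT y|lborel. cis (b * y) * h (x, y))" by simp
    fix a
    have i: "integrable lborel (\<lambda>z. cis ((a, b) \<bullet> z) * h z)"
      by (rule Bochner_Integration.integrable_bound[OF h]) (auto simp: norm_mult)
    have "0 = (LINT x|lborel. LINT y|lborel. cis ((a, b) \<bullet> (x, y)) * h (x, y))"
      using zero[of "(a, b)"] integral_plane_iterated(1)[OF i] by simp
    also have "\<dots> = (LINT x|lborel. cis (a * x) * (LINT y|lborel. cis (b * y) * h (x, y)))"
      by (simp add: mult.assoc flip: cis_mult)
    finally show "(LINT x|lborel. cis (a * x) * (LINT y|lborel. cis (b * y) * h (x, y))) = 0"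
      by simp
  qed
  have A0: "AE y in lborel. (LINT x|lborel. indicator A x * h (x, y)) = 0" if [measurable]: "A \<in> sets borel" for A :: "real set"
  proof (rule fourier_L1_unique_line)
    have i0: "integrable lborel (\<lambda>z. indicator A (fst z) * h z)"
      by (rule Bochner_Integration.integrable_bound[OF h]) (auto simp: norm_mult indicator_def)
    from integral_plane_iterated(4)[OF this]
    show "integrable lborel (\<lambda>y. LINT x|lborel. indicator A x * h (x, y))" by simp
    fix b
    have i: "integrable lborel (\<lambda>z. cis (b * snd z) * (indicator A (fst z) * h z))"
      by (rule Bochner_Integration.integrable_bound[OF h]) (auto simp: norm_mult indicator_def)
    have "(LINT y|lborel. cis (b * y) * (LINT x|lborel. indicator A x * h (x, y)))
       = (LINT x|lborel. LINT y|lborel. cis (b * y) * (indicator A x * h (x, y)))"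
      using integral_plane_iterated(1,2)[OF i] by simp
    also have "\<dots> = (LINT x|lborel. indicator A x * (LINT y|lborel. cis (b * y) * h (x, y)))"
      by (simp only: mult.left_commute integral_mult_right_zero)
    also have "\<dots> = 0"
      using strip[of b] by (intro integral_eq_zero_AE) auto
    finally show "(LINT y|lborel. cis (b * y) * (LINT x|lborel. indicator A x * h (x, y))) = 0" .
  qed
  have rect: "(LINT z|lborel. indicator (A \<times> B) z *\<^sub>R h z) = 0"
    if [measurable]: "A \<in> sets borel" "B \<in> sets borel" for A B :: "real set"
  proof -
    have i: "integrable lborel (\<lambda>z. indicator B (snd z) * (indicator A (fst z) * h z))"
      by (rule Bochner_Integration.integrable_bound[OF h]) (auto simp: norm_mult indicator_def)
    have "(LINT z|lborel. indicator (A \<times> B) z *\<^sub>R h z) =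
       (LINT z|lborel. indicator B (snd z) * (indicator A (fst z) * h z))"
      by (intro Bochner_Integration.integral_cong) (auto simp: indicator_def)
    also have "\<dots> = (LINT y|lborel. indicator B y * (LINT x|lborel. indicator A x * h (x, y)))"
      using integral_plane_iterated(2)[OF i] by simp
    also have "\<dots> = 0"
      using A0[of A] by (intro integral_eq_zero_AE) auto
    finally show ?thesis .
  qed
  have i: "integrable lborel (\<lambda>z. indicator (A \<times> B) z *\<^sub>R h z)"
    if [measurable]: "A \<in> sets borel" "B \<in> sets borel" for A B :: "real set"
  proof (rule Bochner_Integration.integrable_bound[OF h])
    have [measurable]: "A \<times> B \<in> sets borel" using that by (simp add: borel_prod[symmetric])
    show "(\<lambda>z. indicator (A \<times> B) z *\<^sub>R h z) \<in> borel_measurable lborel" by measurable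
  qed (auto simp: indicator_def)
  have "AE z in lborel. Re (h z) = 0"
  proof (rule AE_zero_if_rectangles)
    fix A B :: "real set" assume AB: "A \<in> sets borel" "B \<in> sets borel"
    show "(LINT z:A \<times> B|lborel. Re (h z)) = 0"
      using integral_Re[OF i[OF AB]] rect[OF AB] by (simp add: set_lebesgue_integral_def)
  qed (use h in auto)
  moreover have "AE z in lborel. Im (h z) = 0"
  proof (rule AE_zero_if_rectangles)
    fix A B :: "real set" assume AB: "A \<in> sets borel" "B \<in> sets borel"
    show "(LINT z:A \<times> B|lborel. Im (h z)) = 0"
      using integral_Im[OF i[OF AB]] rect[OF AB] by (simp add: set_lebesgue_integral_def)
  qed (use h in auto)
  ultimately show ?thesis by eventually_elim (simp add: complex_eq_iff)
qed


lemma integrable_tensor: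
  fixes f :: "'a::euclidean_space \<Rightarrow> 'c::{real_normed_field, banach, second_countable_topology}"
    and g :: "'b::euclidean_space \<Rightarrow> 'c"
  assumes f: "integrable lborel f" and g: "integrable lborel g"
  shows "integrable (lborel \<Otimes>\<^sub>M lborel) (\<lambda>z. f (fst z) * g (snd z))"
proof (rule lborel_pair.Fubini_integrable)
  have [measurable]: "f \<in> borel_measurable borel" "g \<in> borel_measurable borel"
    using f g by (auto simp: borel_measurable_integrable)
  show "(\<lambda>z. f (fst z) * g (snd z)) \<in> borel_measurable (lborel \<Otimes>\<^sub>M lborel)"
    by measurable
  show "integrable lborel (\<lambda>x. LINT y|lborel. norm (f (fst (x, y)) * g (snd (x, y))))"
    using f by (simp add: norm_mult)
  show "AE x in lborel. integrable lborel (\<lambda>y. f (fst (x, y)) * g (snd (x, y)))"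
    using g by simp
qed

section \<open>Test functions\<close>

lemma schwartzE:
  assumes "\<phi> \<in> schwartz"
  obtains D :: "nat \<Rightarrow> nat \<Rightarrow> plane \<Rightarrow> complex" where "D 0 0 = \<phi>"
    "\<And>j k x y. ((\<lambda>s. D j k (s, y)) has_vector_derivative D (Suc j) k (x, y)) (at x)"
    "\<And>j k x y. ((\<lambda>s. D j k (x, s)) has_vector_derivative D j (Suc k) (x, y)) (at y)"
    "\<And>j k m n. bounded (range (\<lambda>(x, y). complex_of_real (x ^ m * y ^ n) * D j k (x, y)))"
  using assms unfolding schwartz_def by blast

lemma schwartz_decay:
  assumes "\<phi> \<in> schwartz"
  obtains C where "\<And>x y. norm (\<phi> (x, y)) \<le> C * (inverse (1 + x\<^sup>2) * inverse (1 + y\<^sup>2))"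
proof -
  have D: "bounded (range (\<lambda>(x, y). complex_of_real (x ^ m * y ^ n) * \<phi> (x, y)))" for m n
    using assms by (auto elim: schwartzE)
  have "\<exists>C. \<forall>x y. \<bar>x ^ m * y ^ n\<bar> * norm (\<phi> (x, y)) \<le> C" for m n
  proof -
    obtain a where "\<And>z. z \<in> range (\<lambda>(x, y). complex_of_real (x ^ m * y ^ n) * \<phi> (x, y)) \<Longrightarrow> norm z \<le> a"
      using D[of m n] unfolding bounded_iff by blast
    from this[OF rangeI, of "(_, _)"] show ?thesis
      by (intro exI[of _ a]) (simp add: norm_mult norm_power abs_mult power_abs)
  qed
  then obtain C where C: "\<And>m n x y. \<bar>x ^ m * y ^ n\<bar> * norm (\<phi> (x, y)) \<le> C m n"
    by metis
  show ?thesis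
  proof
    fix x y :: real
    have "(1 + x\<^sup>2) * (1 + y\<^sup>2) * norm (\<phi> (x, y)) \<le> C 0 0 + C 2 0 + C 0 2 + C 2 2"
      using C[of x 0 y 0] C[of x 2 y 0] C[of x 0 y 2] C[of x 2 y 2]
      by (simp add: abs_mult algebra_simps)
    moreover have "0 < (1 + x\<^sup>2) * (1 + y\<^sup>2)"
      by (intro mult_pos_pos add_pos_nonneg) auto
    ultimately show "norm (\<phi> (x, y)) \<le> (C 0 0 + C 2 0 + C 0 2 + C 2 2) *
        (inverse (1 + x\<^sup>2) * inverse (1 + y\<^sup>2))"
      by (simp add: field_simps)
  qed
qed

lemma bounded_derivative_imp_lipschitz:
  fixes f :: "real \<Rightarrow> complex"
  assumes "\<And>x. (f has_vector_derivative f' x) (at x)" "\<And>x. norm (f' x) \<le> M"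
  shows "norm (f x - f y) \<le> M * \<bar>x - y\<bar>"
proof -
  have "norm (f x - f y) \<le> M * norm (x - y)"
  proof (rule differentiable_bound[of UNIV])
    show "(f has_derivative (\<lambda>h. h *\<^sub>R f' x)) (at x within UNIV)" for x
      using assms(1)[of x] by (simp add: has_vector_derivative_def)
    show "onorm (\<lambda>h. h *\<^sub>R f' x) \<le> M" for x
      using assms(2)[of x] by (intro onorm_le) (simp add: mult.commute[of M] mult_left_mono)
  qed auto
  then show ?thesis by simp
qed

lemma schwartz_continuous:
  assumes "\<phi> \<in> schwartz"
  shows "continuous_on UNIV \<phi>"
proof -
  obtain D where D: "D 0 0 = \<phi>"
    "\<And>j k x y. ((\<lambda>s. D j k (s, y)) has_vector_derivative D (Suc j) k (x, y)) (at x)"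
    "\<And>j k x y. ((\<lambda>s. D j k (x, s)) has_vector_derivative D j (Suc k) (x, y)) (at y)"
    "\<And>j k m n. bounded (range (\<lambda>(x, y). complex_of_real (x ^ m * y ^ n) * D j k (x, y)))"
    using assms by (rule schwartzE) blast
  have "\<exists>C. \<forall>z. norm (D j k z) \<le> C" for j k
    using D(4)[of 0 0 j k] by (simp add: bounded_iff case_prod_beta)
  then obtain C where C: "\<And>j k z. norm (D j k z) \<le> C j k" by metis
  define M where "M = max (C 1 0) (C 0 1)"
  have M: "norm (D 1 0 z) \<le> M" "norm (D 0 1 z) \<le> M" for z
    using C[of 1 0 z] C[of 0 1 z] by (auto simp: M_def)
  then have M0: "0 \<le> M" using norm_ge_zero order_trans by blast
  have "(2 * M)-lipschitz_on UNIV \<phi>"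
  proof (rule lipschitz_onI)
    fix z w :: plane
    obtain x y where z: "z = (x, y)" by (cases z)
    obtain x' y' where w: "w = (x', y')" by (cases w)
    have "norm (\<phi> (x, y) - \<phi> (x', y)) \<le> M * \<bar>x - x'\<bar>"
      by (rule bounded_derivative_imp_lipschitz[where f' = "\<lambda>x. D 1 0 (x, y)"])
         (use D(2)[of 0 0 y] M D(1) in auto)
    moreover have "norm (\<phi> (x', y) - \<phi> (x', y')) \<le> M * \<bar>y - y'\<bar>"
      by (rule bounded_derivative_imp_lipschitz[where f' = "\<lambda>y. D 0 1 (x', y)"])
         (use D(3)[of 0 0 x'] M D(1) in auto)
    ultimately have "norm (\<phi> z - \<phi> w) \<le> M * \<bar>x - x'\<bar> + M * \<bar>y - y'\<bar>"
      using norm_triangle_ineq[of "\<phi> (x, y) - \<phi> (x', y)" "\<phi> (x', y) - \<phi> (x', y')"]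
      by (simp add: z w)
    also have "\<dots> \<le> M * dist z w + M * dist z w"
      using dist_fst_le[of z w] dist_snd_le[of z w] M0
      by (intro add_mono mult_left_mono) (auto simp: z w dist_real_def)
    finally show "dist (\<phi> z) (\<phi> w) \<le> 2 * M * dist z w" by (simp add: dist_norm)
  qed (use M0 in auto)
  then show ?thesis by (rule lipschitz_on_continuous_on)
qed

lemma schwartz_measurable: "\<phi> \<in> schwartz \<Longrightarrow> \<phi> \<in> borel_measurable borel"
  using schwartz_continuous by (rule borel_measurable_continuous_onI)

lemma integrable_inverse_one_plus_square: "integrable lborel (\<lambda>x::real. inverse (1 + x\<^sup>2))"
  using integrable_inverse_1_plus_square by (simp add: set_integrable_def)

lemma schwartz_integrable:
  assumes "\<phi> \<in> schwartz"
  shows "integrable lborel \<phi>"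
proof -
  obtain C where C: "\<And>x y. norm (\<phi> (x, y)) \<le> C * (inverse (1 + x\<^sup>2) * inverse (1 + y\<^sup>2))"
    using schwartz_decay[OF assms] by blast
  have "integrable lborel (\<lambda>z::plane. C * (inverse (1 + (fst z)\<^sup>2) * inverse (1 + (snd z)\<^sup>2)))"
    using integrable_tensor[OF integrable_inverse_one_plus_square integrable_inverse_one_plus_square]
    by (simp add: lborel_prod)
  moreover have "\<phi> \<in> borel_measurable lborel"
    using schwartz_measurable[OF assms] by simp
  ultimately show ?thesis
  proof (rule Bochner_Integration.integrable_bound)
    show "AE z in lborel. norm (\<phi> z) \<le> norm (C * (inverse (1 + (fst z)\<^sup>2) * inverse (1 + (snd z)\<^sup>2)))"
      using C by (intro AE_I2) (metis abs_ge_self dual_order.trans prod.collapse real_norm_def)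
  qed
qed

definition partial_x :: "(plane \<Rightarrow> complex) \<Rightarrow> plane \<Rightarrow> complex" where
  "partial_x \<phi> = (\<lambda>(x, y). vector_derivative (\<lambda>s. \<phi> (s, y)) (at x))"

lemma
  assumes "\<phi> \<in> schwartz"
  shows schwartz_partial_x: "partial_x \<phi> \<in> schwartz"
    and schwartz_has_partial_x:
      "\<And>x y. ((\<lambda>s. \<phi> (s, y)) has_vector_derivative partial_x \<phi> (x, y)) (at x)"
proof -
  obtain D where D: "D 0 0 = \<phi>"
    "\<And>j k x y. ((\<lambda>s. D j k (s, y)) has_vector_derivative D (Suc j) k (x, y)) (at x)"
    "\<And>j k x y. ((\<lambda>s. D j k (x, s)) has_vector_derivative D j (Suc k) (x, y)) (at y)"
    "\<And>j k m n. bounded (range (\<lambda>(x, y). complex_of_real (x ^ m * y ^ n) * D j k (x, y)))"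
    using assms by (rule schwartzE) blast
  have eq: "partial_x \<phi> = D 1 0"
    using vector_derivative_at[OF D(2)[of 0 0]] D(1) by (auto simp: partial_x_def fun_eq_iff)
  show "partial_x \<phi> \<in> schwartz"
    unfolding schwartz_def
    by (rule CollectI, rule exI[of _ "\<lambda>j k. D (Suc j) k"]) (use D eq in auto)
  show "((\<lambda>s. \<phi> (s, y)) has_vector_derivative partial_x \<phi> (x, y)) (at x)" for x y
    using D(2)[of 0 0 y x] by (simp add: eq D(1))
qed

lemma inv_fourier_fun_bound:
  "norm (inv_fourier_fun g z) \<le> (LINT \<zeta>|lborel. norm (g \<zeta>)) / (2 * pi)"
proof -
  have "norm (LINT \<zeta>|lborel. cis (z \<bullet> \<zeta>) * g \<zeta>) \<le> (LINT \<zeta>|lborel. norm (cis (z \<bullet> \<zeta>) * g \<zeta>))"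
    by (rule integral_norm_bound)
  then show ?thesis by (simp add: inv_fourier_fun_def norm_divide norm_mult divide_right_mono)
qed

lemma inv_fourier_fun_measurable [measurable]:
  assumes [measurable]: "g \<in> borel_measurable borel"
  shows "inv_fourier_fun g \<in> borel_measurable borel"
  unfolding inv_fourier_fun_def by measurable

lemma inv_fourier_fun_continuous:
  assumes g: "integrable lborel g"
  shows "continuous_on UNIV (inv_fourier_fun g)"
proof -
  have [measurable]: "g \<in> borel_measurable borel"
    using g by (simp add: borel_measurable_integrable)
  have "continuous_on UNIV (\<lambda>z. LINT \<zeta>|lborel. cis (z \<bullet> \<zeta>) * g \<zeta>)"
    unfolding continuous_on_sequentially comp_def
  proof (intro ballI allI impI, elim conjE)
    fix z :: "nat \<Rightarrow> plane" and a
    assume "z \<longlonglongrightarrow> a"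
    have c: "(\<lambda>n. cis (z n \<bullet> \<zeta>) * g \<zeta>) \<longlonglongrightarrow> cis (a \<bullet> \<zeta>) * g \<zeta>" for \<zeta>
    proof -
      have "continuous_on UNIV (\<lambda>z. cis (z \<bullet> \<zeta>) * g \<zeta>)"
        by (intro continuous_intros)
      then show ?thesis using \<open>z \<longlonglongrightarrow> a\<close>
        by (rule continuous_on_tendsto_compose) auto
    qed
    show "(\<lambda>n. LINT \<zeta>|lborel. cis (z n \<bullet> \<zeta>) * g \<zeta>) \<longlonglongrightarrow> (LINT \<zeta>|lborel. cis (a \<bullet> \<zeta>) * g \<zeta>)"
      by (rule integral_dominated_convergence[where w = "\<lambda>\<zeta>. norm (g \<zeta>)"])
         (use c g in \<open>auto simp: norm_mult\<close>)
  qed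
  then show ?thesis unfolding inv_fourier_fun_def by (intro continuous_intros) auto
qed

text \<open>Integration by parts: the boundary terms vanish by the decay of test functions.\<close>

lemma inv_fourier_fun_partial_x:
  assumes \<phi>: "\<phi> \<in> schwartz"
  shows "inv_fourier_fun (partial_x \<phi>) (\<xi>, \<eta>) = - \<i> * of_real \<xi> * inv_fourier_fun \<phi> (\<xi>, \<eta>)"
proof -
  have [measurable]: "\<phi> \<in> borel_measurable borel" "partial_x \<phi> \<in> borel_measurable borel"
    using \<phi> schwartz_measurable schwartz_partial_x by auto
  obtain C where C: "\<And>x y. norm (\<phi> (x, y)) \<le> C * (inverse (1 + x\<^sup>2) * inverse (1 + y\<^sup>2))"
    using schwartz_decay[OF \<phi>] by blast
  obtain C' where C': "\<And>x y. norm (partial_x \<phi> (x, y)) \<le> C' * (inverse (1 + x\<^sup>2) * inverse (1 + y\<^sup>2))"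
    using schwartz_decay[OF schwartz_partial_x[OF \<phi>]] by blast
  define e where "e = (\<lambda>x y. cis ((\<xi>, \<eta>) \<bullet> (x, y)))"
  have line_int: "integrable lborel (\<lambda>x. e x y * h (x, y))"
    if h: "\<And>x y. norm (h (x, y)) \<le> K * (inverse (1 + x\<^sup>2) * inverse (1 + y\<^sup>2))"
      and [measurable]: "h \<in> borel_measurable borel" for y K and h :: "plane \<Rightarrow> complex"
  proof (rule Bochner_Integration.integrable_bound)
    show "integrable lborel (\<lambda>x. K * (inverse (1 + x\<^sup>2) * inverse (1 + y\<^sup>2)))"
      using integrable_inverse_one_plus_square by simp
    show "AE x in lborel. norm (e x y * h (x, y)) \<le> norm (K * (inverse (1 + x\<^sup>2) * inverse (1 + y\<^sup>2)))"
      using h by (intro AE_I2) (auto simp: norm_mult e_def intro: order_trans[OF _ abs_ge_self])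
  qed (simp add: e_def)
  have lim: "((\<lambda>x. e x y * \<phi> (x, y)) \<longlongrightarrow> 0) F" if F: "F = at_top \<or> F = at_bot" for F :: "real filter" and y
  proof (rule Lim_null_comparison)
    show "\<forall>\<^sub>F x in F. norm (e x y * \<phi> (x, y)) \<le> \<bar>C\<bar> * inverse (1 + x\<^sup>2)"
    proof (intro always_eventually allI)
      fix x
      have "norm (\<phi> (x, y)) \<le> \<bar>C\<bar> * (inverse (1 + x\<^sup>2) * 1)"
        by (rule order_trans[OF C]) (intro mult_mono, auto simp: field_simps add_pos_nonneg)
      then show "norm (e x y * \<phi> (x, y)) \<le> \<bar>C\<bar> * inverse (1 + x\<^sup>2)" by (simp add: norm_mult e_def)
    qed
    have "filterlim (\<lambda>x::real. 1 + x\<^sup>2) at_top F"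
      using F
    proof
      assume "F = at_top"
      then show ?thesis
        using filterlim_tendsto_add_at_top[OF tendsto_const filterlim_pow_at_top[OF _ filterlim_ident]]
        by simp
    next
      assume "F = at_bot"
      then show ?thesis
        using filterlim_tendsto_add_at_top[OF tendsto_const filterlim_pow_at_bot_even[OF _ filterlim_ident]]
        by simp
    qed
    then have "((\<lambda>x. inverse (1 + x\<^sup>2)) \<longlongrightarrow> 0) F"
      by (rule tendsto_inverse_0_at_top)
    then show "((\<lambda>x. \<bar>C\<bar> * inverse (1 + x\<^sup>2)) \<longlongrightarrow> 0) F"
      by (auto intro: tendsto_eq_intros)
  qed
  have parts: "(LINT x|lborel. e x y * partial_x \<phi> (x, y)) = (LINT x|lborel. - \<i> * of_real \<xi> * (e x y * \<phi> (x, y)))" for y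
  proof -
    let ?f = "\<lambda>x. \<i> * of_real \<xi> * (e x y * \<phi> (x, y)) + e x y * partial_x \<phi> (x, y)"
    have i: "integrable lborel (\<lambda>x. e x y * \<phi> (x, y))"
        "integrable lborel (\<lambda>x. e x y * partial_x \<phi> (x, y))"
      by (rule line_int[OF C] line_int[OF C']; measurable)+
    have "(LBINT x=-\<infinity>..\<infinity>. ?f x) = 0 - 0"
    proof (rule interval_integral_FTC_integrable[where F = "\<lambda>x. e x y * \<phi> (x, y)"])
      fix x
      have e': "((\<lambda>x. e x y) has_vector_derivative \<i> * of_real \<xi> * e x y) (at x)"
      proof -
        have "((\<lambda>z. exp (\<i> * (of_real \<xi> * z + of_real (\<eta> * y)))) has_field_derivative
            \<i> * of_real \<xi> * exp (\<i> * (of_real \<xi> * of_real x + of_real (\<eta> * y)))) (at (complex_of_real x))"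
          by (auto intro!: derivative_eq_intros)
        from has_vector_derivative_real_field[OF this] show ?thesis
          by (simp only: e_def cis_conv_exp inner_prod_def fst_conv snd_conv inner_real_def
              of_real_add of_real_mult)
      qed
      show "((\<lambda>x. e x y * \<phi> (x, y)) has_vector_derivative ?f x) (at x)"
        using has_vector_derivative_mult[OF e' schwartz_has_partial_x[OF \<phi>]]
        by (simp add: algebra_simps)
      have "continuous_on UNIV (\<lambda>x. h (x, y))" if "h \<in> schwartz" for h :: "plane \<Rightarrow> complex"
        by (rule continuous_on_compose2[OF schwartz_continuous[OF that]]) (auto intro!: continuous_intros)
      then have "continuous_on UNIV (\<lambda>x. \<phi> (x, y))" "continuous_on UNIV (\<lambda>x. partial_x \<phi> (x, y))"
        using \<phi> schwartz_partial_x by auto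
      then have "continuous_on UNIV ?f"
        unfolding e_def by (intro continuous_intros)
      then show "isCont ?f x" by (simp add: continuous_on_eq_continuous_at)
    next
      show "set_integrable lborel (einterval (- \<infinity>) \<infinity>) ?f"
        using i by (simp add: set_integrable_def)
      show "(((\<lambda>x. e x y * \<phi> (x, y)) \<circ> real_of_ereal) \<longlongrightarrow> 0) (at_right (-\<infinity>))"
        using lim[of at_bot y] unfolding ereal_tendsto_simps by simp
      show "(((\<lambda>x. e x y * \<phi> (x, y)) \<circ> real_of_ereal) \<longlongrightarrow> 0) (at_left \<infinity>)"
        using lim[of at_top y] unfolding ereal_tendsto_simps by simp
    qed auto
    then have "(LINT x|lborel. ?f x) = 0"
      by (simp add: interval_lebesgue_integral_def set_lebesgue_integral_def)
    with i show ?thesis by (simp add: add_eq_0_iff)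
  qed
  have i2: "integrable lborel (\<lambda>z. cis ((\<xi>, \<eta>) \<bullet> z) * h z)" if "h \<in> schwartz" for h
    using schwartz_measurable[OF that]
    by (intro Bochner_Integration.integrable_bound[OF schwartz_integrable[OF that]]) (auto simp: norm_mult)
  have "(LINT z|lborel. cis ((\<xi>, \<eta>) \<bullet> z) * partial_x \<phi> z) = - \<i> * of_real \<xi> * (LINT z|lborel. cis ((\<xi>, \<eta>) \<bullet> z) * \<phi> z)"
    using integral_plane_iterated(2)[OF i2[OF \<phi>]]
      integral_plane_iterated(2)[OF i2[OF schwartz_partial_x[OF \<phi>]]] parts
    by (simp add: e_def)
  then show ?thesis by (simp add: inv_fourier_fun_def)
qed


lemma power_le_fact_exp: "0 \<le> y \<Longrightarrow> y ^ n \<le> fact n * exp y" for y :: real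
  using sum_le_suminf[of "\<lambda>n. y ^ n /\<^sub>R fact n" "{n}"] exp_converges[of y]
  by (simp add: sums_iff field_simps)

lemma gauss_bounded:
  fixes q :: "real poly"
  shows "bounded (range (\<lambda>x. poly q x * exp (- x\<^sup>2 / 2)))"
proof -
  have mono: "\<bar>x\<bar> ^ n * exp (- x\<^sup>2 / 2) \<le> fact n * exp (1 / 2)" for n and x :: real
  proof -
    have "\<bar>x\<bar> ^ n * exp (- x\<^sup>2 / 2) \<le> fact n * exp \<bar>x\<bar> * exp (- x\<^sup>2 / 2)"
      by (intro mult_right_mono power_le_fact_exp) auto
    also have "\<dots> = fact n * exp (\<bar>x\<bar> - x\<^sup>2 / 2)"
      by (simp add: mult.assoc flip: exp_add)
    also have "\<dots> \<le> fact n * exp (1 / 2)"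
      using zero_le_power2[of "\<bar>x\<bar> - 1"] by (simp add: power2_eq_square algebra_simps)
    finally show ?thesis .
  qed
  have "norm (poly q x * exp (- x\<^sup>2 / 2)) \<le> (\<Sum>i\<le>degree q. \<bar>coeff q i\<bar> * (fact i * exp (1 / 2)))" for x
  proof -
    have "norm (poly q x * exp (- x\<^sup>2 / 2)) \<le> (\<Sum>i\<le>degree q. \<bar>coeff q i * x ^ i\<bar>) * exp (- x\<^sup>2 / 2)"
      unfolding poly_altdef real_norm_def abs_mult by (intro mult_mono order_trans[OF sum_abs]) (auto simp: sum_nonneg abs_mult)
    also have "\<dots> = (\<Sum>i\<le>degree q. \<bar>coeff q i\<bar> * (\<bar>x\<bar> ^ i * exp (- x\<^sup>2 / 2)))"
      by (simp add: sum_distrib_right abs_mult power_abs mult.assoc)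
    also have "\<dots> \<le> (\<Sum>i\<le>degree q. \<bar>coeff q i\<bar> * (fact i * exp (1 / 2)))"
      by (intro sum_mono mult_left_mono mono) auto
    finally show ?thesis .
  qed
  then show ?thesis unfolding bounded_iff by blast
qed

text \<open>These are the Hermite polynomials up to sign: \<open>hermite n\<close> times
  \<open>exp (- x\<^sup>2 / 2)\<close> is the \<open>n\<close>-th derivative of \<open>exp (-
  x\<^sup>2 / 2)\<close>.\<close>

primrec hermite :: "nat \<Rightarrow> real poly" where
  "hermite 0 = 1"
| "hermite (Suc n) = pderiv (hermite n) - [:0, 1:] * hermite n"

lemma hermite_derivative:
  "((\<lambda>x. poly (hermite n) (x - a) * exp (- (x - a)\<^sup>2 / 2)) has_real_derivative
     poly (hermite (Suc n)) (x - a) * exp (- (x - a)\<^sup>2 / 2)) (at x)"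
proof -
  have E: "((\<lambda>x. exp (- (x - a)\<^sup>2 / 2)) has_real_derivative - (x - a) * exp (- (x - a)\<^sup>2 / 2)) (at x)"
    by (auto intro!: derivative_eq_intros simp: field_simps)
  have P: "((\<lambda>x. poly (hermite n) (x - a)) has_real_derivative poly (pderiv (hermite n)) (x - a)) (at x)"
    using DERIV_chain2[where f = "poly (hermite n)" and g = "\<lambda>x. x - a" and x = x and s = UNIV
        and Db = 1, OF poly_DERIV] by (auto intro!: derivative_eq_intros)
  have "poly (pderiv (hermite n)) (x - a) * c + - (x - a) * c * poly (hermite n) (x - a) =
      poly (hermite (Suc n)) (x - a) * c" for c
    by (simp add: algebra_simps)
  then show ?thesis
    using DERIV_mult[OF P E] by simp
qed

text \<open>The inverse transforms of these translates are the characters times one fixed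
  Gaussian. A distribution evaluated on them yields the Fourier transform of an integrable
  function.\<close>

definition gauss_at :: "plane \<Rightarrow> plane \<Rightarrow> complex" where
  "gauss_at b = (\<lambda>(x, y). complex_of_real (exp (- (x - fst b)\<^sup>2 / 2) * exp (- (y - snd b)\<^sup>2 / 2)))"

lemma gauss_at_schwartz: "gauss_at b \<in> schwartz"
proof -
  define g where "g = (\<lambda>n a x. poly (hermite n) (x - a) * exp (- (x - a)\<^sup>2 / 2))"
  define D where "D = (\<lambda>j k (x, y). complex_of_real (g j (fst b) x * g k (snd b) y))"
  have g': "(g n a has_real_derivative g (Suc n) a x) (at x)" for n a x
    using hermite_derivative[of n a x] by (simp add: g_def)
  have bd: "bounded (range (\<lambda>x. x ^ m * g n a x))" for m n a
  proof -
    have "(\<lambda>x. x ^ m * g n a x) = (\<lambda>x. poly ([:a, 1:] ^ m * hermite n) x * exp (- x\<^sup>2 / 2)) \<circ> (\<lambda>x. x - a)"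
      by (auto simp: g_def fun_eq_iff poly_power)
    then show ?thesis
      by (simp only: image_comp [symmetric])
         (rule bounded_subset[OF gauss_bounded[of "[:a, 1:] ^ m * hermite n"]], rule image_mono, simp)
  qed
  show ?thesis
    unfolding schwartz_def
  proof (rule CollectI, rule exI[of _ D], intro conjI allI)
    show "D 0 0 = gauss_at b" by (auto simp: D_def g_def gauss_at_def fun_eq_iff)
    fix j k m n :: nat and x y :: real
    show "((\<lambda>s. D j k (s, y)) has_vector_derivative D (Suc j) k (x, y)) (at x)"
      unfolding D_def prod.case
      by (intro has_vector_derivative_of_real DERIV_cmult_right g')
    show "((\<lambda>s. D j k (x, s)) has_vector_derivative D j (Suc k) (x, y)) (at y)"
      unfolding D_def prod.case
      by (intro has_vector_derivative_of_real DERIV_cmult g')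
    obtain A where A: "\<And>x. \<bar>x ^ m * g j (fst b) x\<bar> \<le> A"
      using bd[of m j "fst b"] by (auto simp: bounded_iff)
    obtain B where B: "\<And>x. \<bar>x ^ n * g k (snd b) x\<bar> \<le> B"
      using bd[of n k "snd b"] by (auto simp: bounded_iff)
    show "bounded (range (\<lambda>(x, y). complex_of_real (x ^ m * y ^ n) * D j k (x, y)))"
      unfolding bounded_iff
    proof (intro exI[of _ "A * B"] ballI, clarify)
      fix x y
      have "norm (complex_of_real (x ^ m * y ^ n) * D j k (x, y)) =
          \<bar>x ^ m * g j (fst b) x\<bar> * \<bar>y ^ n * g k (snd b) y\<bar>"
        by (simp add: D_def norm_mult norm_power abs_mult power_abs mult_ac)
      also have "\<dots> \<le> A * B"
        by (intro mult_mono A B) (auto intro: order_trans[OF _ A])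
      finally show "norm (complex_of_real (x ^ m * y ^ n) * D j k (x, y)) \<le> A * B" .
    qed
  qed
qed

text \<open>For \<open>a = 0\<close> this is the characteristic function of the standard normal
  distribution.\<close>

lemma fourier_gauss_line:
  "(LINT x|lborel. cis (t * x) * of_real (exp (- (x - a)\<^sup>2 / 2))) =
     of_real (sqrt (2 * pi)) * cis (t * a) * of_real (exp (- t\<^sup>2 / 2))"
proof -
  have "char std_normal_distribution t = (LINT x|lborel. std_normal_density x *\<^sub>R iexp (t * x))"
    unfolding char_def by (subst integral_density) auto
  also have "\<dots> = (LINT x|lborel. cis (t * x) * of_real (exp (- x\<^sup>2 / 2)) / of_real (sqrt (2 * pi)))"
    by (simp add: std_normal_density_def scaleR_conv_of_real cis_conv_exp mult_ac)
  finally have 1: "(LINT x|lborel. cis (t * x) * of_real (exp (- x\<^sup>2 / 2))) =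
      of_real (sqrt (2 * pi)) * of_real (exp (- t\<^sup>2 / 2))"
    by (simp add: char_std_normal_distribution field_simps del: of_real_exp)
  have "(LINT x|lborel. cis (t * x) * of_real (exp (- (x - a)\<^sup>2 / 2))) =
      (LINT x|lborel. cis (t * (a + 1 * x)) * of_real (exp (- ((a + 1 * x) - a)\<^sup>2 / 2)))"
    using lborel_integral_real_affine[of 1 "\<lambda>x. cis (t * x) * of_real (exp (- (x - a)\<^sup>2 / 2))" a]
    by simp
  also have "\<dots> = (LINT x|lborel. cis (t * a) * (cis (t * x) * of_real (exp (- x\<^sup>2 / 2))))"
    by (simp add: distrib_left mult.assoc flip: cis_mult)
  also have "\<dots> = cis (t * a) * (of_real (sqrt (2 * pi)) * of_real (exp (- t\<^sup>2 / 2)))"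
    by (simp only: integral_mult_right_zero 1)
  finally show ?thesis by (simp add: mult_ac)
qed

lemma inv_fourier_fun_gauss_at:
  "inv_fourier_fun (gauss_at b) z = cis (b \<bullet> z) * of_real (exp (- (fst z)\<^sup>2 / 2) * exp (- (snd z)\<^sup>2 / 2))"
proof -
  obtain \<xi> \<eta> where z: "z = (\<xi>, \<eta>)" by (cases z)
  have i: "integrable lborel (\<lambda>w. cis (z \<bullet> w) * gauss_at b w)"
    using schwartz_measurable[OF gauss_at_schwartz]
    by (intro Bochner_Integration.integrable_bound[OF schwartz_integrable[OF gauss_at_schwartz[of b]]])
       (auto simp: norm_mult)
  have "(LINT w|lborel. cis (z \<bullet> w) * gauss_at b w) =
    (LINT x|lborel. (cis (\<xi> * x) * of_real (exp (- (x - fst b)\<^sup>2 / 2))) *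
      (LINT y|lborel. cis (\<eta> * y) * of_real (exp (- (y - snd b)\<^sup>2 / 2))))"
    unfolding integral_plane_iterated(1)[OF i] integral_mult_right_zero[symmetric]
    by (simp add: z gauss_at_def mult_ac flip: cis_mult)
  also have "\<dots> = (of_real (sqrt (2 * pi)) * cis (\<xi> * fst b) * of_real (exp (- \<xi>\<^sup>2 / 2))) *
      (of_real (sqrt (2 * pi)) * cis (\<eta> * snd b) * of_real (exp (- \<eta>\<^sup>2 / 2)))"
    by (simp only: fourier_gauss_line integral_mult_left_zero)
  also have "\<dots> = of_real (2 * pi) * (cis (b \<bullet> z) * of_real (exp (- (fst z)\<^sup>2 / 2) * exp (- (snd z)\<^sup>2 / 2)))"
  proof -
    have "complex_of_real (sqrt (2 * pi)) * complex_of_real (sqrt (2 * pi)) = of_real (2 * pi)"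
      unfolding of_real_mult[symmetric] by simp
    then show ?thesis by (simp add: z inner_prod_def mult_ac flip: cis_mult)
  qed
  finally show ?thesis by (simp add: inv_fourier_fun_def)
qed


section \<open>Distributions with a function as Fourier transform\<close>

text \<open>Tested on the translated Gaussians, the two functions times a fixed Gaussian are
  integrable and have the same Fourier transform.\<close>

lemma has_fourier_unique:
  assumes "has_fourier u g" "has_fourier u h"
  shows "AE z in lborel. g z = h z"
proof -
  have [measurable]: "g \<in> borel_measurable borel" "h \<in> borel_measurable borel"
    using assms by (auto simp: has_fourier_def)
  define E where "E = (\<lambda>z::plane. complex_of_real (exp (- (fst z)\<^sup>2 / 2) * exp (- (snd z)\<^sup>2 / 2)))"
  have [measurable]: "E \<in> borel_measurable borel" unfolding E_def by measurable
  have G: "inv_fourier_fun (gauss_at b) z = cis (b \<bullet> z) * E z" for b z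
    by (simp add: inv_fourier_fun_gauss_at E_def)
  have ig: "integrable lborel (\<lambda>z. g z * (cis (b \<bullet> z) * E z))"
    and ih: "integrable lborel (\<lambda>z. h z * (cis (b \<bullet> z) * E z))" for b
    using assms gauss_at_schwartz[of b] by (auto simp: has_fourier_def G[symmetric])
  have "AE z in lborel. (g z - h z) * E z = 0"
  proof (rule fourier_L1_unique_plane)
    show "integrable lborel (\<lambda>z. (g z - h z) * E z)"
      using ig[of 0] ih[of 0] by (simp add: left_diff_distrib)
    fix b
    have "u = inv_fourier g" "u = inv_fourier h"
      using assms unfolding has_fourier_def by blast+
    then have "inv_fourier g (gauss_at b) = inv_fourier h (gauss_at b)" by metis
    then have "(LINT z|lborel. g z * (cis (b \<bullet> z) * E z)) = (LINT z|lborel. h z * (cis (b \<bullet> z) * E z))"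
      using gauss_at_schwartz[of b] by (simp add: inv_fourier_def G)
    then have "(LINT z|lborel. g z * (cis (b \<bullet> z) * E z)) - (LINT z|lborel. h z * (cis (b \<bullet> z) * E z)) = 0"
      by simp
    then show "(LINT z|lborel. cis (b \<bullet> z) * ((g z - h z) * E z)) = 0"
      using ig[of b] ih[of b]
      by (subst (asm) Bochner_Integration.integral_diff [symmetric]) (auto simp: algebra_simps)
  qed
  then show ?thesis by eventually_elim (simp add: E_def)
qed

lemma has_fourier_fourier: "has_fourier u g \<Longrightarrow> has_fourier u (fourier u)"
  unfolding fourier_def by (rule someI[where P = "has_fourier u"])

lemma fourier_eq_AE: "has_fourier u g \<Longrightarrow> AE z in lborel. fourier u z = g z"
  using has_fourier_unique has_fourier_fourier by blast

lemma fourier_measurable: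
  assumes "has_fourier u g"
  shows "fourier u \<in> borel_measurable borel" "g \<in> borel_measurable borel"
  using assms has_fourier_fourier[OF assms] by (auto simp: has_fourier_def)

lemma inv_fourier_test_measurable:
  "\<phi> \<in> schwartz \<Longrightarrow> inv_fourier_fun \<phi> \<in> borel_measurable borel"
  using schwartz_measurable by measurable

lemma inv_fourier_cong_AE:
  assumes "AE z in lborel. g z = h z" "g \<in> borel_measurable borel" "h \<in> borel_measurable borel"
  shows "inv_fourier g = inv_fourier h"
proof
  fix \<phi>
  show "inv_fourier g \<phi> = inv_fourier h \<phi>"
  proof (cases "\<phi> \<in> schwartz")
    case True
    note [measurable] = assms(2,3) inv_fourier_test_measurable[OF True]
    have "(LINT z|lborel. g z * inv_fourier_fun \<phi> z) = (LINT z|lborel. h z * inv_fourier_fun \<phi> z)"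
      by (rule integral_cong_AE) (use assms(1) in \<open>auto elim: eventually_mono\<close>)
    then show ?thesis by (simp add: inv_fourier_def)
  qed (simp add: inv_fourier_def)
qed

lemma multiplier_eq:
  assumes "has_fourier u g" and [measurable]: "m \<in> borel_measurable borel"
  shows "multiplier m u = inv_fourier (\<lambda>\<zeta>. m \<zeta> * g \<zeta>)"
proof -
  note [measurable] = fourier_measurable[OF assms(1)]
  show ?thesis
    unfolding multiplier_def
    by (rule inv_fourier_cong_AE) (use fourier_eq_AE[OF assms(1)] in \<open>auto elim: eventually_mono\<close>)
qed

lemma integrable_mult_inv_fourier_fun:
  assumes "integrable lborel g" "\<phi> \<in> schwartz"
  shows "integrable lborel (\<lambda>z. g z * inv_fourier_fun \<phi> z)"
proof (rule Bochner_Integration.integrable_bound)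
  define K where "K = (LINT \<zeta>|lborel. norm (\<phi> \<zeta>)) / (2 * pi)"
  show "integrable lborel (\<lambda>z. K * norm (g z))" using assms by auto
  have "K \<ge> 0" by (simp add: K_def)
  then show "AE z in lborel. norm (g z * inv_fourier_fun \<phi> z) \<le> norm (K * norm (g z))"
    using inv_fourier_fun_bound[of \<phi>] unfolding K_def[symmetric]
    by (intro AE_I2) (simp add: norm_mult mult.commute[of K] mult_left_mono abs_mult)
  have [measurable]: "g \<in> borel_measurable borel"
    using assms by (simp add: borel_measurable_integrable)
  note [measurable] = inv_fourier_test_measurable[OF assms(2)]
  show "(\<lambda>z. g z * inv_fourier_fun \<phi> z) \<in> borel_measurable lborel" by measurable
qed

lemma has_fourier_inv_fourier:
  assumes "integrable lborel g"
  shows "has_fourier (inv_fourier g) g"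
  using assms integrable_mult_inv_fourier_fun[OF assms]
  by (auto simp: has_fourier_def borel_measurable_integrable)

text \<open>For an integrable transform the distribution is the classical inverse transform: this is the
  multiplication formula, an instance of Fubini's theorem.\<close>

lemma regular_inv_fourier_fun:
  assumes g: "integrable lborel g"
  shows "regular (inv_fourier_fun g) = inv_fourier g"
proof
  fix \<phi>
  show "regular (inv_fourier_fun g) \<phi> = inv_fourier g \<phi>"
  proof (cases "\<phi> \<in> schwartz")
    case True
    have [measurable]: "g \<in> borel_measurable borel"
      using g by (simp add: borel_measurable_integrable)
    note [measurable] = schwartz_measurable[OF True]
    have "integrable (lborel \<Otimes>\<^sub>M lborel) (\<lambda>(z, \<zeta>). \<phi> z * (cis (z \<bullet> \<zeta>) * g \<zeta>))"
      by (rule Bochner_Integration.integrable_bound[OF integrable_tensor[OF schwartz_integrable[OF True] g]])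
         (auto simp: norm_mult case_prod_beta)
    from lborel_pair.Fubini_integral[OF this]
    have "(LINT z|lborel. \<phi> z * (LINT \<zeta>|lborel. cis (z \<bullet> \<zeta>) * g \<zeta>)) =
        (LINT \<zeta>|lborel. g \<zeta> * (LINT z|lborel. cis (\<zeta> \<bullet> z) * \<phi> z))"
      by (simp add: mult.left_commute inner_commute mult.commute
          flip: integral_mult_right_zero)
    then show ?thesis
      using True by (simp add: regular_def inv_fourier_def inv_fourier_fun_def mult.commute)
  qed (simp add: regular_def inv_fourier_def)
qed

lemma has_fourier_regular:
  "integrable lborel g \<Longrightarrow> has_fourier (regular (inv_fourier_fun g)) g"
  by (simp add: regular_inv_fourier_fun has_fourier_inv_fourier)

lemma has_fourier_add:
  assumes "has_fourier u g" "has_fourier v h"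
  shows "has_fourier (u + v) (\<lambda>z. g z + h z)"
  using assms unfolding has_fourier_def
  by (auto simp: distrib_right inv_fourier_def fun_eq_iff)

lemma has_fourier_scaleR:
  assumes "has_fourier u g"
  shows "has_fourier (c *\<^sub>R u) (\<lambda>z. of_real c * g z)"
  using assms unfolding has_fourier_def
  by (auto simp: mult.assoc inv_fourier_def fun_eq_iff scaleR_fun_def scaleR_conv_of_real)

lemma has_fourier_diff:
  assumes "has_fourier u g" "has_fourier v h"
  shows "has_fourier (u - v) (\<lambda>z. g z - h z)"
  using assms unfolding has_fourier_def
  by (auto simp: left_diff_distrib inv_fourier_def fun_eq_iff)

lemma has_fourier_ddx:
  assumes u: "has_fourier u g" and g: "integrable lborel (\<lambda>z. of_real (fst z) * g z)"
  shows "has_fourier (ddx u) (\<lambda>z. \<i> * of_real (fst z) * g z)"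
proof -
  have "ddx u = inv_fourier (\<lambda>z. \<i> * of_real (fst z) * g z)"
  proof
    fix \<phi>
    show "ddx u \<phi> = inv_fourier (\<lambda>z. \<i> * of_real (fst z) * g z) \<phi>"
    proof (cases "\<phi> \<in> schwartz")
      case True
      have "ddx u \<phi> = - u (partial_x \<phi>)" using True by (simp add: ddx_def partial_x_def)
      also have "\<dots> = - (LINT z|lborel. g z * inv_fourier_fun (partial_x \<phi>) z)"
        using u schwartz_partial_x[OF True] by (auto simp: has_fourier_def inv_fourier_def)
      also have "\<dots> = (LINT z|lborel. - (g z * inv_fourier_fun (partial_x \<phi>) z))" by simp
      also have "(\<lambda>z. - (g z * inv_fourier_fun (partial_x \<phi>) z)) =
          (\<lambda>z. \<i> * of_real (fst z) * g z * inv_fourier_fun \<phi> z)"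
        using inv_fourier_fun_partial_x[OF True] by (auto simp: fun_eq_iff)
      finally show ?thesis using True by (simp add: inv_fourier_def)
    qed (simp add: ddx_def inv_fourier_def)
  qed
  then show ?thesis using has_fourier_inv_fourier[of "\<lambda>z. \<i> * of_real (fst z) * g z"] g
    by (simp add: mult.assoc)
qed

section \<open>The weighted norm\<close>

definition wt :: "real \<Rightarrow> plane \<Rightarrow> real" where
  "wt s z = (1 + \<bar>fst z\<bar>) powr s"

lemma wt_measurable [measurable]: "wt s \<in> borel_measurable borel"
  unfolding wt_def by measurable

lemma wt_pos: "wt s z > 0"
  by (simp add: wt_def)

lemma wt_case_prod:
  "(\<lambda>(\<xi>, \<eta>). ((1 + \<bar>\<xi>\<bar>) powr s * cmod (g (\<xi>, \<eta>)))\<^sup>2) = (\<lambda>z. (wt s z * norm (g z))\<^sup>2)"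
  by (auto simp: wt_def fun_eq_iff)

lemma sob_space_iff:
  "u \<in> sob_space s \<longleftrightarrow> (\<exists>g. has_fourier u g) \<and> integrable lborel (\<lambda>z. (wt s z * norm (fourier u z))\<^sup>2)"
  unfolding sob_space_def wt_case_prod by simp

lemma sob_norm_eq: "sob_norm s u = sqrt (LINT z|lborel. (wt s z * norm (fourier u z))\<^sup>2)"
  unfolding sob_norm_def wt_case_prod ..

lemma sob_spaceI:
  assumes "has_fourier u g" "integrable lborel (\<lambda>z. (wt s z * norm (g z))\<^sup>2)"
  shows "u \<in> sob_space s"
proof -
  note [measurable] = fourier_measurable[OF assms(1)]
  have "integrable lborel (\<lambda>z. (wt s z * norm (fourier u z))\<^sup>2) \<longleftrightarrow> integrable lborel (\<lambda>z. (wt s z * norm (g z))\<^sup>2)"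
    by (rule integrable_cong_AE) (use fourier_eq_AE[OF assms(1)] in \<open>auto elim: eventually_mono\<close>)
  then show ?thesis using assms by (auto simp: sob_space_iff)
qed

lemma sob_norm_fourier:
  assumes "has_fourier u g"
  shows "sob_norm s u = sqrt (LINT z|lborel. (wt s z * norm (g z))\<^sup>2)"
proof -
  note [measurable] = fourier_measurable[OF assms(1)]
  have "(LINT z|lborel. (wt s z * norm (fourier u z))\<^sup>2) = (LINT z|lborel. (wt s z * norm (g z))\<^sup>2)"
    by (rule integral_cong_AE) (use fourier_eq_AE[OF assms(1)] in \<open>auto elim: eventually_mono\<close>)
  then show ?thesis by (simp add: sob_norm_eq)
qed

lemma sob_spaceD:
  assumes "u \<in> sob_space s"
  shows "has_fourier u (fourier u)" "integrable lborel (\<lambda>z. (wt s z * norm (fourier u z))\<^sup>2)"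
    "fourier u \<in> borel_measurable borel"
proof -
  obtain g where "has_fourier u g" "integrable lborel (\<lambda>z. (wt s z * norm (fourier u z))\<^sup>2)"
    using assms unfolding sob_space_iff by blast
  then show "has_fourier u (fourier u)" "integrable lborel (\<lambda>z. (wt s z * norm (fourier u z))\<^sup>2)"
    "fourier u \<in> borel_measurable borel"
    by (blast intro: has_fourier_fourier fourier_measurable(1))+
qed

lemma weighted_square_add_le:
  fixes a b :: complex
  assumes "0 \<le> (w::real)"
  shows "(w * norm (a + b))\<^sup>2 \<le> 2 * (w * norm a)\<^sup>2 + 2 * (w * norm b)\<^sup>2"
proof -
  have "(w * norm (a + b))\<^sup>2 \<le> (w * norm a + w * norm b)\<^sup>2"
    using assms norm_triangle_ineq[of a b]
    by (intro power_mono) (auto simp flip: distrib_left intro: mult_left_mono)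
  also have "\<dots> \<le> 2 * (w * norm a)\<^sup>2 + 2 * (w * norm b)\<^sup>2"
    using zero_le_power2[of "w * norm a - w * norm b"] by (simp add: power2_eq_square algebra_simps)
  finally show ?thesis .
qed

text \<open>The triangle inequality up to the factor 2, from \<open>(a + b)\<^sup>2 \<le> 2
  a\<^sup>2 + 2 b\<^sup>2\<close>; this is enough to compare bounded linear maps.\<close>

lemma
  assumes u: "u \<in> sob_space s" and v: "v \<in> sob_space s"
  shows sob_space_add: "u + v \<in> sob_space s"
    and sob_norm_add: "sob_norm s (u + v) \<le> 2 * (sob_norm s u + sob_norm s v)"
proof -
  note [measurable] = sob_spaceD(3)[OF u] sob_spaceD(3)[OF v]
  let ?a = "\<lambda>z. (wt s z * norm (fourier u z))\<^sup>2" and ?b = "\<lambda>z. (wt s z * norm (fourier v z))\<^sup>2"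
  let ?c = "\<lambda>z. (wt s z * norm (fourier u z + fourier v z))\<^sup>2"
  have hf: "has_fourier (u + v) (\<lambda>z. fourier u z + fourier v z)"
    using u v by (intro has_fourier_add sob_spaceD)
  have le: "?c z \<le> 2 * ?a z + 2 * ?b z" for z
    using wt_pos[of s z] by (intro weighted_square_add_le) simp
  have i: "integrable lborel (\<lambda>z. 2 * ?a z + 2 * ?b z)"
    using sob_spaceD(2)[OF u] sob_spaceD(2)[OF v] by simp
  have ic: "integrable lborel ?c"
    by (rule Bochner_Integration.integrable_bound[OF i])
       (use le in \<open>auto intro!: AE_I2 intro: order_trans[OF _ abs_ge_self]\<close>)
  show "u + v \<in> sob_space s" by (rule sob_spaceI[OF hf ic])
  have "(LINT z|lborel. ?c z) \<le> (LINT z|lborel. 2 * ?a z + 2 * ?b z)"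
    by (rule integral_mono[OF ic i le])
  also have "\<dots> = 2 * (sob_norm s u)\<^sup>2 + 2 * (sob_norm s v)\<^sup>2"
    using sob_spaceD(2)[OF u] sob_spaceD(2)[OF v] by (simp add: sob_norm_eq)
  also have "\<dots> \<le> (2 * (sob_norm s u + sob_norm s v))\<^sup>2"
  proof -
    have "0 \<le> sob_norm s u" "0 \<le> sob_norm s v" by (auto simp: sob_norm_eq)
    then show ?thesis by (simp add: power2_eq_square algebra_simps add_nonneg_nonneg)
  qed
  finally have "sob_norm s (u + v) \<le> sqrt ((2 * (sob_norm s u + sob_norm s v))\<^sup>2)"
    unfolding sob_norm_fourier[OF hf] by (rule real_sqrt_le_mono)
  then show "sob_norm s (u + v) \<le> 2 * (sob_norm s u + sob_norm s v)"
    by (simp add: sob_norm_eq)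
qed

lemma
  assumes u: "u \<in> sob_space s"
  shows sob_space_scaleR: "c *\<^sub>R u \<in> sob_space s"
    and sob_norm_scaleR: "sob_norm s (c *\<^sub>R u) = \<bar>c\<bar> * sob_norm s u"
proof -
  have hf: "has_fourier (c *\<^sub>R u) (\<lambda>z. of_real c * fourier u z)"
    using u by (intro has_fourier_scaleR sob_spaceD)
  have eq: "(\<lambda>z. (wt s z * norm (of_real c * fourier u z))\<^sup>2) = (\<lambda>z. c\<^sup>2 * (wt s z * norm (fourier u z))\<^sup>2)"
    by (auto simp: fun_eq_iff norm_mult power_mult_distrib)
  show "c *\<^sub>R u \<in> sob_space s"
    using sob_spaceD(2)[OF u] by (intro sob_spaceI[OF hf]) (simp add: eq)
  show "sob_norm s (c *\<^sub>R u) = \<bar>c\<bar> * sob_norm s u"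
    by (simp add: sob_norm_fourier[OF hf] sob_norm_fourier[OF sob_spaceD(1)[OF u]] eq real_sqrt_mult
        del: real_sqrt_eq_iff)
qed

text \<open>Pairing the transform with a function in the dual weighted space is bounded; the proof is the
  Cauchy--Schwarz inequality.\<close>

definition fourier_pairing :: "(plane \<Rightarrow> complex) \<Rightarrow> distr \<Rightarrow> complex" where
  "fourier_pairing w u = (LINT z|lborel. w z * fourier u z)"

text \<open>Integrate \<open>\<bar>a b\<bar> \<le> t a\<^sup>2 / 2 + b\<^sup>2 / (2 t)\<close> and
  optimise over \<open>t\<close>. The optimal \<open>t\<close> is the quotient of the two norms;
  both are enlarged by a small \<open>d\<close> so that it is defined when one of them is zero.\<close>

lemma Cauchy_Schwarz_integral:
  fixes f g :: "'a \<Rightarrow> real"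
  assumes [measurable]: "f \<in> borel_measurable M" "g \<in> borel_measurable M"
    and f: "integrable M (\<lambda>x. (f x)\<^sup>2)" and g: "integrable M (\<lambda>x. (g x)\<^sup>2)"
  shows "integrable M (\<lambda>x. f x * g x)"
    and "(LINT x|M. \<bar>f x * g x\<bar>) \<le> sqrt (LINT x|M. (f x)\<^sup>2) * sqrt (LINT x|M. (g x)\<^sup>2)"
proof -
  have ab: "\<bar>a * b\<bar> \<le> t * a\<^sup>2 / 2 + b\<^sup>2 / (2 * t)" if "t > 0" for a b t :: real
  proof -
    have "0 \<le> (t * \<bar>a\<bar> - \<bar>b\<bar>)\<^sup>2" by simp
    then have "2 * t * (\<bar>a\<bar> * \<bar>b\<bar>) \<le> t\<^sup>2 * a\<^sup>2 + b\<^sup>2"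
      by (simp add: power2_eq_square algebra_simps abs_mult_self_eq)
    then show ?thesis using that by (simp add: field_simps power2_eq_square abs_mult)
  qed
  show i: "integrable M (\<lambda>x. f x * g x)"
  proof (rule Bochner_Integration.integrable_bound)
    show "integrable M (\<lambda>x. 1 * (f x)\<^sup>2 / 2 + (g x)\<^sup>2 / (2 * 1))" using f g by simp
    show "AE x in M. norm (f x * g x) \<le> norm (1 * (f x)\<^sup>2 / 2 + (g x)\<^sup>2 / (2 * 1))"
      using ab[of 1] by (intro AE_I2) (auto intro: order_trans[OF _ abs_ge_self])
  qed simp
  define A where "A = (LINT x|M. (f x)\<^sup>2)"
  define B where "B = (LINT x|M. (g x)\<^sup>2)"
  define I where "I = (LINT x|M. \<bar>f x * g x\<bar>)"
  have A0: "A \<ge> 0" and B0: "B \<ge> 0" by (auto simp: A_def B_def)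
  have le: "I \<le> t * A / 2 + B / (2 * t)" if "t > 0" for t
  proof -
    have "I \<le> (LINT x|M. t * (f x)\<^sup>2 / 2 + (g x)\<^sup>2 / (2 * t))"
      unfolding I_def using f g i ab[OF that] by (intro integral_mono) auto
    also have "\<dots> = t * A / 2 + B / (2 * t)" using f g by (simp add: A_def B_def)
    finally show ?thesis .
  qed
  have "I \<le> sqrt A * sqrt B"
  proof (rule field_le_epsilon)
    fix e :: real assume e: "e > 0"
    define d where "d = min 1 (e / (1 + sqrt A + sqrt B))"
    have S: "1 + sqrt A + sqrt B > 0" using A0 B0 by (auto intro!: add_pos_nonneg)
    have d: "0 < d" "d \<le> 1" using S e by (auto simp: d_def)
    have "d * (1 + sqrt A + sqrt B) \<le> e / (1 + sqrt A + sqrt B) * (1 + sqrt A + sqrt B)"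
      using S by (intro mult_right_mono) (auto simp: d_def)
    also have "\<dots> = e" using S by simp
    finally have d': "d * (1 + sqrt A + sqrt B) \<le> e" .
    define a where "a = sqrt A + d"
    define b where "b = sqrt B + d"
    have ab0: "a > 0" "b > 0" using d A0 B0 by (auto simp: a_def b_def intro: add_nonneg_pos)
    have "A \<le> a\<^sup>2" "B \<le> b\<^sup>2"
      using d A0 B0 by (auto simp: a_def b_def power2_sum)
    have "I \<le> (b / a) * A / 2 + B / (2 * (b / a))" using ab0 by (intro le) simp
    also have "\<dots> \<le> (b / a) * a\<^sup>2 / 2 + b\<^sup>2 / (2 * (b / a))"
      using \<open>A \<le> a\<^sup>2\<close> \<open>B \<le> b\<^sup>2\<close> ab0 by (intro add_mono divide_right_mono mult_left_mono) auto
    also have "\<dots> = a * b" using ab0 by (simp add: field_simps power2_eq_square)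
    also have "\<dots> = sqrt A * sqrt B + d * (sqrt A + sqrt B + d)"
      by (simp add: a_def b_def algebra_simps)
    also have "\<dots> \<le> sqrt A * sqrt B + d * (1 + sqrt A + sqrt B)"
      using d by (intro add_left_mono mult_left_mono) auto
    also have "\<dots> \<le> sqrt A * sqrt B + e" using d' by simp
    finally show "I \<le> sqrt A * sqrt B + e" .
  qed
  then show "(LINT x|M. \<bar>f x * g x\<bar>) \<le> sqrt (LINT x|M. (f x)\<^sup>2) * sqrt (LINT x|M. (g x)\<^sup>2)"
    by (simp add: A_def B_def I_def)
qed

lemma
  assumes u: "u \<in> sob_space s" and [measurable]: "w \<in> borel_measurable borel"
    and w: "integrable lborel (\<lambda>z. (norm (w z) / wt s z)\<^sup>2)"
  shows fourier_pairing_integrable: "integrable lborel (\<lambda>z. w z * fourier u z)"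
    and fourier_pairing_bound:
      "norm (fourier_pairing w u) \<le> sqrt (LINT z|lborel. (norm (w z) / wt s z)\<^sup>2) * sob_norm s u"
proof -
  note [measurable] = sob_spaceD(3)[OF u]
  note cs = Cauchy_Schwarz_integral[OF _ _ w sob_spaceD(2)[OF u]]
  have eq: "norm (w z) / wt s z * (wt s z * norm (fourier u z)) = norm (w z * fourier u z)" for z
    using wt_pos[of s z] by (simp add: norm_mult)
  show i: "integrable lborel (\<lambda>z. w z * fourier u z)"
    using cs(1) unfolding eq by (simp add: integrable_norm_iff)
  have "norm (fourier_pairing w u) \<le> (LINT z|lborel. norm (w z * fourier u z))"
    unfolding fourier_pairing_def by (rule integral_norm_bound)
  also have "\<dots> \<le> sqrt (LINT z|lborel. (norm (w z) / wt s z)\<^sup>2) * sob_norm s u"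
    using cs(2) unfolding eq by (simp add: sob_norm_eq)
  finally show "norm (fourier_pairing w u) \<le> sqrt (LINT z|lborel. (norm (w z) / wt s z)\<^sup>2) * sob_norm s u" .
qed

lemma fourier_pairing_eq:
  assumes "has_fourier u g" and [measurable]: "w \<in> borel_measurable borel"
  shows "fourier_pairing w u = (LINT z|lborel. w z * g z)"
proof -
  note [measurable] = fourier_measurable[OF assms(1)]
  show ?thesis
    unfolding fourier_pairing_def
    by (rule integral_cong_AE) (use fourier_eq_AE[OF assms(1)] in \<open>auto elim: eventually_mono\<close>)
qed

lemma
  assumes u: "u \<in> sob_space s" and v: "v \<in> sob_space s" and [measurable]: "w \<in> borel_measurable borel"
    and w: "integrable lborel (\<lambda>z. (norm (w z) / wt s z)\<^sup>2)"
  shows fourier_pairing_add: "fourier_pairing w (u + v) = fourier_pairing w u + fourier_pairing w v"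
    and fourier_pairing_scaleR: "fourier_pairing w (c *\<^sub>R u) = c *\<^sub>R fourier_pairing w u"
proof -
  note i = fourier_pairing_integrable[OF u _ w] fourier_pairing_integrable[OF v _ w]
  show "fourier_pairing w (u + v) = fourier_pairing w u + fourier_pairing w v"
    using i by (subst fourier_pairing_eq[OF has_fourier_add[OF sob_spaceD(1)[OF u] sob_spaceD(1)[OF v]]])
      (auto simp: fourier_pairing_def distrib_left)
  show "fourier_pairing w (c *\<^sub>R u) = c *\<^sub>R fourier_pairing w u"
    by (subst fourier_pairing_eq[OF has_fourier_scaleR[OF sob_spaceD(1)[OF u]]])
      (auto simp: fourier_pairing_def mult.left_commute scaleR_conv_of_real)
qed


section \<open>Third derivatives on quasinormed spaces\<close>

text \<open>A vector space given by a carrier and a seminorm whose triangle inequality holds up to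
  the factor 2. Spaces of bounded linear maps between such spaces, with the operator norm, are of
  the same kind, so the iterated spaces in which the derivatives of a map live can be treated
  uniformly.\<close>

locale quasinormed =
  fixes V :: "'a::real_vector set" and N :: "'a \<Rightarrow> real"
  assumes zero_mem: "0 \<in> V"
    and add_mem: "x \<in> V \<Longrightarrow> y \<in> V \<Longrightarrow> x + y \<in> V"
    and scale_mem: "x \<in> V \<Longrightarrow> c *\<^sub>R x \<in> V"
    and nonneg: "x \<in> V \<Longrightarrow> 0 \<le> N x"
    and scale_le: "x \<in> V \<Longrightarrow> N (c *\<^sub>R x) \<le> \<bar>c\<bar> * N x"
    and quasi_triangle: "x \<in> V \<Longrightarrow> y \<in> V \<Longrightarrow> N (x + y) \<le> 2 * (N x + N y)"
begin

lemma diff_mem: "x \<in> V \<Longrightarrow> y \<in> V \<Longrightarrow> x - y \<in> V"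
  using add_mem[of x "(-1) *\<^sub>R y"] scale_mem[of y "-1"] by simp

lemma norm_zero_le: "N 0 \<le> 0"
  using scale_le[of 0 0] zero_mem by simp

end

text \<open>The infimum that defines the operator norm is itself an admissible constant.\<close>

lemma (in quasinormed) op_norm_bound:
  assumes A: "A \<in> bounded_linear_maps V N Y M" and M: "\<And>y. y \<in> Y \<Longrightarrow> 0 \<le> M y"
  shows "0 \<le> op_norm V N M A"
    and "x \<in> V \<Longrightarrow> M (A x) \<le> op_norm V N M A * N x"
proof -
  let ?S = "{C. 0 \<le> C \<and> (\<forall>x\<in>V. M (A x) \<le> C * N x)}"
  obtain C where C: "\<And>x. x \<in> V \<Longrightarrow> M (A x) \<le> C * N x"
    using A unfolding bounded_linear_maps_def mem_Collect_eq by blast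
  have "M (A x) \<le> max C 0 * N x" if "x \<in> V" for x
    using C[OF that] nonneg[OF that] mult_right_mono[of C "max C 0" "N x"] by linarith
  then have "max C 0 \<in> ?S" by simp
  then have ne: "?S \<noteq> {}" by blast
  show "0 \<le> op_norm V N M A"
    unfolding op_norm_def by (rule cInf_greatest[OF ne]) simp
  show "M (A x) \<le> op_norm V N M A * N x" if x: "x \<in> V"
  proof (cases "N x = 0")
    case True
    then show ?thesis using C[OF x] by simp
  next
    case False
    then have pos: "N x > 0" using nonneg[OF x] by simp
    have "M (A x) / N x \<le> op_norm V N M A"
      unfolding op_norm_def
      by (rule cInf_greatest[OF ne]) (use pos x in \<open>simp add: divide_le_eq\<close>)
    then show ?thesis using pos by (simp add: divide_le_eq)
  qed
qed

lemma op_norm_le: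
  assumes "0 \<le> C" "\<And>x. x \<in> V \<Longrightarrow> M (A x) \<le> C * N x"
  shows "op_norm V N M A \<le> C"
  unfolding op_norm_def using assms by (intro cInf_lower) (auto intro: bdd_belowI[of _ 0])

lemma quasinormed_bounded_linear_maps:
  assumes V: "quasinormed V N" and Y: "quasinormed Y M"
  shows "quasinormed (bounded_linear_maps V N Y M) (op_norm V N M)"
proof -
  interpret V: quasinormed V N by fact
  interpret Y: quasinormed Y M by fact
  let ?L = "bounded_linear_maps V N Y M"
  have AY: "A x \<in> Y" if "A \<in> ?L" "x \<in> V" for A x
    using that by (auto simp: bounded_linear_maps_def)
  note bnd = V.op_norm_bound[OF _ Y.nonneg]
  have sum_bd: "M ((A + B) x) \<le> 2 * (op_norm V N M A + op_norm V N M B) * N x"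
    if "A \<in> ?L" "B \<in> ?L" "x \<in> V" for A B x
  proof -
    have "M ((A + B) x) \<le> 2 * (M (A x) + M (B x))"
      using Y.quasi_triangle[OF AY[OF that(1,3)] AY[OF that(2,3)]] by simp
    also have "\<dots> \<le> 2 * (op_norm V N M A * N x + op_norm V N M B * N x)"
      using bnd(2)[OF that(1) _ that(3)] bnd(2)[OF that(2) _ that(3)] by simp
    finally show ?thesis by (simp add: algebra_simps)
  qed
  have scale_bd: "M ((c *\<^sub>R A) x) \<le> \<bar>c\<bar> * op_norm V N M A * N x"
    if "A \<in> ?L" "x \<in> V" for A c x
  proof -
    have "M ((c *\<^sub>R A) x) \<le> \<bar>c\<bar> * M (A x)"
      using that AY by (simp add: scaleR_fun_def Y.scale_le)
    also have "\<dots> \<le> \<bar>c\<bar> * (op_norm V N M A * N x)"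
      using bnd(2)[OF that(1) _ that(2)] by (simp add: mult_left_mono)
    finally show ?thesis by (simp add: mult.assoc)
  qed
  show ?thesis
  proof
    show "0 \<in> ?L"
      using Y.zero_mem Y.norm_zero_le by (auto simp: bounded_linear_maps_def intro!: exI[of _ 0])
    fix A B assume A: "A \<in> ?L"
    show "0 \<le> op_norm V N M A" using A by (rule bnd) 
    show "c *\<^sub>R A \<in> ?L" for c
    proof -
      have "\<exists>C. \<forall>x\<in>V. M ((c *\<^sub>R A) x) \<le> C * N x" using scale_bd[OF A] by blast
      then show ?thesis using A AY[OF A]
        by (auto simp: bounded_linear_maps_def scaleR_fun_def Y.scale_mem scaleR_add_right)
    qed
    show "op_norm V N M (c *\<^sub>R A) \<le> \<bar>c\<bar> * op_norm V N M A" for c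
      using bnd(1)[OF A] scale_bd[OF A] by (intro op_norm_le) auto
    assume B: "B \<in> ?L"
    show "A + B \<in> ?L"
    proof -
      have "\<exists>C. \<forall>x\<in>V. M ((A + B) x) \<le> C * N x" using sum_bd[OF A B] by blast
      then show ?thesis using A B AY[OF A] AY[OF B]
        by (auto simp: bounded_linear_maps_def Y.add_mem scaleR_add_right)
    qed
    show "op_norm V N M (A + B) \<le> 2 * (op_norm V N M A + op_norm V N M B)"
      using bnd(1)[OF A] bnd(1)[OF B] sum_bd[OF A B] by (intro op_norm_le) auto
  qed
qed

definition bounded_functional ::
    "'a::real_vector set \<Rightarrow> ('a \<Rightarrow> real) \<Rightarrow> real \<Rightarrow> ('a \<Rightarrow> complex) \<Rightarrow> bool" where
  "bounded_functional V N L \<Lambda> \<longleftrightarrow> 0 \<le> L \<and>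
     (\<forall>x\<in>V. \<forall>y\<in>V. \<Lambda> (x + y) = \<Lambda> x + \<Lambda> y) \<and> (\<forall>c. \<forall>x\<in>V. \<Lambda> (c *\<^sub>R x) = c *\<^sub>R \<Lambda> x) \<and>
     (\<forall>x\<in>V. norm (\<Lambda> x) \<le> L * N x)"

text \<open>Evaluation at a vector turns a functional on the values into a functional on the
  linear maps. By applying it repeatedly, a higher derivative is tested on a direction and becomes
  a scalar.\<close>

lemma bounded_functional_eval:
  assumes V: "quasinormed V N" and Y: "quasinormed Y M"
    and \<Lambda>: "bounded_functional Y M L \<Lambda>" and v: "v \<in> V"
  shows "bounded_functional (bounded_linear_maps V N Y M) (op_norm V N M) (L * N v) (\<lambda>A. \<Lambda> (A v))"
proof -
  interpret V: quasinormed V N by fact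
  interpret Y: quasinormed Y M by fact
  have AY: "A v \<in> Y" if "A \<in> bounded_linear_maps V N Y M" for A
    using that v by (auto simp: bounded_linear_maps_def)
  have "norm (\<Lambda> (A v)) \<le> L * N v * op_norm V N M A" if A: "A \<in> bounded_linear_maps V N Y M" for A
  proof -
    have "norm (\<Lambda> (A v)) \<le> L * M (A v)" using \<Lambda> AY[OF A] by (auto simp: bounded_functional_def)
    also have "\<dots> \<le> L * (op_norm V N M A * N v)"
      using \<Lambda> V.op_norm_bound(2)[OF A Y.nonneg v]
      by (intro mult_left_mono) (auto simp: bounded_functional_def)
    finally show ?thesis by (simp add: mult_ac)
  qed
  then show ?thesis
    using \<Lambda> AY V.nonneg[OF v] by (auto simp: bounded_functional_def scaleR_fun_def)
qed

text \<open>Along a line, and tested by a functional, a Frechet derivative becomes the derivative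
  of a complex function of a real variable.\<close>

lemma has_frechet_imp_directional:
  assumes V: "quasinormed V N" and Y: "quasinormed Y M"
    and \<Lambda>: "bounded_functional Y M L \<Lambda>" and v: "v \<in> V"
    and fr: "has_frechet V N Y M f A (t *\<^sub>R v)"
    and fY: "\<And>s. \<bar>s\<bar> < \<rho> \<Longrightarrow> f (s *\<^sub>R v) \<in> Y" and t: "\<bar>t\<bar> < \<rho>"
  shows "((\<lambda>s. \<Lambda> (f (s *\<^sub>R v))) has_vector_derivative \<Lambda> (A v)) (at t)"
  unfolding has_vector_derivative_def has_derivative_at_alt
proof (intro conjI allI impI)
  interpret V: quasinormed V N by fact
  interpret Y: quasinormed Y M by fact
  show "bounded_linear (\<lambda>h. h *\<^sub>R \<Lambda> (A v))" by (rule bounded_linear_scaleR_left)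
  have L: "0 \<le> L" using \<Lambda> by (simp add: bounded_functional_def)
  have A: "A \<in> bounded_linear_maps V N Y M" using fr by (simp add: has_frechet_def)
  have lin: "\<Lambda> (x - y) = \<Lambda> x - \<Lambda> y" if "x \<in> Y" "y \<in> Y" for x y
  proof -
    have "\<Lambda> (x + (-1) *\<^sub>R y) = \<Lambda> x + (-1) *\<^sub>R \<Lambda> y"
      using \<Lambda> that Y.scale_mem[OF that(2), of "-1"] unfolding bounded_functional_def by metis
    then show ?thesis by simp
  qed
  fix e :: real assume e: "0 < e"
  define K where "K = L * N v + 1"
  have Nv: "0 \<le> N v" using V.nonneg[OF v] .
  have K: "K > 0" "L * N v \<le> K" using L Nv by (auto simp: K_def intro: add_nonneg_pos)
  obtain d where d: "d > 0" "\<And>h. h \<in> V \<Longrightarrow> N h < d \<Longrightarrow> M (f (t *\<^sub>R v + h) - f (t *\<^sub>R v) - A h) \<le> e / K * N h"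
  proof -
    have "0 < e / K" using e K by simp
    then show ?thesis using fr that unfolding has_frechet_def by blast
  qed
  show "\<exists>r>0. \<forall>y. norm (y - t) < r \<longrightarrow>
    norm (\<Lambda> (f (y *\<^sub>R v)) - \<Lambda> (f (t *\<^sub>R v)) - (y - t) *\<^sub>R \<Lambda> (A v)) \<le> e * norm (y - t)"
  proof (intro exI[of _ "min (\<rho> - \<bar>t\<bar>) (d / (N v + 1))"] conjI allI impI)
    show "0 < min (\<rho> - \<bar>t\<bar>) (d / (N v + 1))" using t d Nv by auto
    fix y assume y: "norm (y - t) < min (\<rho> - \<bar>t\<bar>) (d / (N v + 1))"
    define h where "h = (y - t) *\<^sub>R v"
    have h: "h \<in> V" using v by (simp add: h_def V.scale_mem)
    have Nh: "N h \<le> \<bar>y - t\<bar> * N v" using V.scale_le[OF v] by (simp add: h_def)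
    also have "\<dots> \<le> \<bar>y - t\<bar> * (N v + 1)" by (simp add: mult_left_mono)
    also have "\<dots> < d" using y Nv by (simp add: pos_less_divide_eq)
    finally have "N h < d" .
    have yv: "t *\<^sub>R v + h = y *\<^sub>R v" by (simp add: h_def flip: scaleR_add_left)
    have mem: "f (y *\<^sub>R v) \<in> Y" "f (t *\<^sub>R v) \<in> Y" using fY y t by auto
    have Ah: "A h \<in> Y" "A h = (y - t) *\<^sub>R A v" "A v \<in> Y"
      using A h v by (auto simp: bounded_linear_maps_def h_def)
    have "\<Lambda> (A h) = (y - t) *\<^sub>R \<Lambda> (A v)"
      using \<Lambda> Ah by (auto simp: bounded_functional_def)
    then have "norm (\<Lambda> (f (y *\<^sub>R v)) - \<Lambda> (f (t *\<^sub>R v)) - (y - t) *\<^sub>R \<Lambda> (A v)) =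
        norm (\<Lambda> (f (y *\<^sub>R v) - f (t *\<^sub>R v) - A h))"
      using lin mem Ah Y.diff_mem by simp
    also have "\<dots> \<le> L * M (f (y *\<^sub>R v) - f (t *\<^sub>R v) - A h)"
      using \<Lambda> mem Ah Y.diff_mem by (simp add: bounded_functional_def)
    also have "\<dots> \<le> L * (e / K * N h)"
      using d(2)[OF h \<open>N h < d\<close>] L by (intro mult_left_mono) (simp_all add: yv)
    also have "\<dots> \<le> L * (e / K * (\<bar>y - t\<bar> * N v))"
      using Nh L e K by (intro mult_left_mono) auto
    also have "\<dots> = (L * N v) / K * (e * \<bar>y - t\<bar>)" by simp
    also have "\<dots> \<le> 1 * (e * \<bar>y - t\<bar>)"
      using K e by (intro mult_right_mono) auto
    finally show "norm (\<Lambda> (f (y *\<^sub>R v)) - \<Lambda> (f (t *\<^sub>R v)) - (y - t) *\<^sub>R \<Lambda> (A v)) \<le> e * norm (y - t)"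
      by simp
  qed
qed

text \<open>Derivatives are unique, so a derivative that is known to exist has to agree with the
  series differentiated term by term.\<close>

lemma power_series_vector_derivative:
  fixes c :: "nat \<Rightarrow> complex" and G :: "real \<Rightarrow> complex"
  assumes G: "\<And>s. \<bar>s\<bar> < \<rho> \<Longrightarrow> (\<lambda>k. c k * of_real s ^ k) sums G s" and t: "\<bar>t\<bar> < \<rho>"
    and D: "(G has_vector_derivative D) (at t)"
  shows "(\<lambda>k. diffs c k * of_real t ^ k) sums D"
proof -
  have inside: "summable (\<lambda>k. c k * z ^ k)" if z: "norm z < \<rho>" for z :: complex
  proof -
    obtain r where r: "norm z < r" "r < \<rho>" using dense[OF z] by blast
    then have "\<bar>r\<bar> < \<rho>" using norm_ge_zero[of z] by linarith
    from sums_summable[OF G[OF this]] show ?thesis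
      by (rule powser_inside) (use r in auto)
  qed
  define P where "P = (\<lambda>z. \<Sum>k. c k * z ^ k)"
  obtain r where r: "\<bar>t\<bar> < r" "r < \<rho>" using dense[OF t] by blast
  have "(P has_field_derivative (\<Sum>k. diffs c k * of_real t ^ k)) (at (of_real t))"
    unfolding P_def by (rule termdiffs_strong[OF inside[of "of_real r"]]) (use r in auto)
  from has_vector_derivative_real_field[OF this]
  have "((\<lambda>s. P (of_real s)) has_vector_derivative (\<Sum>k. diffs c k * of_real t ^ k)) (at t)" .
  moreover have "((\<lambda>s. P (of_real s)) has_vector_derivative D) (at t)"
  proof (rule has_vector_derivative_transform_within_open[OF D, of "{-\<rho><..<\<rho>}"])
    show "G s = P (of_real s)" if "s \<in> {-\<rho><..<\<rho>}" for s
      using G[of s] that by (auto simp: P_def sums_iff)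
  qed (use t in auto)
  ultimately have "(\<Sum>k. diffs c k * of_real t ^ k) = D"
    by (rule vector_derivative_unique_at)
  moreover have "summable (\<lambda>k. diffs c k * of_real t ^ k)"
    by (rule termdiff_converges[of _ \<rho>]) (use t inside in auto)
  ultimately show ?thesis by (simp add: sums_iff)
qed

text \<open>Along a line through the origin a map of class \<open>C\<^sup>3\<close> has a third derivative that is cubic in the
  direction; if in addition the map is analytic on that line, this derivative is read off from the
  third coefficient.\<close>

lemma C3_at_zero_coefficient_bound:
  assumes V: "quasinormed V N" and C3: "C3_at_zero V N f"
  obtains C where "\<And>v L \<Lambda> a \<rho>. v \<in> V \<Longrightarrow> bounded_functional V N L \<Lambda> \<Longrightarrow> 0 < \<rho> \<Longrightarrow>
    (\<And>s. \<bar>s\<bar> < \<rho> \<Longrightarrow> (\<lambda>k. a k * of_real s ^ k) sums \<Lambda> (f (s *\<^sub>R v))) \<Longrightarrow>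
    norm (a 3) \<le> C * L * N v ^ 3"
proof -
  interpret V: quasinormed V N by fact
  define L1 where "L1 = bounded_linear_maps V N V N"
  define N1 where "N1 = op_norm V N N"
  define L2 where "L2 = bounded_linear_maps V N L1 N1"
  define N2 where "N2 = op_norm V N N1"
  define N3 where "N3 = op_norm V N N2"
  interpret L1: quasinormed L1 N1
    unfolding L1_def N1_def using V V by (rule quasinormed_bounded_linear_maps)
  interpret L2: quasinormed L2 N2
    unfolding L2_def N2_def using V L1.quasinormed_axioms by (rule quasinormed_bounded_linear_maps)
  obtain r D1 D2 D3 where r: "r > 0"
    and F0: "\<forall>x\<in>V. N x < r \<longrightarrow> f x \<in> V \<and> has_frechet V N V N f (D1 x) x \<and>
      has_frechet V N L1 N1 D1 (D2 x) x \<and> has_frechet V N L2 N2 D2 (D3 x) x"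
    using C3[unfolded C3_at_zero_def Let_def, folded L1_def N1_def, folded L2_def N2_def]
    by (elim exE conjE) (rule that)
  have F: "f x \<in> V" "has_frechet V N V N f (D1 x) x"
      "has_frechet V N L1 N1 D1 (D2 x) x" "has_frechet V N L2 N2 D2 (D3 x) x"
    if "x \<in> V" "N x < r" for x
    using F0 that by simp_all
  have "N 0 < r" using V.norm_zero_le r by linarith
  have D30: "D3 0 \<in> bounded_linear_maps V N L2 N2"
    using F(4)[OF V.zero_mem \<open>N 0 < r\<close>] by (simp add: has_frechet_def)
  show ?thesis
  proof
    fix v L \<Lambda> a and \<rho>0 :: real
    assume v: "v \<in> V" and \<Lambda>: "bounded_functional V N L \<Lambda>" and \<rho>0: "0 < \<rho>0"
      and S0: "\<And>s. \<bar>s\<bar> < \<rho>0 \<Longrightarrow> (\<lambda>k. a k * of_real s ^ k) sums \<Lambda> (f (s *\<^sub>R v))"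
    have Nv: "0 \<le> N v" using V.nonneg[OF v] .
    define \<rho> where "\<rho> = min \<rho>0 (r / (N v + 1))"
    have \<rho>: "0 < \<rho>" using \<rho>0 r Nv by (auto simp: \<rho>_def)
    have line: "s *\<^sub>R v \<in> V" "N (s *\<^sub>R v) < r" if "\<bar>s\<bar> < \<rho>" for s
    proof -
      have "N (s *\<^sub>R v) \<le> \<bar>s\<bar> * N v" using V.scale_le[OF v] .
      also have "\<dots> \<le> \<bar>s\<bar> * (N v + 1)" by (simp add: mult_left_mono)
      also have "\<dots> < r" using that Nv by (simp add: \<rho>_def pos_less_divide_eq)
      finally show "N (s *\<^sub>R v) < r" .
    qed (use v V.scale_mem in auto)
    note \<Lambda>1 = bounded_functional_eval[OF V V \<Lambda> v, folded L1_def N1_def]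
    note \<Lambda>2 = bounded_functional_eval[OF V L1.quasinormed_axioms \<Lambda>1 v, folded L2_def N2_def]
    have mem1: "D1 x \<in> L1" if "x \<in> V" "N x < r" for x
      using F(2)[OF that] by (simp add: has_frechet_def L1_def)
    have mem2: "D2 x \<in> L2" if "x \<in> V" "N x < r" for x
      using F(3)[OF that] by (simp add: has_frechet_def L2_def)
    have S0': "(\<lambda>k. a k * of_real s ^ k) sums \<Lambda> (f (s *\<^sub>R v))" if "\<bar>s\<bar> < \<rho>" for s
      using S0 that by (simp add: \<rho>_def)
    have S1: "(\<lambda>k. diffs a k * of_real s ^ k) sums \<Lambda> (D1 (s *\<^sub>R v) v)" if s: "\<bar>s\<bar> < \<rho>" for s
      using has_frechet_imp_directional[OF V V \<Lambda> v F(2)[OF line[OF s]] _ s] F(1) line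
      by (intro power_series_vector_derivative[OF S0' s]) auto
    have S2: "(\<lambda>k. diffs (diffs a) k * of_real s ^ k) sums \<Lambda> (D2 (s *\<^sub>R v) v v)" if s: "\<bar>s\<bar> < \<rho>" for s
      using has_frechet_imp_directional[OF V L1.quasinormed_axioms \<Lambda>1 v F(3)[OF line[OF s]] _ s] mem1 line
      by (intro power_series_vector_derivative[OF S1 s]) auto
    have S3: "(\<lambda>k. diffs (diffs (diffs a)) k * of_real 0 ^ k) sums \<Lambda> (D3 (0 *\<^sub>R v) v v v)"
      using has_frechet_imp_directional[OF V L2.quasinormed_axioms \<Lambda>2 v F(4)[OF line[of 0]], of \<rho>] \<rho> mem2 line
      by (intro power_series_vector_derivative[OF S2]) auto
    have "(\<lambda>k. diffs (diffs (diffs a)) k * of_real 0 ^ k) sums diffs (diffs (diffs a)) 0"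
      using powser_sums_zero[of "diffs (diffs (diffs a))"] by simp
    with S3 have "\<Lambda> (D3 0 v v v) = diffs (diffs (diffs a)) 0"
      using sums_unique2 by fastforce
    also have "\<dots> = 6 * a 3" by (simp add: diffs_def numeral_3_eq_3)
    finally have eq: "6 * a 3 = \<Lambda> (D3 0 v v v)" ..
    have "D3 0 v \<in> L2" using D30 v by (auto simp: bounded_linear_maps_def)
    then have "norm (\<Lambda> (D3 0 v v v)) \<le> L * N v * N v * N2 (D3 0 v)"
      using \<Lambda>2 by (auto simp: bounded_functional_def)
    also have "\<dots> \<le> L * N v * N v * (N3 (D3 0) * N v)"
      using V.op_norm_bound(2)[OF D30 L2.nonneg v] \<Lambda> Nv
      by (intro mult_left_mono) (auto simp: N3_def bounded_functional_def)
    finally have "6 * norm (a 3) \<le> N3 (D3 0) * L * N v ^ 3"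
      using arg_cong[OF eq, of norm] by (simp add: norm_mult power3_eq_cube mult_ac)
    then show "norm (a 3) \<le> (N3 (D3 0) / 6) * L * N v ^ 3" by simp
  qed
qed

lemma quasinormed_sobolev: "quasinormed (sob_space s) (sob_norm s)"
proof
  have "has_fourier 0 (\<lambda>_. 0)"
    by (auto simp: has_fourier_def inv_fourier_def fun_eq_iff)
  then show "0 \<in> sob_space s" by (rule sob_spaceI) simp
  show "0 \<le> sob_norm s u" for u by (simp add: sob_norm_eq)
qed (use sob_space_add sob_space_scaleR sob_norm_add sob_norm_scaleR in \<open>auto simp only: order_refl\<close>)


section \<open>Convolution\<close>

definition conv :: "(plane \<Rightarrow> 'c::{real_normed_field, banach, second_countable_topology}) \<Rightarrow>
    (plane \<Rightarrow> 'c) \<Rightarrow> plane \<Rightarrow> 'c" where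
  "conv f g z = (LINT w|lborel. f w * g (z - w))"

lemma conv_measurable:
  assumes "(\<lambda>x. f (fst x) (snd x)) \<in> borel_measurable (M \<Otimes>\<^sub>M borel)"
    and "(\<lambda>x. g (fst x) (snd x)) \<in> borel_measurable (M \<Otimes>\<^sub>M borel)"
  shows "(\<lambda>x. conv (f (fst x)) (g (fst x)) (snd x)) \<in> borel_measurable (M \<Otimes>\<^sub>M borel)"
proof -
  have m: "(\<lambda>x. (fst (fst x), snd x)) \<in> (M \<Otimes>\<^sub>M borel) \<Otimes>\<^sub>M lborel \<rightarrow>\<^sub>M M \<Otimes>\<^sub>M borel"
    "(\<lambda>x. (fst (fst x), snd (fst x) - snd x)) \<in> (M \<Otimes>\<^sub>M borel) \<Otimes>\<^sub>M lborel \<rightarrow>\<^sub>M M \<Otimes>\<^sub>M borel"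
    by measurable
  have [measurable]: "(\<lambda>x. f (fst (fst x)) (snd x)) \<in> borel_measurable ((M \<Otimes>\<^sub>M borel) \<Otimes>\<^sub>M lborel)"
    "(\<lambda>x. g (fst (fst x)) (snd (fst x) - snd x)) \<in> borel_measurable ((M \<Otimes>\<^sub>M borel) \<Otimes>\<^sub>M lborel)"
    using measurable_compose[OF m(1) assms(1)] measurable_compose[OF m(2) assms(2)] by simp_all
  show ?thesis
    unfolding conv_def
    by (rule sigma_finite_measure.borel_measurable_lebesgue_integral[OF sigma_finite_lborel])
       (simp add: case_prod_beta')
qed

lemma conv_measurable' [measurable]:
  fixes f g :: "plane \<Rightarrow> 'c::{real_normed_field, banach, second_countable_topology}"
  assumes [measurable]: "f \<in> borel_measurable borel" "g \<in> borel_measurable borel"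
  shows "conv f g \<in> borel_measurable borel"
  unfolding conv_def[abs_def] by measurable

text \<open>Translations and point reflections preserve Lebesgue measure.\<close>

lemma
  fixes g :: "'a::euclidean_space \<Rightarrow> 'c::{real_normed_field, banach, second_countable_topology}"
  assumes "c = 1 \<or> c = -1" and [measurable]: "g \<in> borel_measurable borel"
  shows integral_isometry: "(LINT x|lborel. g (t + c *\<^sub>R x)) = (LINT x|lborel. g x)"
    and integrable_isometry: "integrable lborel (\<lambda>x. g (t + c *\<^sub>R x)) \<longleftrightarrow> integrable lborel g"
proof -
  have "\<bar>c\<bar> = 1" "c \<noteq> 0" using assms by auto
  then have eq: "(lborel :: 'a measure) = distr lborel borel (\<lambda>x. t + c *\<^sub>R x)"
    using lborel_affine[of c t] by (simp add: density_1)
  show "(LINT x|lborel. g (t + c *\<^sub>R x)) = (LINT x|lborel. g x)"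
    by (subst (2) eq) (simp add: integral_distr)
  show "integrable lborel (\<lambda>x. g (t + c *\<^sub>R x)) \<longleftrightarrow> integrable lborel g"
    by (subst (2) eq) (simp add: integrable_distr_eq)
qed

lemma
  fixes g :: "plane \<Rightarrow> 'c::{real_normed_field, banach, second_countable_topology}"
  assumes [measurable]: "g \<in> borel_measurable borel"
  shows integral_shift: "(LINT x|lborel. g (x - t)) = (LINT x|lborel. g x)"
    and integrable_shift: "integrable lborel (\<lambda>x. g (x - t)) \<longleftrightarrow> integrable lborel g"
    and integral_reflect: "(LINT x|lborel. g (t - x)) = (LINT x|lborel. g x)"
  using integral_isometry[of 1 g "- t"] integrable_isometry[of 1 g "- t"]
    integral_isometry[of "-1" g t] integrable_isometry[of "-1" g t] by simp_all

lemma conv_commute: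
  fixes f g :: "plane \<Rightarrow> 'c::{real_normed_field, banach, second_countable_topology}"
  assumes [measurable]: "f \<in> borel_measurable borel" "g \<in> borel_measurable borel"
  shows "conv f g z = conv g f z"
  unfolding conv_def using integral_reflect[of "\<lambda>w. f w * g (z - w)" z] by (simp add: mult.commute)

lemma
  fixes f g :: "plane \<Rightarrow> 'c::{real_normed_field, banach, second_countable_topology}"
  assumes f: "integrable lborel f" and [measurable]: "g \<in> borel_measurable borel"
    and g: "\<And>z. norm (g z) \<le> S"
  shows conv_integrand_integrable: "integrable lborel (\<lambda>w. f w * g (z - w))"
    and norm_conv_le: "norm (conv f g z) \<le> (LINT w|lborel. norm (f w)) * S"
proof -
  have [measurable]: "f \<in> borel_measurable borel"
    using f by (simp add: borel_measurable_integrable)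
  have le: "norm (f w * g (z - w)) \<le> norm (f w) * S" for w
    by (simp add: norm_mult g mult_left_mono)
  show i: "integrable lborel (\<lambda>w. f w * g (z - w))"
  proof (rule Bochner_Integration.integrable_bound)
    show "integrable lborel (\<lambda>w. norm (f w) * S)" using f by simp
  qed (use le in \<open>auto intro!: AE_I2 intro: order_trans[OF _ abs_ge_self]\<close>)
  have "norm (conv f g z) \<le> (LINT w|lborel. norm (f w * g (z - w)))"
    unfolding conv_def by (rule integral_norm_bound)
  also have "\<dots> \<le> (LINT w|lborel. norm (f w) * S)"
    using i f le by (intro integral_mono) auto
  finally show "norm (conv f g z) \<le> (LINT w|lborel. norm (f w)) * S" by simp
qed

lemma norm_conv_mono:
  fixes f g :: "plane \<Rightarrow> complex" and F G :: "plane \<Rightarrow> real"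
  assumes [measurable]: "f \<in> borel_measurable borel" "g \<in> borel_measurable borel"
    and fF: "\<And>z. norm (f z) \<le> F z" and gG: "\<And>z. norm (g z) \<le> G z"
    and F: "integrable lborel F" and [measurable]: "G \<in> borel_measurable borel" and G: "\<And>z. G z \<le> S"
  shows "norm (conv f g z) \<le> conv F G z"
proof -
  have G': "norm (G z) \<le> S" for z
    using order_trans[OF norm_ge_zero gG[of z]] G[of z] by simp
  have le: "norm (f w * g (z - w)) \<le> F w * G (z - w)" for w
    unfolding norm_mult by (intro mult_mono fF gG order_trans[OF norm_ge_zero fF]) auto
  have i: "integrable lborel (\<lambda>w. F w * G (z - w))"
    by (rule conv_integrand_integrable[OF F _ G']) simp
  have "norm (conv f g z) \<le> (LINT w|lborel. norm (f w * g (z - w)))"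
    unfolding conv_def by (rule integral_norm_bound)
  also have "\<dots> \<le> conv F G z"
    unfolding conv_def
    by (rule integral_mono[OF _ i le])
       (rule Bochner_Integration.integrable_bound[OF i],
        use le in \<open>auto intro!: AE_I2 intro: order_trans[OF _ abs_ge_self]\<close>)
  finally show ?thesis .
qed

lemma
  fixes f g :: "plane \<Rightarrow> 'c::{real_normed_field, banach, second_countable_topology}"
  assumes f: "integrable lborel f" and g: "integrable lborel g"
  shows conv_kernel_integrable: "integrable (lborel \<Otimes>\<^sub>M lborel) (\<lambda>(w, z). f w * g (z - w))"
    and conv_integrable: "integrable lborel (conv f g)"
    and integral_conv: "(LINT z|lborel. conv f g z) = (LINT w|lborel. f w) * (LINT z|lborel. g z)"
proof -
  have [measurable]: "f \<in> borel_measurable borel" "g \<in> borel_measurable borel"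
    using f g by (auto simp: borel_measurable_integrable)
  show k: "integrable (lborel \<Otimes>\<^sub>M lborel) (\<lambda>(w, z). f w * g (z - w))"
  proof (rule lborel_pair.Fubini_integrable)
    show "integrable lborel (\<lambda>w. LINT z|lborel. norm (case (w, z) of (w, z) \<Rightarrow> f w * g (z - w)))"
      using f integral_shift[of "\<lambda>z. norm (g z)"] by (simp add: norm_mult)
    show "AE w in lborel. integrable lborel (\<lambda>z. case (w, z) of (w, z) \<Rightarrow> f w * g (z - w))"
      using g integrable_shift[of g] by (intro AE_I2) simp
  qed measurable
  show "integrable lborel (conv f g)"
    unfolding conv_def[abs_def] using lborel_pair.integrable_snd[OF k] by simp
  show "(LINT z|lborel. conv f g z) = (LINT w|lborel. f w) * (LINT z|lborel. g z)"
    unfolding conv_def lborel_pair.Fubini_integral[OF k]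
    using integral_shift[of g] by simp
qed

text \<open>The inverse transform turns convolution into multiplication; the factor is the one of the
  unitary normalisation.\<close>

lemma inv_fourier_fun_conv:
  assumes f: "integrable lborel f" and g: "integrable lborel g"
  shows "inv_fourier_fun f z * inv_fourier_fun g z =
    inv_fourier_fun (\<lambda>\<zeta>. conv f g \<zeta> / of_real (2 * pi)) z"
proof -
  have [measurable]: "f \<in> borel_measurable borel" "g \<in> borel_measurable borel"
    using f g by (auto simp: borel_measurable_integrable)
  let ?f = "\<lambda>w. cis (z \<bullet> w) * f w" and ?g = "\<lambda>w. cis (z \<bullet> w) * g w"
  have if': "integrable lborel ?f" and ig': "integrable lborel ?g"
    by (rule Bochner_Integration.integrable_bound[OF f] Bochner_Integration.integrable_bound[OF g];
        simp add: norm_mult)+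
  have "conv ?f ?g \<zeta> = cis (z \<bullet> \<zeta>) * conv f g \<zeta>" for \<zeta>
  proof -
    have "cis (z \<bullet> w) * f w * (cis (z \<bullet> (\<zeta> - w)) * g (\<zeta> - w)) = cis (z \<bullet> \<zeta>) * (f w * g (\<zeta> - w))" for w
    proof -
      have "cis (z \<bullet> w) * cis (z \<bullet> (\<zeta> - w)) = cis (z \<bullet> \<zeta>)"
        by (simp add: cis_mult inner_diff_right)
      then show ?thesis by (metis mult.assoc mult.left_commute)
    qed
    then show ?thesis by (simp only: conv_def integral_mult_right_zero)
  qed
  then have "(LINT \<zeta>|lborel. cis (z \<bullet> \<zeta>) * conv f g \<zeta>) = (LINT w|lborel. ?f w) * (LINT w|lborel. ?g w)"
    using integral_conv[OF if' ig'] by simp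
  then show ?thesis by (simp add: inv_fourier_fun_def)
qed

section \<open>Rapidly decreasing majorants\<close>

text \<open>A majorant of this kind for a transform places the function in every
  \<open>H\<^sup>n\<close> and dominates all the integrals that occur in passing to the limit.\<close>

definition rapid :: "(plane \<Rightarrow> real) \<Rightarrow> bool" where
  "rapid d \<longleftrightarrow> d \<in> borel_measurable borel \<and> (\<forall>z. 0 \<le> d z) \<and>
     (\<forall>n. integrable lborel (\<lambda>z. (1 + norm z) ^ n * d z)) \<and>
     (\<forall>n. \<exists>K. \<forall>z. (1 + norm z) ^ n * d z \<le> K)"

lemma rapidD:
  assumes "rapid d"
  shows "d \<in> borel_measurable borel" "0 \<le> d z"
    "integrable lborel (\<lambda>z. (1 + norm z) ^ n * d z)" "integrable lborel d"
proof -
  show "d \<in> borel_measurable borel" "0 \<le> d z" "integrable lborel (\<lambda>z. (1 + norm z) ^ n * d z)" for n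
    using assms unfolding rapid_def by blast+
  from this(3)[of 0] show "integrable lborel d" by simp
qed

lemma rapid_bounded:
  assumes "rapid d"
  obtains K where "\<And>z. (1 + norm z) ^ n * d z \<le> K" "0 \<le> K"
proof -
  obtain K where "\<And>z. (1 + norm z) ^ n * d z \<le> K" using assms unfolding rapid_def by blast
  moreover from this[of 0] have "0 \<le> K" using rapidD(2)[OF assms, of 0] by simp
  ultimately show ?thesis by (rule that)
qed

lemma rapid_square_integrable:
  assumes d: "rapid d"
  shows "integrable lborel (\<lambda>z. ((1 + norm z) ^ n * d z)\<^sup>2)"
proof -
  note [measurable] = rapidD(1)[OF d]
  obtain K where K: "\<And>z. (1 + norm z) ^ n * d z \<le> K" "0 \<le> K" using rapid_bounded[OF d] by blast
  show ?thesis
  proof (rule Bochner_Integration.integrable_bound)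
    show "integrable lborel (\<lambda>z. K * ((1 + norm z) ^ n * d z))" using rapidD(3)[OF d] by simp
    show "AE z in lborel. norm (((1 + norm z) ^ n * d z)\<^sup>2) \<le> norm (K * ((1 + norm z) ^ n * d z))"
      using K rapidD(2)[OF d]
      by (intro AE_I2) (simp add: power2_eq_square abs_mult mult_right_mono)
  qed simp
qed

text \<open>The weight is submultiplicative: \<open>1 + \<parallel>z\<parallel> \<le> (1 +
  \<parallel>w\<parallel>) (1 + \<parallel>z - w\<parallel>)\<close>.\<close>

lemma
  assumes d: "rapid d"
  shows rapid_conv_integrable: "integrable lborel (\<lambda>z. (1 + norm z) * conv d d z)"
    and rapid_conv_nonneg: "0 \<le> conv d d z"
proof -
  note [measurable] = rapidD(1)[OF d]
  obtain K where K: "\<And>z. (1 + norm z) ^ 1 * d z \<le> K" "0 \<le> K" using rapid_bounded[OF d] by blast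
  have K': "d z \<le> K" for z
    using K(1)[of z] mult_right_mono[of 1 "1 + norm z" "d z"] rapidD(2)[OF d, of z] by simp
  show nn: "0 \<le> conv d d z" for z
    unfolding conv_def using rapidD(2)[OF d] by (intro integral_nonneg_AE) auto
  define D where "D = (\<lambda>z. (1 + norm z) * d z)"
  have iD: "integrable lborel D" using rapidD(3)[OF d, of 1] by (simp add: D_def)
  have [measurable]: "D \<in> borel_measurable borel" by (simp add: D_def)
  have DK: "norm (D z) \<le> K" for z using K(1)[of z] rapidD(2)[OF d, of z] by (simp add: D_def)
  show "integrable lborel (\<lambda>z. (1 + norm z) * conv d d z)"
  proof (rule Bochner_Integration.integrable_bound[OF conv_integrable[OF iD iD]])
    have "(1 + norm z) * conv d d z \<le> conv D D z" for z
      unfolding conv_def integral_mult_right_zero[symmetric]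
    proof (rule integral_mono)
      show "integrable lborel (\<lambda>w. (1 + norm z) * (d w * d (z - w)))"
        using conv_integrand_integrable[OF rapidD(4)[OF d], of d K z] K' rapidD(2)[OF d] by simp
      show "integrable lborel (\<lambda>w. D w * D (z - w))"
        by (rule conv_integrand_integrable[OF iD _ DK]) simp
      fix w
      have "norm z \<le> norm w + norm (z - w)" using norm_triangle_ineq[of w "z - w"] by simp
      moreover have "0 \<le> norm w * norm (z - w)" by simp
      ultimately have "1 + norm z \<le> (1 + norm w) * (1 + norm (z - w))"
        by (simp only: distrib_right distrib_left mult_1_left mult_1_right)
      then have "(1 + norm z) * (d w * d (z - w)) \<le> (1 + norm w) * (1 + norm (z - w)) * (d w * d (z - w))"
        using rapidD(2)[OF d] by (intro mult_right_mono) auto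
      also have "\<dots> = D w * D (z - w)" by (simp add: D_def)
      finally show "(1 + norm z) * (d w * d (z - w)) \<le> D w * D (z - w)" .
    qed
    then show "AE z in lborel. norm ((1 + norm z) * conv d d z) \<le> norm (conv D D z)"
      using nn by (intro AE_I2) (auto intro: order_trans[OF _ abs_ge_self])
  qed simp
qed


section \<open>The power series of the solution in the size of the data\<close>

declare sum.cong [fundef_cong]

text \<open>The coefficient of \<open>\<delta>\<^sup>n\<close> in the transform of the solution
  with data \<open>\<delta> f\<close>: comparing coefficients in the integral equation expresses
  it by the coefficients of lower order.\<close>

function iterate :: "(plane \<Rightarrow> real) \<Rightarrow> (plane \<Rightarrow> complex) \<Rightarrow> nat \<Rightarrow> real \<Rightarrow> plane \<Rightarrow> complex" where
  "iterate p f n = (if n = 0 then (\<lambda>t z. 0) else if n = 1 then (\<lambda>t z. cis (t * p z) * f z)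
     else (\<lambda>t z. - (\<i> * of_real (fst z) / of_real (2 * pi)) *
       (LINT \<tau>:{0..t}|lborel. cis ((t - \<tau>) * p z) *
         (\<Sum>j\<in>{1..<n}. conv (iterate p f j \<tau>) (iterate p f (n - j) \<tau>) z))))"
  by auto
termination by (relation "Wellfounded.measure (\<lambda>(p, f, n). n)") auto

text \<open>The iterates without their dependence on time. The constant comes from
  \<open>\<bar>\<xi>\<bar> / (2 \<pi>) \<le> n R / (2 \<pi>)\<close> and the factor \<open>1 / (n
  - 1)\<close> of the time integration: for \<open>n \<ge> 2\<close> their product is at most
  \<open>R / \<pi>\<close>.\<close>

function majorant :: "real \<Rightarrow> (plane \<Rightarrow> complex) \<Rightarrow> nat \<Rightarrow> plane \<Rightarrow> real" where
  "majorant R f n = (if n = 0 then (\<lambda>z. 0) else if n = 1 then (\<lambda>z. norm (f z))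
     else (\<lambda>z. R / pi * (\<Sum>j\<in>{1..<n}. conv (majorant R f j) (majorant R f (n - j)) z)))"
  by auto
termination by (relation "Wellfounded.measure (\<lambda>(R, f, n). n)") auto

declare iterate.simps [simp del] majorant.simps [simp del]

lemma sum_inverse_squares_le: "(\<Sum>j\<in>{1..<n}. 1 / (real j)\<^sup>2) \<le> 2"
proof -
  have "(\<Sum>j\<in>{1..<Suc m}. 1 / (real j)\<^sup>2) \<le> 2 - 1 / real m" if "m \<ge> 1" for m
    using that
  proof (induction m rule: dec_induct)
    case base
    show ?case by simp
  next
    case (step m)
    have "1 / (real (Suc m))\<^sup>2 \<le> 1 / real m - 1 / real (Suc m)"
    proof -
      have "1 / (real (Suc m))\<^sup>2 \<le> 1 / (real m * real (Suc m))"
        using step by (intro divide_left_mono) (auto simp: power2_eq_square)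
      also have "\<dots> = 1 / real m - 1 / real (Suc m)" using step by (simp add: field_simps)
      finally show ?thesis .
    qed
    then show ?case using step by simp
  qed
  note le = this
  show ?thesis
  proof (cases "n \<ge> 2")
    case True
    then obtain m where "n = Suc m" "m \<ge> 1" by (cases n) auto
    with le[of m] show ?thesis by (simp only:) (auto intro: order_trans)
  qed (auto simp: not_le)
qed

text \<open>The sequence \<open>1 / n\<^sup>2\<close> is stable under discrete convolution up to a
  constant, because \<open>1 / (j (n - j))\<close> is the sum of \<open>1 / j\<close> and \<open>1
  / (n - j)\<close> divided by \<open>n\<close>. This lets a quadratic recursion be solved by a
  geometric sequence.\<close>

lemma sum_inverse_squares_product_le:
  "(\<Sum>j\<in>{1..<n}. 1 / (real j)\<^sup>2 * (1 / (real (n - j))\<^sup>2)) \<le> 8 / (real n)\<^sup>2"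
proof -
  have le: "1 / (real j)\<^sup>2 * (1 / (real (n - j))\<^sup>2) \<le>
      2 / (real n)\<^sup>2 * (1 / (real j)\<^sup>2 + 1 / (real (n - j))\<^sup>2)" if "j \<in> {1..<n}" for j
  proof -
    have aux: "1 / a\<^sup>2 * (1 / b\<^sup>2) \<le> 2 / (a + b)\<^sup>2 * (1 / a\<^sup>2 + 1 / b\<^sup>2)" if "a > 0" "b > 0" for a b :: real
    proof -
      have "(a + b)\<^sup>2 \<le> 2 * (a\<^sup>2 + b\<^sup>2)"
        using zero_le_power2[of "a - b"] by (simp add: power2_eq_square algebra_simps)
      then have "1 \<le> 2 * (a\<^sup>2 + b\<^sup>2) / (a + b)\<^sup>2" using that by simp
      then have "1 / (a\<^sup>2 * b\<^sup>2) * 1 \<le> 1 / (a\<^sup>2 * b\<^sup>2) * (2 * (a\<^sup>2 + b\<^sup>2) / (a + b)\<^sup>2)"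
        using that by (intro mult_left_mono) auto
      also have "\<dots> = 2 / (a + b)\<^sup>2 * ((a\<^sup>2 + b\<^sup>2) / (a\<^sup>2 * b\<^sup>2))" by simp
      also have "(a\<^sup>2 + b\<^sup>2) / (a\<^sup>2 * b\<^sup>2) = 1 / a\<^sup>2 + 1 / b\<^sup>2"
        using that by (simp add: add_divide_distrib)
      finally show ?thesis by simp
    qed
    have "real n = real j + real (n - j)" using that by auto
    moreover have "0 < real j" "0 < real (n - j)" using that by auto
    ultimately show ?thesis using aux[of "real j" "real (n - j)"] by metis
  qed
  have refl: "(\<Sum>j\<in>{1..<n}. 1 / (real (n - j))\<^sup>2) = (\<Sum>j\<in>{1..<n}. 1 / (real j)\<^sup>2)"
    by (rule sum.reindex_bij_witness[of _ "\<lambda>j. n - j" "\<lambda>j. n - j"]) auto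
  have "(\<Sum>j\<in>{1..<n}. 1 / (real j)\<^sup>2 * (1 / (real (n - j))\<^sup>2)) \<le>
      (\<Sum>j\<in>{1..<n}. 2 / (real n)\<^sup>2 * (1 / (real j)\<^sup>2 + 1 / (real (n - j))\<^sup>2))"
    by (intro sum_mono le)
  also have "\<dots> = 2 / (real n)\<^sup>2 * (2 * (\<Sum>j\<in>{1..<n}. 1 / (real j)\<^sup>2))"
    by (simp only: sum_distrib_left[symmetric] sum.distrib refl mult_2)
  also have "\<dots> \<le> 2 / (real n)\<^sup>2 * (2 * 2)"
    using sum_inverse_squares_le by (intro mult_left_mono) auto
  finally show ?thesis by simp
qed

lemma conv_scale: "conv (\<lambda>w. a * f w) (\<lambda>w. b * g w) z = a * b * conv f g z"
proof -
  have "(\<lambda>w. a * f w * (b * g (z - w))) = (\<lambda>w. a * b * (f w * g (z - w)))"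
    by (simp add: fun_eq_iff mult_ac)
  then show ?thesis by (simp add: conv_def)
qed

lemma time_integral_measurable:
  fixes h :: "real \<Rightarrow> plane \<Rightarrow> real \<Rightarrow> complex"
  assumes [measurable]: "(\<lambda>x. h (fst (fst x)) (snd (fst x)) (snd x)) \<in>
      borel_measurable ((borel \<Otimes>\<^sub>M borel) \<Otimes>\<^sub>M lborel)"
  shows "(\<lambda>x. LINT \<tau>:{0..fst x}|lborel. h (fst x) (snd x) \<tau>) \<in> borel_measurable (borel \<Otimes>\<^sub>M borel)"
proof -
  have "(\<lambda>x. (if 0 \<le> snd x \<and> snd x \<le> fst (fst x) then 1 else 0) *\<^sub>R h (fst (fst x)) (snd (fst x)) (snd x))
      \<in> borel_measurable ((borel \<Otimes>\<^sub>M borel) \<Otimes>\<^sub>M lborel)"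
    by measurable
  then have "(\<lambda>x. LINT \<tau>|lborel. (if 0 \<le> \<tau> \<and> \<tau> \<le> fst x then 1 else 0) *\<^sub>R h (fst x) (snd x) \<tau>)
      \<in> borel_measurable (borel \<Otimes>\<^sub>M borel)"
    by (intro sigma_finite_measure.borel_measurable_lebesgue_integral[OF sigma_finite_lborel])
       (simp add: case_prod_beta')
  then show ?thesis
    unfolding set_lebesgue_integral_def indicator_def atLeastAtMost_iff of_bool_def .
qed

lemma norm_time_integral_le:
  fixes g :: "real \<Rightarrow> complex"
  assumes [measurable]: "g \<in> borel_measurable borel"
    and G: "set_integrable lborel {0..t} G" and le: "\<And>\<tau>. 0 \<le> \<tau> \<Longrightarrow> \<tau> \<le> t \<Longrightarrow> norm (g \<tau>) \<le> G \<tau>"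
  shows "set_integrable lborel {0..t} g"
    and "norm (LINT \<tau>:{0..t}|lborel. g \<tau>) \<le> (LINT \<tau>:{0..t}|lborel. G \<tau>)"
proof -
  have le': "norm (indicator {0..t} \<tau> *\<^sub>R g \<tau>) \<le> indicator {0..t} \<tau> *\<^sub>R G \<tau>" for \<tau>
    using le[of \<tau>] by (auto simp: indicator_def)
  show i: "set_integrable lborel {0..t} g"
    unfolding set_integrable_def
    by (rule Bochner_Integration.integrable_bound[OF G[unfolded set_integrable_def]])
       (use le' in \<open>auto intro!: AE_I2 intro: order_trans[OF _ abs_ge_self]\<close>)
  have "norm (LINT \<tau>:{0..t}|lborel. g \<tau>) \<le> (LINT \<tau>|lborel. norm (indicator {0..t} \<tau> *\<^sub>R g \<tau>))"
    unfolding set_lebesgue_integral_def by (rule integral_norm_bound)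
  also have "\<dots> \<le> (LINT \<tau>:{0..t}|lborel. G \<tau>)"
    unfolding set_lebesgue_integral_def
    by (rule integral_mono[OF integrable_norm[OF i[unfolded set_integrable_def]]
          G[unfolded set_integrable_def] le'])
  finally show "norm (LINT \<tau>:{0..t}|lborel. g \<tau>) \<le> (LINT \<tau>:{0..t}|lborel. G \<tau>)" .
qed

lemma
  fixes t :: real
  assumes "0 \<le> t"
  shows power_time_integrable: "set_integrable lborel {0..t} (\<lambda>\<tau>. \<tau> ^ k * c)"
    and power_time_integral: "(LINT \<tau>:{0..t}|lborel. \<tau> ^ k * c) = t ^ Suc k / real (Suc k) * c"
proof -
  show "set_integrable lborel {0..t} (\<lambda>\<tau>. \<tau> ^ k * c)"
    by (intro borel_integrable_atLeastAtMost' continuous_intros)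
  have "(LINT \<tau>|lborel. \<tau> ^ k * indicator {0..t} \<tau>) = t ^ Suc k / real (Suc k)"
    using integral_power[OF assms, of k] by simp
  moreover have "(LINT \<tau>:{0..t}|lborel. \<tau> ^ k * c) = (LINT \<tau>|lborel. \<tau> ^ k * indicator {0..t} \<tau>) * c"
    unfolding set_lebesgue_integral_def by (simp add: mult_ac flip: integral_mult_left_zero)
  ultimately show "(LINT \<tau>:{0..t}|lborel. \<tau> ^ k * c) = t ^ Suc k / real (Suc k) * c"
    by simp
qed

lemma time_integral_point: "(LINT \<tau>:{0::real}|lborel. h \<tau>) = (0 :: complex)"
proof -
  have "AE \<tau> in lborel. indicator {0} \<tau> *\<^sub>R h \<tau> = 0"
    using AE_lborel_singleton[of "0::real"] by eventually_elim simp
  then show ?thesis unfolding set_lebesgue_integral_def by (rule integral_eq_zero_AE)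
qed

text \<open>The constant \<open>A\<close> bounds the supremum as well as the integral of \<open>f\<close>, because the recursion for
  the iterates couples these two quantities.\<close>

locale fourier_data =
  fixes p :: "plane \<Rightarrow> real" and f :: "plane \<Rightarrow> complex" and R A :: real
  assumes p_measurable [measurable]: "p \<in> borel_measurable borel"
    and f_measurable [measurable]: "f \<in> borel_measurable borel"
    and R: "0 < R" and A: "0 < A"
    and f_bound: "norm (f z) \<le> A" and f_integrable: "integrable lborel f"
    and f_integral: "(LINT z|lborel. norm (f z)) \<le> A"
    and f_support: "f z \<noteq> 0 \<Longrightarrow> \<bar>fst z\<bar> \<le> R \<and> \<bar>snd z\<bar> \<le> R"
begin

abbreviation "U \<equiv> iterate p f"
abbreviation "B \<equiv> majorant R f"

text \<open>The factor \<open>8 R A / \<pi>\<close> in each step is what the recursion for the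
  majorants produces with the weights \<open>1 / n\<^sup>2\<close>.\<close>

definition coeff :: "nat \<Rightarrow> real" where
  "coeff n = A * (8 * R / pi * A) ^ (n - 1) / (real n)\<^sup>2"

lemma coeff_nonneg: "0 \<le> coeff n"
  using A R by (simp add: coeff_def)

lemma coeff_conv:
  "R / pi * (\<Sum>j\<in>{1..<n}. coeff j * coeff (n - j)) \<le> coeff n"
proof (cases "n \<ge> 2")
  case True
  define \<Lambda> where "\<Lambda> = 8 * R / pi * A"
  have \<Lambda>: "\<Lambda> \<ge> 0" using R A by (simp add: \<Lambda>_def)
  have "coeff j * coeff (n - j) = A\<^sup>2 * \<Lambda> ^ (n - 2) * (1 / (real j)\<^sup>2 * (1 / (real (n - j))\<^sup>2))"
    if "j \<in> {1..<n}" for j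
  proof -
    have "n - 2 = (j - 1) + (n - j - 1)" using that by auto
    then have "\<Lambda> ^ (n - 2) = \<Lambda> ^ (j - 1) * \<Lambda> ^ (n - j - 1)" by (metis power_add)
    then show ?thesis unfolding coeff_def \<Lambda>_def[symmetric] by (simp add: power2_eq_square)
  qed
  then have "(\<Sum>j\<in>{1..<n}. coeff j * coeff (n - j)) =
      A\<^sup>2 * \<Lambda> ^ (n - 2) * (\<Sum>j\<in>{1..<n}. 1 / (real j)\<^sup>2 * (1 / (real (n - j))\<^sup>2))"
    unfolding sum_distrib_left by (intro sum.cong refl) 
  also have "\<dots> \<le> A\<^sup>2 * \<Lambda> ^ (n - 2) * (8 / (real n)\<^sup>2)"
    using \<Lambda> by (intro mult_left_mono sum_inverse_squares_product_le) auto
  finally have "R / pi * (\<Sum>j\<in>{1..<n}. coeff j * coeff (n - j)) \<le>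
      R / pi * (A\<^sup>2 * \<Lambda> ^ (n - 2) * (8 / (real n)\<^sup>2))"
    using R by (intro mult_left_mono) auto
  also have "\<dots> = A * (\<Lambda> * \<Lambda> ^ (n - 2)) / (real n)\<^sup>2"
    by (simp add: \<Lambda>_def power2_eq_square)
  also have "\<Lambda> * \<Lambda> ^ (n - 2) = \<Lambda> ^ (n - 1)"
    using True by (metis Suc_diff_le diff_Suc_Suc numeral_2_eq_2 power_Suc One_nat_def)
  finally show ?thesis by (simp add: coeff_def \<Lambda>_def)
qed (use coeff_nonneg in \<open>simp add: not_le\<close>)

lemma majorant_0: "B 0 = (\<lambda>z. 0)" and majorant_1: "B 1 = (\<lambda>z. norm (f z))"
  and majorant_Suc: "n \<ge> 2 \<Longrightarrow> B n z = R / pi * (\<Sum>j\<in>{1..<n}. conv (B j) (B (n - j)) z)"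
  by (subst majorant.simps; simp)+

text \<open>The supremum and the integral satisfy the same recursion: the supremum of a
  convolution is at most the integral of one factor times the supremum of the other, and the
  integral of a convolution is the product of the integrals. Supports add.\<close>

lemma majorant_props:
  "B n \<in> borel_measurable borel \<and> (\<forall>z. 0 \<le> B n z) \<and> (\<forall>z. B n z \<le> coeff n) \<and>
   (\<forall>z. B n z \<noteq> 0 \<longrightarrow> \<bar>fst z\<bar> \<le> real n * R \<and> \<bar>snd z\<bar> \<le> real n * R) \<and>
   integrable lborel (B n) \<and> (LINT z|lborel. B n z) \<le> coeff n"
proof (induction n rule: less_induct)
  case (less n)
  consider "n = 0" | "n = 1" | "n \<ge> 2" by linarith
  then show ?case
  proof cases
    case 1
    then show ?thesis using coeff_nonneg by (simp add: majorant_0)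
  next
    case 2
    have c1: "coeff 1 = A" by (simp add: coeff_def)
    show ?thesis
      unfolding 2 majorant_1 c1
      using f_bound f_integrable f_integral f_support by auto
  next
    case 3
    define I where "I = {1..<n}"
    have fin: "finite I" by (simp add: I_def)
    have m [measurable]: "B j \<in> borel_measurable borel" "B (n - j) \<in> borel_measurable borel"
      and nn: "0 \<le> B j z" "0 \<le> B (n - j) z"
      and le: "B j z \<le> coeff j" "B (n - j) z \<le> coeff (n - j)"
      and s1: "B j z \<noteq> 0 \<Longrightarrow> \<bar>fst z\<bar> \<le> real j * R \<and> \<bar>snd z\<bar> \<le> real j * R"
      and s2: "B (n - j) z \<noteq> 0 \<Longrightarrow> \<bar>fst z\<bar> \<le> real (n - j) * R \<and> \<bar>snd z\<bar> \<le> real (n - j) * R"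
      and i: "integrable lborel (B j)" "integrable lborel (B (n - j))"
      and il: "(LINT z|lborel. B j z) \<le> coeff j" "(LINT z|lborel. B (n - j) z) \<le> coeff (n - j)"
      if "j \<in> I" for j z
    proof -
      have "j < n" "n - j < n" using that by (auto simp: I_def)
      note IH = less.IH[OF this(1)] less.IH[OF this(2)]
      show "B j \<in> borel_measurable borel" "B (n - j) \<in> borel_measurable borel"
        "0 \<le> B j z" "0 \<le> B (n - j) z" "B j z \<le> coeff j" "B (n - j) z \<le> coeff (n - j)"
        "B j z \<noteq> 0 \<Longrightarrow> \<bar>fst z\<bar> \<le> real j * R \<and> \<bar>snd z\<bar> \<le> real j * R"
        "B (n - j) z \<noteq> 0 \<Longrightarrow> \<bar>fst z\<bar> \<le> real (n - j) * R \<and> \<bar>snd z\<bar> \<le> real (n - j) * R"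
        "integrable lborel (B j)" "integrable lborel (B (n - j))"
        "(LINT z|lborel. B j z) \<le> coeff j" "(LINT z|lborel. B (n - j) z) \<le> coeff (n - j)"
        using IH by (simp_all del: split_paired_All of_nat_diff)
    qed
    have Bn: "B n = (\<lambda>z. R / pi * (\<Sum>j\<in>I. conv (B j) (B (n - j)) z))"
      using 3 by (simp add: majorant_Suc I_def fun_eq_iff)
    have cnn: "0 \<le> conv (B j) (B (n - j)) z" if "j \<in> I" for j z
      unfolding conv_def using nn[OF that] by (intro integral_nonneg_AE) auto
    have ci: "integrable lborel (conv (B j) (B (n - j)))" if "j \<in> I" for j
      by (rule conv_integrable[OF i[OF that]])
    have cle: "conv (B j) (B (n - j)) z \<le> coeff j * coeff (n - j)" if j: "j \<in> I" for j z
    proof -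
      have "conv (B j) (B (n - j)) z \<le> norm (conv (B j) (B (n - j)) z)" by simp
      also have "\<dots> \<le> (LINT w|lborel. norm (B j w)) * coeff (n - j)"
        using nn[OF j] le[OF j] by (intro norm_conv_le[OF i(1)[OF j] m(2)[OF j]]) simp
      also have "\<dots> \<le> coeff j * coeff (n - j)"
        using il(1)[OF j] nn[OF j] coeff_nonneg by (intro mult_right_mono) auto
      finally show ?thesis .
    qed
    have mB: "B n \<in> borel_measurable borel"
      unfolding Bn using m by (intro borel_measurable_times borel_measurable_const borel_measurable_sum conv_measurable')
    have nnB: "0 \<le> B n z" for z
      unfolding Bn using R cnn by (intro mult_nonneg_nonneg sum_nonneg) auto
    have leB: "B n z \<le> coeff n" for z
    proof -
      have "B n z \<le> R / pi * (\<Sum>j\<in>I. coeff j * coeff (n - j))"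
        unfolding Bn using R by (intro mult_left_mono sum_mono cle) auto
      also have "\<dots> \<le> coeff n" using coeff_conv[of n] by (simp add: I_def)
      finally show ?thesis .
    qed
    have sB: "\<bar>fst z\<bar> \<le> real n * R \<and> \<bar>snd z\<bar> \<le> real n * R" if "B n z \<noteq> 0" for z
    proof -
      have "\<exists>j\<in>I. conv (B j) (B (n - j)) z \<noteq> 0"
        using that unfolding Bn by (auto intro: ccontr)
      then obtain j where j: "j \<in> I" "conv (B j) (B (n - j)) z \<noteq> 0" by blast
      then have "\<exists>w. B j w * B (n - j) (z - w) \<noteq> 0"
        unfolding conv_def by (metis (no_types, lifting) Bochner_Integration.integral_cong Bochner_Integration.integral_zero)
      then obtain w where w: "B j w \<noteq> 0" "B (n - j) (z - w) \<noteq> 0" by auto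
      have "real n * R = real j * R + real (n - j) * R"
        using j(1) by (simp add: I_def of_nat_diff algebra_simps)
      then show ?thesis using s1[OF j(1) w(1)] s2[OF j(1) w(2)] by auto
    qed
    have iB: "integrable lborel (B n)"
      unfolding Bn using ci by auto
    have "(LINT z|lborel. B n z) = R / pi * (\<Sum>j\<in>I. (LINT z|lborel. B j z) * (LINT z|lborel. B (n - j) z))"
    proof -
      have "(LINT z|lborel. B n z) = R / pi * (\<Sum>j\<in>I. LINT z|lborel. conv (B j) (B (n - j)) z)"
        unfolding Bn integral_mult_right_zero by (subst Bochner_Integration.integral_sum) (use ci in auto)
      then show ?thesis using integral_conv[OF i] by simp
    qed
    also have "\<dots> \<le> R / pi * (\<Sum>j\<in>I. coeff j * coeff (n - j))"
      using R il nn coeff_nonneg by (intro mult_left_mono sum_mono mult_mono) auto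
    also have "\<dots> \<le> coeff n" using coeff_conv[of n] by (simp add: I_def)
    finally have "(LINT z|lborel. B n z) \<le> coeff n" .
    with mB nnB leB sB iB show ?thesis by blast
  qed
qed

lemma majorant_measurable [measurable]: "B n \<in> borel_measurable borel"
  and majorant_nonneg: "0 \<le> B n z"
  and majorant_le: "B n z \<le> coeff n"
  and majorant_support: "B n z \<noteq> 0 \<Longrightarrow> \<bar>fst z\<bar> \<le> real n * R \<and> \<bar>snd z\<bar> \<le> real n * R"
  and majorant_integrable: "integrable lborel (B n)"
  and majorant_integral: "(LINT z|lborel. B n z) \<le> coeff n"
  using majorant_props[of n] by blast+

lemma iterate_0: "U 0 = (\<lambda>t z. 0)" and iterate_1: "U 1 = (\<lambda>t z. cis (t * p z) * f z)"
  and iterate_Suc: "n \<ge> 2 \<Longrightarrow> U n t z = - (\<i> * of_real (fst z) / of_real (2 * pi)) *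
       (LINT \<tau>:{0..t}|lborel. cis ((t - \<tau>) * p z) *
         (\<Sum>j\<in>{1..<n}. conv (U j \<tau>) (U (n - j) \<tau>) z))"
  by (subst iterate.simps; simp)+

lemma iterate_measurable_pair: "(\<lambda>x. U n (fst x) (snd x)) \<in> borel_measurable (borel \<Otimes>\<^sub>M borel)"
proof (induction n rule: less_induct)
  case (less n)
  consider "n = 0" | "n = 1" | "n \<ge> 2" by linarith
  then show ?case
  proof cases
    case 2
    show ?thesis unfolding 2 iterate_1 by measurable
  next
    case 3
    have c: "(\<lambda>x. conv (U j (fst x)) (U (n - j) (fst x)) (snd x)) \<in> borel_measurable (borel \<Otimes>\<^sub>M borel)"
      if "j \<in> {1..<n}" for j
      using less.IH[of j] less.IH[of "n - j"] that by (intro conv_measurable) auto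
    have "(\<lambda>x. conv (U j (snd x)) (U (n - j) (snd x)) (snd (fst x)))
        \<in> borel_measurable ((borel \<Otimes>\<^sub>M borel) \<Otimes>\<^sub>M lborel)"
      if "j \<in> {1..<n}" for j
      using measurable_compose[OF _ c[OF that], of "\<lambda>x. (snd x, snd (fst x))" "(borel \<Otimes>\<^sub>M borel) \<Otimes>\<^sub>M lborel"]
      by simp
    then have "(\<lambda>x. \<Sum>j\<in>{1..<n}. conv (U j (snd x)) (U (n - j) (snd x)) (snd (fst x)))
        \<in> borel_measurable ((borel \<Otimes>\<^sub>M borel) \<Otimes>\<^sub>M lborel)"
      by (rule borel_measurable_sum)
    then have "(\<lambda>x. cis ((fst (fst x) - snd x) * p (snd (fst x))) *
        (\<Sum>j\<in>{1..<n}. conv (U j (snd x)) (U (n - j) (snd x)) (snd (fst x))))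
        \<in> borel_measurable ((borel \<Otimes>\<^sub>M borel) \<Otimes>\<^sub>M lborel)"
      by measurable
    note [measurable] = time_integral_measurable[OF this]
    show ?thesis unfolding iterate_Suc[OF 3] by measurable
  qed (simp add: iterate_0)
qed

lemma iterate_measurable [measurable]: "U n t \<in> borel_measurable borel"
  using measurable_compose[OF _ iterate_measurable_pair, of "\<lambda>z. (t, z)" borel n] by simp

lemma conv_iterate_measurable:
  "(\<lambda>x. conv (U j (fst x)) (U k (fst x)) (snd x)) \<in> borel_measurable (borel \<Otimes>\<^sub>M borel)"
  by (intro conv_measurable iterate_measurable_pair)

lemma conv_iterate_measurable_time [measurable]:
  "(\<lambda>\<tau>. conv (U j \<tau>) (U k \<tau>) z) \<in> borel_measurable borel"
  using measurable_compose[OF _ conv_iterate_measurable, of "\<lambda>\<tau>. (\<tau>, z)" borel j k] by simp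

text \<open>A product of two lower iterates grows like \<open>\<tau>\<^bsup>n - 2\<^esup>\<close>,
  so its time integral is \<open>t\<^bsup>n - 1\<^esup> / (n - 1)\<close>. The denominator absorbs
  the factor \<open>n\<close> that the derivative costs on the support of the majorant.\<close>

lemma iterate_bound:
  assumes "0 \<le> t"
  shows "norm (U n t z) \<le> t ^ (n - 1) * B n z"
  using assms
proof (induction n arbitrary: t z rule: less_induct)
  case (less n)
  consider "n = 0" | "n = 1" | "n \<ge> 2" by linarith
  then show ?case
  proof cases
    case 2
    show ?thesis unfolding 2 iterate_1 majorant_1 by (simp add: norm_mult)
  next
    case 3
    define Q where "Q = (\<Sum>j\<in>{1..<n}. conv (B j) (B (n - j)) z)"
    have Qn: "B n z = R / pi * Q" using majorant_Suc[OF 3] by (simp add: Q_def)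
    have le: "norm (cis ((t - \<tau>) * p z) * (\<Sum>j\<in>{1..<n}. conv (U j \<tau>) (U (n - j) \<tau>) z)) \<le> \<tau> ^ (n - 2) * Q"
      if \<tau>: "0 \<le> \<tau>" for \<tau>
    proof -
      have "norm (conv (U j \<tau>) (U (n - j) \<tau>) z) \<le> \<tau> ^ (n - 2) * conv (B j) (B (n - j)) z"
        if j: "j \<in> {1..<n}" for j
      proof -
        have "norm (conv (U j \<tau>) (U (n - j) \<tau>) z) \<le>
            conv (\<lambda>w. \<tau> ^ (j - 1) * B j w) (\<lambda>w. \<tau> ^ (n - j - 1) * B (n - j) w) z"
        proof (rule norm_conv_mono)
          show "norm (U j \<tau> w) \<le> \<tau> ^ (j - 1) * B j w" for w using less.IH[of j \<tau>] j \<tau> by simp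
          show "norm (U (n - j) \<tau> w) \<le> \<tau> ^ (n - j - 1) * B (n - j) w" for w
            using less.IH[of "n - j" \<tau>] j \<tau> by simp
          show "\<tau> ^ (n - j - 1) * B (n - j) w \<le> \<tau> ^ (n - j - 1) * coeff (n - j)" for w
            using \<tau> majorant_le by (intro mult_left_mono) auto
        qed (use majorant_integrable in auto)
        also have "\<dots> = \<tau> ^ ((j - 1) + (n - j - 1)) * conv (B j) (B (n - j)) z"
          unfolding conv_scale power_add ..
        also have "(j - 1) + (n - j - 1) = n - 2" using j by auto
        finally show ?thesis .
      qed
      then have "(\<Sum>j\<in>{1..<n}. norm (conv (U j \<tau>) (U (n - j) \<tau>) z)) \<le> \<tau> ^ (n - 2) * Q"
        unfolding Q_def sum_distrib_left by (rule sum_mono)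
      then show ?thesis
        using norm_sum[of "\<lambda>j. conv (U j \<tau>) (U (n - j) \<tau>) z" "{1..<n}"] by (simp add: norm_mult)
    qed
    have "norm (LINT \<tau>:{0..t}|lborel. cis ((t - \<tau>) * p z) *
         (\<Sum>j\<in>{1..<n}. conv (U j \<tau>) (U (n - j) \<tau>) z)) \<le> (LINT \<tau>:{0..t}|lborel. \<tau> ^ (n - 2) * Q)"
      using le power_time_integrable[OF less.prems] by (intro norm_time_integral_le) auto
    also have "\<dots> = t ^ (n - 1) / real (n - 1) * Q"
    proof -
      obtain k where "n = Suc (Suc k)" using 3 by (metis add_2_eq_Suc le_Suc_ex)
      then show ?thesis using power_time_integral[OF less.prems, of k Q] by simp
    qed
    finally have I: "norm (LINT \<tau>:{0..t}|lborel. cis ((t - \<tau>) * p z) *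
         (\<Sum>j\<in>{1..<n}. conv (U j \<tau>) (U (n - j) \<tau>) z)) \<le> t ^ (n - 1) / real (n - 1) * Q" .
    have Q0: "0 \<le> Q"
    proof -
      have "0 < R / pi" using R by simp
      then show ?thesis using majorant_nonneg[of n z] unfolding Qn by (simp only: zero_le_mult_iff) linarith
    qed
    have fQ: "\<bar>fst z\<bar> * Q \<le> real n * R * Q"
      using majorant_support[of n z] Q0 R by (cases "Q = 0") (auto simp: Qn intro: mult_right_mono)
    have "norm (U n t z) \<le> \<bar>fst z\<bar> / (2 * pi) * (t ^ (n - 1) / real (n - 1) * Q)"
      unfolding iterate_Suc[OF 3] norm_mult norm_minus_cancel
      using I by (intro mult_mono) (auto simp: norm_divide norm_mult)
    also have "\<dots> = \<bar>fst z\<bar> * Q * (t ^ (n - 1) / (2 * pi * real (n - 1)))" by simp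
    also have "\<dots> \<le> real n * R * Q * (t ^ (n - 1) / (2 * pi * real (n - 1)))"
      by (rule mult_right_mono[OF fQ]) (use less.prems in simp)
    also have "\<dots> = real n / (2 * real (n - 1)) * (t ^ (n - 1) * B n z)" by (simp add: Qn mult_ac)
    also have "\<dots> \<le> 1 * (t ^ (n - 1) * B n z)"
      using 3 less.prems majorant_nonneg by (intro mult_right_mono) (auto simp: of_nat_diff field_simps)
    finally show ?thesis by simp
  qed (simp add: iterate_0 majorant_0)
qed

end


section \<open>Convergence of the series\<close>

text \<open>The polynomial is dominated by an exponential of arbitrarily small rate, here chosen
  such that the quotient \<open>1 / 2\<close> becomes \<open>3 / 4\<close>.\<close>

lemma polynomial_times_geometric_summable:
  fixes K :: real
  assumes "0 \<le> K"
  shows "summable (\<lambda>n. (1 + real n * K) ^ m * (1 / 2) ^ n)"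
proof -
  define s where "s = ln (3 / 2) / (K + 1)"
  have s: "0 < s" using assms by (simp add: s_def)
  have sK: "s * K \<le> ln (3 / 2)"
    using assms by (simp add: s_def field_simps)
  have le: "(1 + real n * K) ^ m * (1 / 2) ^ n \<le> fact m / s ^ m * exp s * (3 / 4) ^ n" for n
  proof -
    define y where "y = s * (1 + real n * K)"
    have y: "0 \<le> y" using s assms by (simp add: y_def)
    have "y ^ m \<le> fact m * exp y" by (rule power_le_fact_exp[OF y])
    then have "s ^ m * (1 + real n * K) ^ m \<le> fact m * exp y"
      by (simp add: y_def power_mult_distrib)
    then have 1: "(1 + real n * K) ^ m \<le> fact m / s ^ m * exp y" using s by (simp add: field_simps)
    have "exp y = exp s * exp (s * K) ^ n"
      by (simp add: y_def algebra_simps exp_add flip: exp_of_nat_mult)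
    also have "\<dots> \<le> exp s * (3 / 2) ^ n"
    proof -
      have "exp (s * K) \<le> 3 / 2" using sK exp_le_cancel_iff[of "s * K" "ln (3 / 2)"] by simp
      then show ?thesis by (intro mult_left_mono power_mono) auto
    qed
    finally have "fact m / s ^ m * exp y \<le> fact m / s ^ m * (exp s * (3 / 2) ^ n)"
      using s by (intro mult_left_mono) auto
    with 1 have "(1 + real n * K) ^ m * (1 / 2) ^ n \<le> fact m / s ^ m * (exp s * (3 / 2) ^ n) * (1 / 2) ^ n"
      by (intro mult_right_mono) auto
    also have "\<dots> = fact m / s ^ m * exp s * ((3 / 2) * (1 / 2)) ^ n"
      by (simp only: power_mult_distrib mult.assoc)
    finally show ?thesis by simp
  qed
  show ?thesis
  proof (rule summable_comparison_test'[of _ 0])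
    show "summable (\<lambda>n. fact m / s ^ m * exp s * (3 / 4 :: real) ^ n)"
      by (intro summable_mult summable_geometric) simp
    show "norm ((1 + real n * K) ^ m * (1 / 2) ^ n) \<le> fact m / s ^ m * exp s * (3 / 4) ^ n" for n
      using le[of n] assms by simp
  qed
qed

text \<open>The bound on \<open>\<delta>\<close> makes the terms of the series decay like
  \<open>2\<^sup>-\<^sup>n\<close> throughout \<open>[0, T]\<close>.\<close>

locale small_fourier_data = fourier_data +
  fixes \<delta> T :: real
  assumes T: "0 < T" and small: "\<bar>\<delta>\<bar> * T * (8 * R / pi * A) \<le> 1 / 2"
begin

definition bnd :: "nat \<Rightarrow> plane \<Rightarrow> real" where
  "bnd n z = \<bar>\<delta>\<bar> ^ n * (T ^ (n - 1) * B n z)"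

definition C0 :: real where "C0 = 2 * \<bar>\<delta>\<bar> * A"

definition total :: "plane \<Rightarrow> real" where
  "total z = (\<Sum>n. bnd n z)"

definition sol :: "real \<Rightarrow> plane \<Rightarrow> complex" where
  "sol t z = (\<Sum>n. of_real \<delta> ^ n * U n t z)"

lemma bnd_nonneg: "0 \<le> bnd n z"
  using T majorant_nonneg by (simp add: bnd_def)

lemma bnd_measurable [measurable]: "bnd n \<in> borel_measurable borel"
  unfolding bnd_def[abs_def] by measurable

lemma C0_nonneg: "0 \<le> C0"
  using A by (simp add: C0_def)

lemma coeff_small: "\<bar>\<delta>\<bar> ^ n * (T ^ (n - 1) * coeff n) \<le> C0 * (1 / 2) ^ n"
proof (cases n)
  case (Suc m)
  have "\<bar>\<delta>\<bar> ^ n * (T ^ (n - 1) * coeff n) = \<bar>\<delta>\<bar> * A * (\<bar>\<delta>\<bar> * T * (8 * R / pi * A)) ^ m / (real n)\<^sup>2"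
    by (simp add: Suc coeff_def power_mult_distrib power_divide)
  also have "\<dots> \<le> \<bar>\<delta>\<bar> * A * (\<bar>\<delta>\<bar> * T * (8 * R / pi * A)) ^ m / 1"
    using A R T by (intro divide_left_mono) (auto simp: Suc power2_eq_square mult_nonneg_nonneg
        intro!: one_le_power mult_ge1_I)
  also have "\<dots> \<le> \<bar>\<delta>\<bar> * A * (1 / 2) ^ m / 1"
    using A R T small by (intro divide_right_mono mult_left_mono power_mono) auto
  finally show ?thesis by (simp add: C0_def Suc)
qed (simp add: coeff_def C0_nonneg)

lemma bnd_le: "bnd n z \<le> C0 * (1 / 2) ^ n"
proof -
  have "bnd n z \<le> \<bar>\<delta>\<bar> ^ n * (T ^ (n - 1) * coeff n)"
    unfolding bnd_def using T majorant_le by (intro mult_left_mono) auto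
  then show ?thesis using coeff_small[of n] by simp
qed

lemma bnd_integrable: "integrable lborel (bnd n)"
  unfolding bnd_def[abs_def] using majorant_integrable by simp

lemma bnd_integral: "(LINT z|lborel. bnd n z) \<le> C0 * (1 / 2) ^ n"
proof -
  have "(LINT z|lborel. bnd n z) = \<bar>\<delta>\<bar> ^ n * (T ^ (n - 1) * (LINT z|lborel. B n z))"
    by (simp add: bnd_def)
  also have "\<dots> \<le> \<bar>\<delta>\<bar> ^ n * (T ^ (n - 1) * coeff n)"
    using T majorant_integral by (intro mult_left_mono) auto
  finally show ?thesis using coeff_small[of n] by simp
qed

text \<open>On the support of the \<open>n\<close>-th term the weight is polynomial in
  \<open>n\<close>.\<close>

lemma weighted_bnd_le: "(1 + norm z) ^ m * bnd n z \<le> (1 + real n * (2 * R)) ^ m * bnd n z"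
proof (cases "bnd n z = 0")
  case False
  then have "B n z \<noteq> 0" by (auto simp: bnd_def)
  from majorant_support[OF this] have "norm z \<le> real n * (2 * R)"
    using norm_Pair_le[of "fst z" "snd z"] by (simp add: algebra_simps)
  then show ?thesis using bnd_nonneg by (intro mult_right_mono power_mono) auto
qed simp

lemma weighted_bnd_le': "(1 + norm z) ^ m * bnd n z \<le> C0 * ((1 + real n * (2 * R)) ^ m * (1 / 2) ^ n)"
proof -
  have "(1 + real n * (2 * R)) ^ m * bnd n z \<le> (1 + real n * (2 * R)) ^ m * (C0 * (1 / 2) ^ n)"
    using R bnd_le by (intro mult_left_mono) auto
  then show ?thesis using weighted_bnd_le[of z m n] by (simp add: mult.left_commute)
qed

lemma weights_summable: "summable (\<lambda>n. C0 * ((1 + real n * (2 * R)) ^ m * (1 / 2) ^ n))"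
  using R by (intro summable_mult polynomial_times_geometric_summable) simp

lemma weighted_bnd_summable: "summable (\<lambda>n. (1 + norm z) ^ m * bnd n z)"
  by (rule summable_comparison_test'[OF weights_summable[of m], of 0])
     (use weighted_bnd_le' bnd_nonneg in auto)

lemma bnd_summable: "summable (\<lambda>n. bnd n z)"
  using weighted_bnd_summable[of z 0] by simp

lemma weighted_total: "(1 + norm z) ^ m * total z = (\<Sum>n. (1 + norm z) ^ m * bnd n z)"
  unfolding total_def using bnd_summable by (rule suminf_mult[symmetric])

text \<open>Geometric decay of the terms beats the polynomial growth of their supports.\<close>

lemma rapid_total: "rapid total"
  unfolding rapid_def
proof (intro conjI allI)
  show "total \<in> borel_measurable borel" unfolding total_def[abs_def] by measurable
  show "0 \<le> total z" for z unfolding total_def using bnd_summable bnd_nonneg by (rule suminf_nonneg)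
  fix m
  show "\<exists>K. \<forall>z. (1 + norm z) ^ m * total z \<le> K"
    unfolding weighted_total
    by (intro exI[of _ "\<Sum>n. C0 * ((1 + real n * (2 * R)) ^ m * (1 / 2) ^ n)"] allI
        suminf_le[OF weighted_bnd_le' weighted_bnd_summable weights_summable])
  show "integrable lborel (\<lambda>z. (1 + norm z) ^ m * total z)"
    unfolding weighted_total
  proof (rule integrable_suminf)
    have le: "norm ((1 + norm z) ^ m * bnd n z) \<le> (1 + real n * (2 * R)) ^ m * bnd n z" for n z
      using weighted_bnd_le[of z m n] bnd_nonneg[of n z] by simp
    show i: "integrable lborel (\<lambda>z. (1 + norm z) ^ m * bnd n z)" for n
    proof (rule Bochner_Integration.integrable_bound)
      show "integrable lborel (\<lambda>z. (1 + real n * (2 * R)) ^ m * bnd n z)"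
        using bnd_integrable by simp
    qed (use le in \<open>auto intro!: AE_I2 intro: order_trans[OF _ abs_ge_self]\<close>)
    show "AE z in lborel. summable (\<lambda>n. norm ((1 + norm z) ^ m * bnd n z))"
      using weighted_bnd_summable bnd_nonneg by (intro AE_I2) simp
    show "summable (\<lambda>n. LINT z|lborel. norm ((1 + norm z) ^ m * bnd n z))"
    proof (rule summable_comparison_test'[OF weights_summable[of m], of 0])
      fix n
      have "(LINT z|lborel. norm ((1 + norm z) ^ m * bnd n z)) \<le>
          (LINT z|lborel. (1 + real n * (2 * R)) ^ m * bnd n z)"
        using le bnd_integrable by (intro integral_mono integrable_norm i) auto
      also have "\<dots> \<le> (1 + real n * (2 * R)) ^ m * (C0 * (1 / 2) ^ n)"
        using bnd_integral[of n] R by (simp add: mult_left_mono)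
      finally show "norm (LINT z|lborel. norm ((1 + norm z) ^ m * bnd n z)) \<le>
          C0 * ((1 + real n * (2 * R)) ^ m * (1 / 2) ^ n)"
        by (simp add: mult.left_commute)
    qed
  qed
qed

lemma term_bound:
  assumes "0 \<le> t" "t \<le> T"
  shows "norm (of_real \<delta> ^ n * U n t z) \<le> bnd n z"
proof -
  have "norm (U n t z) \<le> t ^ (n - 1) * B n z" by (rule iterate_bound[OF assms(1)])
  also have "\<dots> \<le> T ^ (n - 1) * B n z"
    using assms majorant_nonneg by (intro mult_right_mono power_mono) auto
  finally show ?thesis by (simp add: norm_mult norm_power bnd_def mult_left_mono)
qed

lemma term_summable:
  assumes "0 \<le> t" "t \<le> T"
  shows "summable (\<lambda>n. norm (of_real \<delta> ^ n * U n t z))"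
  by (rule summable_comparison_test'[OF bnd_summable[of z], of 0])
     (simp only: real_norm_def abs_norm_cancel, rule term_bound[OF assms])

lemma sol_bound:
  assumes "0 \<le> t" "t \<le> T"
  shows "norm (sol t z) \<le> total z"
proof -
  have "norm (sol t z) \<le> (\<Sum>n. norm (of_real \<delta> ^ n * U n t z))"
    unfolding sol_def by (rule summable_norm[OF term_summable[OF assms]])
  also have "\<dots> \<le> total z"
    unfolding total_def by (rule suminf_le[OF term_bound[OF assms] term_summable[OF assms] bnd_summable])
  finally show ?thesis .
qed

lemma sol_measurable_pair: "(\<lambda>x. sol (fst x) (snd x)) \<in> borel_measurable (borel \<Otimes>\<^sub>M borel)"
  unfolding sol_def using iterate_measurable_pair
  by (intro borel_measurable_suminf borel_measurable_times borel_measurable_const)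

lemma sol_measurable [measurable]: "sol t \<in> borel_measurable borel"
  using measurable_compose[OF _ sol_measurable_pair, of "\<lambda>z. (t, z)" borel] by simp

definition csum :: "nat \<Rightarrow> real \<Rightarrow> plane \<Rightarrow> complex" where
  "csum n t z = (\<Sum>j\<le>n. conv (U j t) (U (n - j) t) z)"

lemma csum_eq: "csum n t z = (\<Sum>j\<in>{1..<n}. conv (U j t) (U (n - j) t) z)"
  unfolding csum_def
proof (rule sum.mono_neutral_right)
  show "\<forall>j\<in>{..n} - {1..<n}. conv (U j t) (U (n - j) t) z = 0"
  proof
    fix j assume "j \<in> {..n} - {1..<n}"
    then have "j = 0 \<or> n - j = 0" by auto
    then show "conv (U j t) (U (n - j) t) z = 0" by (auto simp: conv_def iterate_0)
  qed
qed auto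

definition cbnd :: "nat \<Rightarrow> real" where
  "cbnd n = C0\<^sup>2 * ((1 + real n * 1) ^ 1 * (1 / 2) ^ n)"

lemma cbnd_summable: "summable cbnd"
  unfolding cbnd_def by (intro summable_mult polynomial_times_geometric_summable) simp

lemma scaled_csum:
  "of_real \<delta> ^ n * csum n t z = (\<Sum>j\<le>n. conv (\<lambda>w. of_real \<delta> ^ j * U j t w) (\<lambda>w. of_real \<delta> ^ (n - j) * U (n - j) t w) z)"
  unfolding csum_def sum_distrib_left conv_scale
  by (intro sum.cong refl) (simp add: power_add[symmetric])

context
  fixes t :: real
  assumes t: "0 \<le> t" "t \<le> T"
begin

lemma product_integrable:
  "integrable lborel (\<lambda>w. of_real \<delta> ^ j * U j t w * (of_real \<delta> ^ k * U k t (z - w)))"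
proof (rule conv_integrand_integrable)
  show "integrable lborel (\<lambda>w. of_real \<delta> ^ j * U j t w)"
    by (rule Bochner_Integration.integrable_bound[OF bnd_integrable[of j]])
       (use term_bound[OF t] in \<open>auto intro!: AE_I2 intro: order_trans[OF _ abs_ge_self]\<close>)
  show "norm (of_real \<delta> ^ k * U k t w) \<le> C0 * (1 / 2) ^ k" for w
    using term_bound[OF t] bnd_le order_trans by blast
qed simp

lemma product_integral_le:
  "(LINT w|lborel. norm (of_real \<delta> ^ j * U j t w * (of_real \<delta> ^ k * U k t (z - w)))) \<le>
    C0\<^sup>2 * (1 / 2) ^ (j + k)"
proof -
  have "(LINT w|lborel. norm (of_real \<delta> ^ j * U j t w * (of_real \<delta> ^ k * U k t (z - w)))) \<le>
      (LINT w|lborel. bnd j w * (C0 * (1 / 2) ^ k))"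
  proof (rule integral_mono[OF integrable_norm[OF product_integrable]])
    show "integrable lborel (\<lambda>w. bnd j w * (C0 * (1 / 2) ^ k))" using bnd_integrable by simp
    show "norm (of_real \<delta> ^ j * U j t w * (of_real \<delta> ^ k * U k t (z - w))) \<le> bnd j w * (C0 * (1 / 2) ^ k)" for w
      unfolding norm_mult[of "of_real \<delta> ^ j * U j t w"]
      by (intro mult_mono term_bound[OF t] order_trans[OF term_bound[OF t] bnd_le] bnd_nonneg) simp
  qed
  also have "\<dots> = (LINT w|lborel. bnd j w) * (C0 * (1 / 2) ^ k)" by simp
  also have "\<dots> \<le> C0 * (1 / 2) ^ j * (C0 * (1 / 2) ^ k)"
    using bnd_integral C0_nonneg by (intro mult_right_mono) auto
  also have "\<dots> = C0\<^sup>2 * (1 / 2) ^ (j + k)"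
    by (simp only: power2_eq_square power_add mult_ac)
  finally show ?thesis .
qed

lemma csum_bound: "norm (of_real \<delta> ^ n * csum n t z) \<le> cbnd n"
proof -
  have "norm (of_real \<delta> ^ n * csum n t z) \<le>
      (\<Sum>j\<le>n. norm (conv (\<lambda>w. of_real \<delta> ^ j * U j t w) (\<lambda>w. of_real \<delta> ^ (n - j) * U (n - j) t w) z))"
    unfolding scaled_csum by (rule norm_sum)
  also have "\<dots> \<le> (\<Sum>j\<le>n. C0\<^sup>2 * (1 / 2) ^ n)"
  proof (rule sum_mono)
    fix j assume j: "j \<in> {..n}"
    show "norm (conv (\<lambda>w. of_real \<delta> ^ j * U j t w) (\<lambda>w. of_real \<delta> ^ (n - j) * U (n - j) t w) z) \<le> C0\<^sup>2 * (1 / 2) ^ n"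
      unfolding conv_def using product_integral_le[of j "n - j" z] j
      by (intro order_trans[OF integral_norm_bound]) simp
  qed
  also have "\<dots> = cbnd n" by (simp add: cbnd_def)
  finally show ?thesis .
qed

text \<open>The Cauchy product, integrated.\<close>

lemma conv_sol_sums: "(\<lambda>n. of_real \<delta> ^ n * csum n t z) sums conv (sol t) (sol t) z"
proof -
  define g where "g = (\<lambda>n w. \<Sum>j\<le>n. of_real \<delta> ^ j * U j t w * (of_real \<delta> ^ (n - j) * U (n - j) t (z - w)))"
  have gs: "(\<lambda>n. g n w) sums (sol t w * sol t (z - w))" for w
    unfolding g_def sol_def by (rule Cauchy_product_sums[OF term_summable[OF t] term_summable[OF t]])
  have gi: "integrable lborel (g n)" for n
    unfolding g_def using product_integrable by (intro Bochner_Integration.integrable_sum) 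
  have g_int: "(LINT w|lborel. g n w) = of_real \<delta> ^ n * csum n t z" for n
    unfolding g_def scaled_csum conv_def using product_integrable by (rule Bochner_Integration.integral_sum)
  have "(\<lambda>n. LINT w|lborel. g n w) sums (LINT w|lborel. (\<Sum>n. g n w))"
  proof (rule sums_integral[OF gi])
    show "AE w in lborel. summable (\<lambda>n. norm (g n w))"
    proof (rule AE_I2)
      fix w
      show "summable (\<lambda>n. norm (g n w))"
      proof (rule summable_comparison_test'[OF cbnd_summable, of 0])
        fix n
        have "norm (g n w) \<le> (\<Sum>j\<le>n. norm (of_real \<delta> ^ j * U j t w * (of_real \<delta> ^ (n - j) * U (n - j) t (z - w))))"
          unfolding g_def by (rule norm_sum)
        also have "\<dots> \<le> (\<Sum>j\<le>n. C0\<^sup>2 * (1 / 2) ^ n)"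
        proof (rule sum_mono)
          fix j assume j: "j \<in> {..n}"
          have "norm (of_real \<delta> ^ j * U j t w * (of_real \<delta> ^ (n - j) * U (n - j) t (z - w))) \<le>
              (C0 * (1 / 2) ^ j) * (C0 * (1 / 2) ^ (n - j))"
            unfolding norm_mult[of "of_real \<delta> ^ j * U j t w"] using C0_nonneg
            by (intro mult_mono order_trans[OF term_bound[OF t] bnd_le]) auto
          also have "\<dots> = C0\<^sup>2 * (1 / 2) ^ (j + (n - j))"
            by (simp only: power_add power2_eq_square mult_ac)
          finally show "norm (of_real \<delta> ^ j * U j t w * (of_real \<delta> ^ (n - j) * U (n - j) t (z - w))) \<le> C0\<^sup>2 * (1 / 2) ^ n"
            using j by simp
        qed
        also have "\<dots> = cbnd n" by (simp add: cbnd_def)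
        finally show "norm (norm (g n w)) \<le> cbnd n" by simp
      qed
    qed
    show "summable (\<lambda>n. LINT w|lborel. norm (g n w))"
    proof (rule summable_comparison_test'[OF cbnd_summable, of 0])
      fix n
      have "(LINT w|lborel. norm (g n w)) \<le>
          (LINT w|lborel. (\<Sum>j\<le>n. norm (of_real \<delta> ^ j * U j t w * (of_real \<delta> ^ (n - j) * U (n - j) t (z - w)))))"
        by (rule integral_mono[OF integrable_norm[OF gi]])
           (use product_integrable in \<open>auto simp: g_def intro!: Bochner_Integration.integrable_sum norm_sum\<close>)
      also have "\<dots> = (\<Sum>j\<le>n. LINT w|lborel. norm (of_real \<delta> ^ j * U j t w * (of_real \<delta> ^ (n - j) * U (n - j) t (z - w))))"
        by (rule Bochner_Integration.integral_sum) (rule integrable_norm[OF product_integrable])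
      also have "\<dots> \<le> (\<Sum>j\<le>n. C0\<^sup>2 * (1 / 2) ^ n)"
        by (intro sum_mono order_trans[OF product_integral_le]) auto
      also have "\<dots> = cbnd n" by (simp add: cbnd_def)
      finally show "norm (LINT w|lborel. norm (g n w)) \<le> cbnd n" by simp
    qed
  qed
  moreover have "(\<Sum>n. g n w) = sol t w * sol t (z - w)" for w
    using gs[of w] by (simp add: sums_iff)
  ultimately show ?thesis unfolding g_int conv_def by simp
qed

end

lemma csum_measurable_time [measurable]: "(\<lambda>\<tau>. csum n \<tau> z) \<in> borel_measurable borel"
  unfolding csum_def by measurable

text \<open>The recursion of the iterates in a form that is uniform in the order:
  \<open>csum\<close> vanishes for the orders 0 and 1.\<close>

lemma term_duhamel:
  "of_real \<delta> ^ n * U n t z = (if n = 1 then cis (t * p z) * (of_real \<delta> * f z) else 0) -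
     (\<i> * of_real (fst z) / of_real (2 * pi)) *
       (LINT \<tau>:{0..t}|lborel. cis ((t - \<tau>) * p z) * (of_real \<delta> ^ n * csum n \<tau> z))"
proof -
  consider "n = 0" | "n = 1" | "n \<ge> 2" by linarith
  then show ?thesis
  proof cases
    case 3
    have "(LINT \<tau>:{0..t}|lborel. cis ((t - \<tau>) * p z) * (of_real \<delta> ^ n * csum n \<tau> z)) =
        of_real \<delta> ^ n * (LINT \<tau>:{0..t}|lborel. cis ((t - \<tau>) * p z) * csum n \<tau> z)"
      unfolding set_lebesgue_integral_def integral_mult_right_zero[symmetric]
      by (simp add: mult.left_commute)
    with 3 show ?thesis by (simp add: iterate_Suc csum_eq)
  qed (simp_all add: iterate_0 iterate_1[unfolded One_nat_def] csum_eq)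
qed

text \<open>Summing the recursion over all orders; the sum and the time integral are interchanged
  by dominated convergence.\<close>

lemma sol_duhamel:
  assumes t: "0 \<le> t" "t \<le> T"
  shows "sol t z = cis (t * p z) * (of_real \<delta> * f z) -
     (\<i> * of_real (fst z) / of_real (2 * pi)) *
       (LINT \<tau>:{0..t}|lborel. cis ((t - \<tau>) * p z) * conv (sol \<tau>) (sol \<tau>) z)"
proof -
  define h where "h = (\<lambda>n \<tau>. indicator {0..t} \<tau> *\<^sub>R (cis ((t - \<tau>) * p z) * (of_real \<delta> ^ n * csum n \<tau> z)))"
  have [measurable]: "h n \<in> borel_measurable borel" for n unfolding h_def by measurable
  have hb: "norm (h n \<tau>) \<le> indicator {0..t} \<tau> * cbnd n" for n \<tau>
    using csum_bound[of \<tau> n z] t by (auto simp: h_def indicator_def norm_mult)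
  have ind: "integrable lborel (\<lambda>\<tau>. indicator {0..t} \<tau> * cbnd n)" for n
    using power_time_integrable[OF t(1), of 0 "cbnd n"] by (simp only: set_integrable_def real_scaleR_def power_0 mult_1_left)
  have hi: "integrable lborel (h n)" for n
    by (rule Bochner_Integration.integrable_bound[OF ind[of n]])
       (use hb in \<open>auto intro!: AE_I2 intro: order_trans[OF _ abs_ge_self]\<close>)
  have "(\<lambda>n. LINT \<tau>|lborel. h n \<tau>) sums (LINT \<tau>|lborel. (\<Sum>n. h n \<tau>))"
  proof (rule sums_integral[OF hi])
    show "AE \<tau> in lborel. summable (\<lambda>n. norm (h n \<tau>))"
    proof (rule AE_I2)
      fix \<tau>
      show "summable (\<lambda>n. norm (h n \<tau>))"
        by (rule summable_comparison_test'[OF summable_mult[OF cbnd_summable, of "indicator {0..t} \<tau>"], of 0])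
           (use hb in auto)
    qed
    show "summable (\<lambda>n. LINT \<tau>|lborel. norm (h n \<tau>))"
    proof (rule summable_comparison_test'[OF summable_mult[OF cbnd_summable, of t], of 0])
      fix n
      have "(LINT \<tau>|lborel. norm (h n \<tau>)) \<le> (LINT \<tau>|lborel. indicator {0..t} \<tau> * cbnd n)"
        using hb by (intro integral_mono integrable_norm hi ind)
      also have "\<dots> = t * cbnd n" using t by simp
      finally show "norm (LINT \<tau>|lborel. norm (h n \<tau>)) \<le> t * cbnd n" by simp
    qed
  qed
  moreover have "(\<Sum>n. h n \<tau>) = indicator {0..t} \<tau> *\<^sub>R (cis ((t - \<tau>) * p z) * conv (sol \<tau>) (sol \<tau>) z)" for \<tau>
  proof (cases "\<tau> \<in> {0..t}")
    case True
    then have "0 \<le> \<tau>" "\<tau> \<le> T" using t by auto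
    from sums_mult[OF conv_sol_sums[OF this], of "cis ((t - \<tau>) * p z)" z] show ?thesis
      using True by (simp add: h_def sums_iff)
  qed (simp add: h_def)
  ultimately have I: "(\<lambda>n. LINT \<tau>:{0..t}|lborel. cis ((t - \<tau>) * p z) * (of_real \<delta> ^ n * csum n \<tau> z)) sums
      (LINT \<tau>:{0..t}|lborel. cis ((t - \<tau>) * p z) * conv (sol \<tau>) (sol \<tau>) z)"
    by (simp add: h_def set_lebesgue_integral_def)
  have "(\<lambda>n. if n = 1 then cis (t * p z) * (of_real \<delta> * f z) else 0) sums (cis (t * p z) * (of_real \<delta> * f z))"
    using sums_single[of 1 "\<lambda>_. cis (t * p z) * (of_real \<delta> * f z)"] by simp
  from sums_diff[OF this sums_mult[OF I]]
  have "(\<lambda>n. of_real \<delta> ^ n * U n t z) sums (cis (t * p z) * (of_real \<delta> * f z) -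
     (\<i> * of_real (fst z) / of_real (2 * pi)) *
       (LINT \<tau>:{0..t}|lborel. cis ((t - \<tau>) * p z) * conv (sol \<tau>) (sol \<tau>) z))"
    unfolding term_duhamel .
  then show ?thesis by (simp add: sol_def sums_iff)
qed

text \<open>Tested against a bounded function, the solution is an honest power series in \<open>\<delta>\<close>; its third
  coefficient is the quantity that is estimated from above and from below.\<close>

lemma pairing_sums:
  assumes t: "0 \<le> t" "t \<le> T" and [measurable]: "w \<in> borel_measurable borel"
    and w: "\<And>z. norm (w z) \<le> K"
  shows "(\<lambda>n. (LINT z|lborel. w z * U n t z) * of_real \<delta> ^ n) sums (LINT z|lborel. w z * sol t z)"
proof -
  define h where "h = (\<lambda>n z. w z * (of_real \<delta> ^ n * U n t z))"
  have K: "0 \<le> K" using w[of 0] norm_ge_zero order_trans by blast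
  have [measurable]: "h n \<in> borel_measurable borel" for n unfolding h_def by measurable
  have hb: "norm (h n z) \<le> K * bnd n z" for n z
    unfolding h_def norm_mult[of "w z"] using w term_bound[OF t] K by (intro mult_mono) auto
  have ind: "integrable lborel (\<lambda>z. K * bnd n z)" for n using bnd_integrable by simp
  have hi: "integrable lborel (h n)" for n
    by (rule Bochner_Integration.integrable_bound[OF ind[of n]])
       (use hb in \<open>auto intro!: AE_I2 intro: order_trans[OF _ abs_ge_self]\<close>)
  have "(\<lambda>n. LINT z|lborel. h n z) sums (LINT z|lborel. (\<Sum>n. h n z))"
  proof (rule sums_integral[OF hi])
    show "AE z in lborel. summable (\<lambda>n. norm (h n z))"
    proof (rule AE_I2)
      show "summable (\<lambda>n. norm (h n z))" for z
        by (rule summable_comparison_test'[OF summable_mult[OF bnd_summable[of z], of K], of 0])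
           (simp only: real_norm_def abs_norm_cancel, rule hb)
    qed
    show "summable (\<lambda>n. LINT z|lborel. norm (h n z))"
    proof (rule summable_comparison_test'[OF summable_mult[OF weights_summable[of 0], of K], of 0])
      fix n
      have "(LINT z|lborel. norm (h n z)) \<le> (LINT z|lborel. K * bnd n z)"
        using hb by (intro integral_mono integrable_norm hi ind)
      also have "\<dots> \<le> K * (C0 * (1 / 2) ^ n)"
        using bnd_integral[of n] K by (simp add: mult_left_mono)
      finally show "norm (LINT z|lborel. norm (h n z)) \<le> K * (C0 * ((1 + real n * (2 * R)) ^ 0 * (1 / 2) ^ n))"
        by simp
    qed
  qed
  moreover have "(\<Sum>n. h n z) = w z * sol t z" for z
    using suminf_mult[OF summable_norm_cancel[OF term_summable[OF t]], of "w z" z]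
    by (simp add: h_def sol_def)
  moreover have "(LINT z|lborel. h n z) = (LINT z|lborel. w z * U n t z) * of_real \<delta> ^ n" for n
    by (simp add: h_def mult.left_commute[of "w _"] mult.commute)
  ultimately show ?thesis by simp
qed

end


section \<open>From the Fourier side to smooth solutions\<close>

definition symb :: "real \<Rightarrow> real \<Rightarrow> plane \<Rightarrow> real" where
  "symb \<beta> \<gamma> z = - \<beta> * fst z ^ 3 - ((snd z)\<^sup>2 + \<gamma>) / fst z"

lemma symb_measurable [measurable]: "symb \<beta> \<gamma> \<in> borel_measurable borel"
  unfolding symb_def[abs_def] by measurable

lemma W_inv_fourier:
  assumes "has_fourier u g"
  shows "W \<beta> \<gamma> t u = inv_fourier (\<lambda>z. cis (t * symb \<beta> \<gamma> z) * g z)"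
proof -
  have "(\<lambda>(\<xi>, \<eta>). exp (\<i> * complex_of_real (t * (- \<beta> * \<xi> ^ 3 - (\<eta>\<^sup>2 + \<gamma>) / \<xi>)))) =
      (\<lambda>z. cis (t * symb \<beta> \<gamma> z))"
    by (auto simp: fun_eq_iff symb_def cis_conv_exp)
  then show ?thesis
    unfolding W_def by (simp only:) (rule multiplier_eq[OF assms], measurable)
qed

lemma rapid_dominated_integrable:
  fixes g :: "plane \<Rightarrow> complex"
  assumes d: "rapid d" and [measurable]: "g \<in> borel_measurable borel" and gd: "\<And>z. norm (g z) \<le> d z"
  shows "integrable lborel g"
  by (rule Bochner_Integration.integrable_bound[OF rapidD(4)[OF d]])
     (use gd rapidD(2)[OF d] in \<open>auto intro!: AE_I2 intro: order_trans[OF _ abs_ge_self]\<close>)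

lemma rapid_dominated_square_integrable:
  fixes g :: "plane \<Rightarrow> complex"
  assumes d: "rapid d" and [measurable]: "g \<in> borel_measurable borel" and gd: "\<And>z. norm (g z) \<le> d z"
  shows "integrable lborel (\<lambda>z. ((1 + norm z) ^ n * norm (g z))\<^sup>2)"
proof (rule Bochner_Integration.integrable_bound[OF rapid_square_integrable[OF d, of n]])
  show "AE z in lborel. norm (((1 + norm z) ^ n * norm (g z))\<^sup>2) \<le> norm (((1 + norm z) ^ n * d z)\<^sup>2)"
    using gd by (intro AE_I2) (auto intro!: power_mono mult_left_mono)
qed simp

lemma H_inf_inv_fourier_fun:
  assumes d: "rapid d" and [measurable]: "g \<in> borel_measurable borel" and gd: "\<And>z. norm (g z) \<le> d z"
  shows "inv_fourier_fun g \<in> H_inf"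
proof -
  have g: "integrable lborel g" by (rule rapid_dominated_integrable[OF assms])
  note hf = has_fourier_regular[OF g]
  note [measurable] = fourier_measurable[OF hf]
  have "integrable lborel (\<lambda>z. ((1 + norm z) ^ n * norm (fourier (regular (inv_fourier_fun g)) z))\<^sup>2)" for n
  proof -
    have "integrable lborel (\<lambda>z. ((1 + norm z) ^ n * norm (fourier (regular (inv_fourier_fun g)) z))\<^sup>2) \<longleftrightarrow>
        integrable lborel (\<lambda>z. ((1 + norm z) ^ n * norm (g z))\<^sup>2)"
      by (rule integrable_cong_AE) (use fourier_eq_AE[OF hf] in \<open>auto elim: eventually_mono\<close>)
    then show ?thesis using rapid_dominated_square_integrable[OF assms] by simp
  qed
  moreover have "bounded (range (inv_fourier_fun g))"
    unfolding bounded_iff using inv_fourier_fun_bound[of g] by blast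
  ultimately show ?thesis
    unfolding H_inf_def using inv_fourier_fun_continuous[OF g] hf by blast
qed

lemma iso_norm_diff:
  assumes "has_fourier u g" "has_fourier v h"
  shows "iso_norm n (u - v) = sqrt (LINT z|lborel. ((1 + norm z) ^ n * norm (g z - h z))\<^sup>2)"
proof -
  note hf = has_fourier_diff[OF assms]
  note [measurable] = fourier_measurable[OF hf] fourier_measurable(2)[OF assms(1)] fourier_measurable(2)[OF assms(2)]
  have "(LINT z|lborel. ((1 + norm z) ^ n * norm (fourier (u - v) z))\<^sup>2) =
      (LINT z|lborel. ((1 + norm z) ^ n * norm (g z - h z))\<^sup>2)"
    by (rule integral_cong_AE) (use fourier_eq_AE[OF hf] in \<open>auto elim: eventually_mono\<close>)
  then show ?thesis by (simp add: iso_norm_def)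
qed

text \<open>The integral equation on the Fourier side, pointwise in the frequency.\<close>

locale fourier_solution =
  fixes \<beta> \<gamma> T :: real and d :: "plane \<Rightarrow> real" and V :: "real \<Rightarrow> plane \<Rightarrow> complex"
    and f :: "plane \<Rightarrow> complex"
  assumes d: "rapid d"
    and V_measurable_pair: "(\<lambda>x. V (fst x) (snd x)) \<in> borel_measurable (borel \<Otimes>\<^sub>M borel)"
    and V_bound: "0 \<le> t \<Longrightarrow> t \<le> T \<Longrightarrow> norm (V t z) \<le> d z"
    and T: "0 < T"
    and duhamel: "0 \<le> t \<Longrightarrow> t \<le> T \<Longrightarrow> V t z = cis (t * symb \<beta> \<gamma> z) * f z -
      (\<i> * of_real (fst z) / of_real (2 * pi)) *
       (LINT \<tau>:{0..t}|lborel. cis ((t - \<tau>) * symb \<beta> \<gamma> z) * conv (V \<tau>) (V \<tau>) z)"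
begin

abbreviation "p \<equiv> symb \<beta> \<gamma>"

lemma V_measurable [measurable]: "V t \<in> borel_measurable borel"
  using measurable_compose[OF _ V_measurable_pair, of "\<lambda>z. (t, z)" borel] by simp

lemma V_0: "V 0 = f"
  using duhamel[of 0] T by (simp add: time_integral_point fun_eq_iff)

lemma V_integrable: "0 \<le> t \<Longrightarrow> t \<le> T \<Longrightarrow> integrable lborel (V t)"
  by (rule rapid_dominated_integrable[OF d _ V_bound]) auto

lemma conv_V_measurable_pair: "(\<lambda>x. conv (V (fst x)) (V (fst x)) (snd x)) \<in> borel_measurable (borel \<Otimes>\<^sub>M borel)"
  by (intro conv_measurable V_measurable_pair)

lemma conv_V_measurable_time [measurable]: "(\<lambda>\<tau>. conv (V \<tau>) (V \<tau>) z) \<in> borel_measurable borel"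
  using measurable_compose[OF _ conv_V_measurable_pair, of "\<lambda>\<tau>. (\<tau>, z)" borel] by simp

lemma conv_V_bound:
  assumes "0 \<le> t" "t \<le> T"
  shows "norm (conv (V t) (V t) z) \<le> conv d d z"
proof -
  obtain K where K: "\<And>z. (1 + norm z) ^ 0 * d z \<le> K" using rapid_bounded[OF d] by blast
  note [measurable] = rapidD(1)[OF d]
  show ?thesis
    by (rule norm_conv_mono[where S = K])
       (use V_bound[OF assms] rapidD(4)[OF d] K in simp_all)
qed

lemma weighted_conv_V_integrable:
  assumes t: "0 \<le> t" "t \<le> T"
  shows "integrable lborel (\<lambda>z. of_real (fst z) * (conv (V t) (V t) z / of_real (2 * pi)))"
proof (rule Bochner_Integration.integrable_bound[OF rapid_conv_integrable[OF d]])
  show "AE z in lborel. norm (complex_of_real (fst z) * (conv (V t) (V t) z / of_real (2 * pi))) \<le>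
      norm ((1 + norm z) * conv d d z)"
  proof (rule AE_I2)
    fix z :: plane
    have "norm (conv (V t) (V t) z) / (2 * pi) \<le> norm (conv (V t) (V t) z) / 1"
      using pi_ge_two by (intro divide_left_mono) auto
    then have "norm (conv (V t) (V t) z / of_real (2 * pi)) \<le> conv d d z"
      using conv_V_bound[OF t, of z] by (simp add: norm_divide norm_mult)
    moreover have "\<bar>fst z\<bar> \<le> 1 + norm z" using norm_fst_le[of "fst z" "snd z"] by simp
    ultimately have "\<bar>fst z\<bar> * norm (conv (V t) (V t) z / of_real (2 * pi)) \<le> (1 + norm z) * conv d d z"
      by (intro mult_mono) auto
    then have "norm (complex_of_real (fst z) * (conv (V t) (V t) z / of_real (2 * pi))) \<le>
        (1 + norm z) * conv d d z"
      by (simp only: norm_mult[of "of_real (fst z)"] norm_of_real)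
    then show "norm (complex_of_real (fst z) * (conv (V t) (V t) z / of_real (2 * pi))) \<le>
        norm ((1 + norm z) * conv d d z)"
      unfolding real_norm_def by (rule order_trans[OF _ abs_ge_self])
  qed
qed simp

lemma has_fourier_nonlinearity:
  assumes t: "0 \<le> t" "t \<le> T"
  shows "has_fourier (ddx (regular (\<lambda>z. (inv_fourier_fun (V t) z)\<^sup>2)))
    (\<lambda>z. \<i> * of_real (fst z) * (conv (V t) (V t) z / of_real (2 * pi)))"
proof (rule has_fourier_ddx[OF _ weighted_conv_V_integrable[OF t]])
  have "integrable lborel (\<lambda>z. conv (V t) (V t) z / of_real (2 * pi))"
    using conv_integrable[OF V_integrable[OF t] V_integrable[OF t]] by simp
  from has_fourier_regular[OF this]
  show "has_fourier (regular (\<lambda>z. (inv_fourier_fun (V t) z)\<^sup>2)) (\<lambda>z. conv (V t) (V t) z / of_real (2 * pi))"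
    unfolding inv_fourier_fun_conv[OF V_integrable[OF t] V_integrable[OF t], symmetric]
    by (simp add: power2_eq_square)
qed

text \<open>The integral equation writes \<open>V\<close> as a continuous phase times the
  indefinite integral of a bounded function.\<close>

lemma V_continuous: "continuous_on {0..T} (\<lambda>t. V t z)"
proof -
  define G where "G = (\<lambda>\<tau>. cis (- \<tau> * p z) * conv (V \<tau>) (V \<tau>) z)"
  have [measurable]: "G \<in> borel_measurable borel" unfolding G_def by measurable
  have Gi: "set_integrable lborel {0..t} G" if "0 \<le> t" "t \<le> T" for t
    using power_time_integrable[OF that(1), of 0 "conv d d z"] conv_V_bound that
    by (intro norm_time_integral_le(1)[where G = "\<lambda>_. conv d d z"]) (auto simp: G_def norm_mult)
  have J: "(LINT \<tau>:{0..t}|lborel. G \<tau>) = integral {0..t} G" if "0 \<le> t" "t \<le> T" for t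
    by (rule set_borel_integral_eq_integral(2)[OF Gi[OF that]])
  have "G integrable_on {0..T}"
    using T by (intro set_borel_integral_eq_integral(1)[OF Gi]) auto
  then have c: "continuous_on {0..T} (\<lambda>t. integral {0..t} G)"
    by (rule indefinite_integral_continuous_1)
  have eq: "V t z = cis (t * p z) * (f z - (\<i> * of_real (fst z) / of_real (2 * pi)) * integral {0..t} G)"
    if t: "t \<in> {0..T}" for t
  proof -
    have "(LINT \<tau>:{0..t}|lborel. cis ((t - \<tau>) * p z) * conv (V \<tau>) (V \<tau>) z) =
        (LINT \<tau>:{0..t}|lborel. cis (t * p z) * G \<tau>)"
      unfolding G_def mult.assoc[symmetric] cis_mult by (simp add: algebra_simps)
    also have "\<dots> = cis (t * p z) * integral {0..t} G"
      using J[of t] t by simp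
    finally show ?thesis using duhamel[of t z] t by (simp add: algebra_simps)
  qed
  show ?thesis
    by (subst continuous_on_cong[OF refl eq]) (auto intro!: continuous_intros c)
qed

text \<open>Dominated convergence, with the majorant \<open>d\<close>.\<close>

lemma iso_norm_continuous:
  assumes t: "t \<in> {0..T}"
  shows "((\<lambda>\<tau>. iso_norm n (regular (inv_fourier_fun (V \<tau>)) - regular (inv_fourier_fun (V t)))) \<longlongrightarrow> 0)
    (at t within {0..T})"
  unfolding tendsto_at_iff_sequentially comp_def
proof (intro allI impI)
  fix X :: "nat \<Rightarrow> real"
  assume X: "\<forall>i. X i \<in> {0..T} - {t}" "X \<longlonglongrightarrow> t"
  have X': "0 \<le> X i" "X i \<le> T" for i using X(1) by auto
  have t': "0 \<le> t" "t \<le> T" using t by auto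
  note [measurable] = rapidD(1)[OF d]
  have lim: "(\<lambda>i. V (X i) z) \<longlonglongrightarrow> V t z" for z
    by (rule continuous_on_tendsto_compose[OF V_continuous X(2) t]) (use X' in auto)
  have "(\<lambda>i. LINT z|lborel. ((1 + norm z) ^ n * norm (V (X i) z - V t z))\<^sup>2) \<longlonglongrightarrow> (LINT z|(lborel :: plane measure). 0)"
  proof (rule integral_dominated_convergence[where w = "\<lambda>z. 4 * ((1 + norm z) ^ n * d z)\<^sup>2"])
    show "integrable lborel (\<lambda>z. 4 * ((1 + norm z) ^ n * d z)\<^sup>2)"
      using rapid_square_integrable[OF d] by simp
    show "AE z in lborel. (\<lambda>i. ((1 + norm z) ^ n * norm (V (X i) z - V t z))\<^sup>2) \<longlonglongrightarrow> 0"
    proof (rule AE_I2)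
      fix z :: plane
      have "(\<lambda>i. ((1 + norm z) ^ n * norm (V (X i) z - V t z))\<^sup>2) \<longlonglongrightarrow>
          ((1 + norm z) ^ n * norm (V t z - V t z))\<^sup>2"
        by (intro tendsto_intros lim)
      then show "(\<lambda>i. ((1 + norm z) ^ n * norm (V (X i) z - V t z))\<^sup>2) \<longlonglongrightarrow> 0" by simp
    qed
    show "AE z in lborel. norm (((1 + norm z) ^ n * norm (V (X i) z - V t z))\<^sup>2) \<le>
        4 * ((1 + norm z) ^ n * d z)\<^sup>2" for i
    proof (rule AE_I2)
      fix z :: plane
      have "norm (V (X i) z - V t z) \<le> 2 * d z"
        using norm_triangle_ineq4[of "V (X i) z" "V t z"] V_bound[OF X'[of i], of z] V_bound[OF t', of z] by simp
      then have "((1 + norm z) ^ n * norm (V (X i) z - V t z))\<^sup>2 \<le> ((1 + norm z) ^ n * (2 * d z))\<^sup>2"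
        by (intro power_mono mult_left_mono) auto
      then show "norm (((1 + norm z) ^ n * norm (V (X i) z - V t z))\<^sup>2) \<le> 4 * ((1 + norm z) ^ n * d z)\<^sup>2"
        by (simp add: power_mult_distrib)
    qed
  qed simp_all
  from tendsto_real_sqrt[OF this]
  show "(\<lambda>i. iso_norm n (regular (inv_fourier_fun (V (X i))) - regular (inv_fourier_fun (V t)))) \<longlonglongrightarrow> 0"
    by (simp add: iso_norm_diff[OF has_fourier_regular[OF V_integrable[OF X']] has_fourier_regular[OF V_integrable[OF t']]])
qed

context
  fixes t :: real and \<phi> :: "plane \<Rightarrow> complex"
  assumes t: "0 \<le> t" "t \<le> T" and \<phi>: "\<phi> \<in> schwartz"
begin

text \<open>The integrand of the nonlinear term, in time and frequency, after pairing with a test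
  function.\<close>

definition duhamel_kernel :: "real \<Rightarrow> plane \<Rightarrow> complex" where
  "duhamel_kernel \<tau> z = cis ((t - \<tau>) * p z) * (\<i> * of_real (fst z) * (conv (V \<tau>) (V \<tau>) z / of_real (2 * pi))) *
     inv_fourier_fun \<phi> z"

text \<open>Joint integrability, which permits both the weak time integral and the interchange of
  time and frequency integrals.\<close>

lemma duhamel_kernel_integrable:
  "integrable (lborel \<Otimes>\<^sub>M lborel) (\<lambda>(\<tau>, z). indicator {0..t} \<tau> *\<^sub>R duhamel_kernel \<tau> z)"
proof -
  define K where "K = (LINT \<zeta>|lborel. norm (\<phi> \<zeta>)) / (2 * pi)"
  have K: "0 \<le> K" "norm (inv_fourier_fun \<phi> z) \<le> K" for z
    using inv_fourier_fun_bound[of \<phi> z] by (auto simp: K_def)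
  note [measurable] = inv_fourier_test_measurable[OF \<phi>] conv_V_measurable_pair
  have bound: "integrable (lborel \<Otimes>\<^sub>M lborel) (\<lambda>x. indicator {0..t} (fst x) * (K * ((1 + norm (snd x)) * conv d d (snd x))))"
  proof (rule integrable_tensor)
    show "integrable lborel (indicat_real {0..t})"
      using power_time_integrable[OF t(1), of 0 1] by (simp add: set_integrable_def)
    show "integrable lborel (\<lambda>z. K * ((1 + norm z) * conv d d z))"
      using rapid_conv_integrable[OF d] by simp
  qed
  show ?thesis
  proof (rule Bochner_Integration.integrable_bound[OF bound])
    show "(\<lambda>(\<tau>, z). indicator {0..t} \<tau> *\<^sub>R duhamel_kernel \<tau> z) \<in> borel_measurable (lborel \<Otimes>\<^sub>M lborel)"
      unfolding duhamel_kernel_def case_prod_beta' by measurable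
    show "AE x in lborel \<Otimes>\<^sub>M lborel. norm (case x of (\<tau>, z) \<Rightarrow> indicator {0..t} \<tau> *\<^sub>R duhamel_kernel \<tau> z) \<le>
        norm (indicator {0..t} (fst x) * (K * ((1 + norm (snd x)) * conv d d (snd x))))"
    proof (rule AE_I2, clarify)
      fix \<tau> :: real and \<xi> \<eta> :: real
      define z where "z = (\<xi>, \<eta>)"
      show "norm (indicator {0..t} \<tau> *\<^sub>R duhamel_kernel \<tau> (\<xi>, \<eta>)) \<le>
        norm (indicator {0..t} (fst (\<tau>, \<xi>, \<eta>)) * (K * ((1 + norm (snd (\<tau>, \<xi>, \<eta>))) * conv d d (snd (\<tau>, \<xi>, \<eta>)))))"
      proof (cases "\<tau> \<in> {0..t}")
        case True
        then have \<tau>: "0 \<le> \<tau>" "\<tau> \<le> T" using t by auto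
        have "norm (conv (V \<tau>) (V \<tau>) z) / (2 * pi) \<le> norm (conv (V \<tau>) (V \<tau>) z) / 1"
          using pi_ge_two by (intro divide_left_mono) auto
        then have 1: "norm (conv (V \<tau>) (V \<tau>) z / of_real (2 * pi)) \<le> conv d d z"
          using conv_V_bound[OF \<tau>, of z] by (simp add: norm_divide norm_mult)
        have 2: "\<bar>fst z\<bar> \<le> 1 + norm z" using norm_fst_le[of "fst z" "snd z"] by simp
        have "norm (duhamel_kernel \<tau> z) =
            \<bar>fst z\<bar> * norm (conv (V \<tau>) (V \<tau>) z / of_real (2 * pi)) * norm (inv_fourier_fun \<phi> z)"
          unfolding duhamel_kernel_def norm_mult by simp
        also have "\<dots> \<le> (1 + norm z) * conv d d z * K"
          using 1 2 K rapid_conv_nonneg[OF d, of z] by (intro mult_mono) auto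
        finally show ?thesis
          using True K(1) rapid_conv_nonneg[OF d, of z] unfolding z_def[symmetric]
          by (simp add: mult_ac)
      qed simp
    qed
  qed
qed

lemma duhamel_W:
  assumes "\<tau> \<in> {0..t}"
  shows "W \<beta> \<gamma> (t - \<tau>) (ddx (regular (\<lambda>z. (inv_fourier_fun (V \<tau>) z)\<^sup>2))) \<phi> =
    (LINT z|lborel. duhamel_kernel \<tau> z)"
proof -
  have \<tau>: "0 \<le> \<tau>" "\<tau> \<le> T" using assms t by auto
  show ?thesis
    unfolding W_inv_fourier[OF has_fourier_nonlinearity[OF \<tau>]] inv_fourier_def duhamel_kernel_def
    using \<phi> by simp
qed

lemma duhamel_set_integrable:
  "set_integrable lborel {0..t} (\<lambda>\<tau>. W \<beta> \<gamma> (t - \<tau>) (ddx (regular (\<lambda>z. (inv_fourier_fun (V \<tau>) z)\<^sup>2))) \<phi>)"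
proof -
  have "set_integrable lborel {0..t} (\<lambda>\<tau>. LINT z|lborel. duhamel_kernel \<tau> z)"
    using lborel_pair.integrable_fst[OF duhamel_kernel_integrable]
    by (simp add: set_integrable_def)
  then show ?thesis
    by (subst set_integrable_cong[OF refl refl duhamel_W]) auto
qed

lemma duhamel_distr:
  "regular (inv_fourier_fun (V t)) \<phi> = W \<beta> \<gamma> t (regular (inv_fourier_fun f)) \<phi> -
    (LINT \<tau>:{0..t}|lborel. W \<beta> \<gamma> (t - \<tau>) (ddx (regular (\<lambda>z. (inv_fourier_fun (V \<tau>) z)\<^sup>2))) \<phi>)"
proof -
  note [measurable] = inv_fourier_test_measurable[OF \<phi>]
  have f: "integrable lborel f" using V_integrable[of 0] V_0 T by simp
  then have [measurable]: "f \<in> borel_measurable borel" by (simp add: borel_measurable_integrable)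
  define c where "c = (\<lambda>z. (\<i> * of_real (fst z) / of_real (2 * pi)) *
       (LINT \<tau>:{0..t}|lborel. cis ((t - \<tau>) * p z) * conv (V \<tau>) (V \<tau>) z))"
  have lin: "integrable lborel (\<lambda>z. cis (t * p z) * f z * inv_fourier_fun \<phi> z)"
  proof (rule integrable_mult_inv_fourier_fun[OF _ \<phi>])
    show "integrable lborel (\<lambda>z. cis (t * p z) * f z)"
      by (rule Bochner_Integration.integrable_bound[OF f]) (auto simp: norm_mult)
  qed
  have ck: "(LINT \<tau>|lborel. indicator {0..t} \<tau> *\<^sub>R duhamel_kernel \<tau> z) = c z * inv_fourier_fun \<phi> z" for z
  proof -
    have "(\<lambda>\<tau>. indicator {0..t} \<tau> *\<^sub>R duhamel_kernel \<tau> z) =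
        (\<lambda>\<tau>. (\<i> * of_real (fst z) / of_real (2 * pi)) * inv_fourier_fun \<phi> z *
          (indicator {0..t} \<tau> *\<^sub>R (cis ((t - \<tau>) * p z) * conv (V \<tau>) (V \<tau>) z)))"
      by (simp add: duhamel_kernel_def fun_eq_iff mult_ac)
    then have "(LINT \<tau>|lborel. indicator {0..t} \<tau> *\<^sub>R duhamel_kernel \<tau> z) =
        (\<i> * of_real (fst z) / of_real (2 * pi)) * inv_fourier_fun \<phi> z *
          (LINT \<tau>|lborel. indicator {0..t} \<tau> *\<^sub>R (cis ((t - \<tau>) * p z) * conv (V \<tau>) (V \<tau>) z))"
      by (simp only: integral_mult_right_zero)
    then show ?thesis by (simp only: c_def set_lebesgue_integral_def mult_ac)
  qed
  have ci: "integrable lborel (\<lambda>z. c z * inv_fourier_fun \<phi> z)"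
    using lborel_pair.integrable_snd[OF duhamel_kernel_integrable] by (simp only: ck)
  have "regular (inv_fourier_fun (V t)) \<phi> = (LINT z|lborel. V t z * inv_fourier_fun \<phi> z)"
    using \<phi> by (simp add: regular_inv_fourier_fun[OF V_integrable[OF t]] inv_fourier_def)
  also have "\<dots> = (LINT z|lborel. cis (t * p z) * f z * inv_fourier_fun \<phi> z - c z * inv_fourier_fun \<phi> z)"
    by (simp only: duhamel[OF t] c_def left_diff_distrib)
  also have "\<dots> = (LINT z|lborel. cis (t * p z) * f z * inv_fourier_fun \<phi> z) - (LINT z|lborel. c z * inv_fourier_fun \<phi> z)"
    by (rule Bochner_Integration.integral_diff[OF lin ci])
  also have "(LINT z|lborel. cis (t * p z) * f z * inv_fourier_fun \<phi> z) = W \<beta> \<gamma> t (regular (inv_fourier_fun f)) \<phi>"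
    using \<phi> by (simp add: W_inv_fourier[OF has_fourier_regular[OF f]] inv_fourier_def)
  also have "(LINT z|lborel. c z * inv_fourier_fun \<phi> z) = (LINT \<tau>|lborel. LINT z|lborel. indicator {0..t} \<tau> *\<^sub>R duhamel_kernel \<tau> z)"
    unfolding ck[symmetric] by (rule lborel_pair.Fubini_integral[OF duhamel_kernel_integrable])
  also have "\<dots> = (LINT \<tau>:{0..t}|lborel. LINT z|lborel. duhamel_kernel \<tau> z)"
    by (simp add: set_lebesgue_integral_def)
  also have "\<dots> = (LINT \<tau>:{0..t}|lborel. W \<beta> \<gamma> (t - \<tau>) (ddx (regular (\<lambda>z. (inv_fourier_fun (V \<tau>) z)\<^sup>2))) \<phi>)"
    by (rule set_lebesgue_integral_cong) (auto simp: duhamel_W)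
  finally show ?thesis .
qed

end

theorem smooth_solution_inv_fourier:
  "smooth_solution \<beta> \<gamma> T (inv_fourier_fun f) (\<lambda>t. inv_fourier_fun (V t))"
  unfolding smooth_solution_def
proof (intro conjI ballI allI)
  show "inv_fourier_fun (V t) \<in> H_inf" if "t \<in> {0..T}" for t
    using that by (intro H_inf_inv_fourier_fun[OF d _ V_bound]) auto
qed (use iso_norm_continuous duhamel_set_integrable duhamel_distr in auto)

end


section \<open>The third coefficient as an oscillatory integral\<close>

text \<open>The integral of \<open>cis (\<sigma> \<Omega>)\<close> over \<open>[0, t]\<close>.\<close>

definition osc :: "real \<Rightarrow> real \<Rightarrow> complex" where
  "osc \<Omega> t = (if \<Omega> = 0 then of_real t else (cis (t * \<Omega>) - 1) / (\<i> * of_real \<Omega>))"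

lemma cis_linear_derivative:
  "((\<lambda>\<sigma>. cis (\<sigma> * \<Omega>)) has_vector_derivative \<i> * of_real \<Omega> * cis (\<sigma> * \<Omega>)) (at \<sigma> within S)"
proof -
  have "((\<lambda>z. exp (\<i> * (z * of_real \<Omega>))) has_field_derivative
      \<i> * of_real \<Omega> * exp (\<i> * (of_real \<sigma> * of_real \<Omega>))) (at (complex_of_real \<sigma>))"
    by (auto intro!: derivative_eq_intros)
  from has_vector_derivative_real_field[OF this]
  have "((\<lambda>\<sigma>. cis (\<sigma> * \<Omega>)) has_vector_derivative \<i> * of_real \<Omega> * cis (\<sigma> * \<Omega>)) (at \<sigma>)"
    by (simp only: cis_conv_exp of_real_mult)
  then show ?thesis by (rule has_vector_derivative_at_within)
qed

lemma osc_integral: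
  assumes "0 \<le> t"
  shows "set_integrable lborel {0..t} (\<lambda>\<sigma>. cis (\<sigma> * \<Omega>))"
    and "(LINT \<sigma>:{0..t}|lborel. cis (\<sigma> * \<Omega>)) = osc \<Omega> t"
proof -
  show "set_integrable lborel {0..t} (\<lambda>\<sigma>. cis (\<sigma> * \<Omega>))"
    by (intro borel_integrable_atLeastAtMost' continuous_intros)
  show "(LINT \<sigma>:{0..t}|lborel. cis (\<sigma> * \<Omega>)) = osc \<Omega> t"
  proof (cases "\<Omega> = 0")
    case True
    then show ?thesis
      using assms by (simp add: osc_def set_lebesgue_integral_def scaleR_conv_of_real)
  next
    case False
    have "(LINT \<sigma>|lborel. indicator {0..t} \<sigma> *\<^sub>R cis (\<sigma> * \<Omega>)) =
        cis (t * \<Omega>) / (\<i> * of_real \<Omega>) - cis (0 * \<Omega>) / (\<i> * of_real \<Omega>)"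
    proof (rule integral_FTC_atLeastAtMost[OF assms])
      show "((\<lambda>\<sigma>. cis (\<sigma> * \<Omega>) / (\<i> * of_real \<Omega>)) has_vector_derivative cis (\<sigma> * \<Omega>)) (at \<sigma> within {0..t})" for \<sigma>
        by (rule has_vector_derivative_eq_rhs[OF has_vector_derivative_divide[OF cis_linear_derivative]])
           (use False in simp)
    qed (intro continuous_intros)
    then show ?thesis using False by (simp add: osc_def set_lebesgue_integral_def diff_divide_distrib)
  qed
qed

lemma osc_norm_le: "0 \<le> t \<Longrightarrow> norm (osc \<Omega> t) \<le> t"
proof -
  assume t: "0 \<le> t"
  have "norm (LINT \<sigma>:{0..t}|lborel. cis (\<sigma> * \<Omega>)) \<le> (LINT \<sigma>:{0..t}|lborel. \<sigma> ^ 0 * 1)"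
    by (rule norm_time_integral_le(2)[OF _ power_time_integrable[OF t]]) auto
  then show "norm (osc \<Omega> t) \<le> t"
    unfolding osc_integral(2)[OF t] power_time_integral[OF t] by simp
qed

lemma osc_norm_le_inverse: "\<Omega> \<noteq> 0 \<Longrightarrow> norm (osc \<Omega> t) \<le> 2 / \<bar>\<Omega>\<bar>"
  using norm_triangle_ineq4[of "cis (t * \<Omega>)" 1]
  by (simp add: osc_def norm_divide norm_mult divide_right_mono)

lemma osc_measurable [measurable]:
  assumes [measurable]: "g \<in> borel_measurable M" "h \<in> borel_measurable M"
  shows "(\<lambda>x. osc (g x) (h x)) \<in> borel_measurable M"
  unfolding osc_def by measurable

definition tri :: "real \<Rightarrow> real \<Rightarrow> real \<Rightarrow> complex" where
  "tri \<Theta> \<Omega> t = (LINT \<tau>:{0..t}|lborel. cis (\<tau> * \<Theta>) * osc \<Omega> \<tau>)"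

lemma tri_norm_le_aux:
  assumes t: "0 \<le> t" and K: "\<And>\<tau>. 0 \<le> \<tau> \<Longrightarrow> \<tau> \<le> t \<Longrightarrow> norm (osc \<Omega> \<tau>) \<le> K"
  shows "norm (tri \<Theta> \<Omega> t) \<le> t * K"
proof -
  have "norm (LINT \<tau>:{0..t}|lborel. cis (\<tau> * \<Theta>) * osc \<Omega> \<tau>) \<le> (LINT \<tau>:{0..t}|lborel. \<tau> ^ 0 * K)"
    by (rule norm_time_integral_le(2)[OF _ power_time_integrable[OF t]]) (use K in \<open>auto simp: norm_mult\<close>)
  then show ?thesis unfolding tri_def power_time_integral[OF t] by simp
qed

lemma tri_norm_le: "0 \<le> t \<Longrightarrow> norm (tri \<Theta> \<Omega> t) \<le> t * t"
  by (rule tri_norm_le_aux) (auto intro: order_trans[OF osc_norm_le])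

lemma tri_norm_le_inverse: "0 \<le> t \<Longrightarrow> \<Omega> \<noteq> 0 \<Longrightarrow> norm (tri \<Theta> \<Omega> t) \<le> t * (2 / \<bar>\<Omega>\<bar>)"
  by (rule tri_norm_le_aux) (auto intro: osc_norm_le_inverse)

lemma tri_measurable [measurable]:
  assumes [measurable]: "g \<in> borel_measurable M" "h \<in> borel_measurable M"
  shows "(\<lambda>x. tri (g x) (h x) t) \<in> borel_measurable M"
  unfolding tri_def set_lebesgue_integral_def by measurable

text \<open>Two nested time integrations split into two single ones: one oscillates with the total
  phase \<open>\<Theta> + \<Omega>\<close>, the other with the phase \<open>\<Theta>\<close> of
  the second interaction alone.\<close>

lemma tri_eq:
  assumes t: "0 \<le> t" and "\<Omega> \<noteq> 0"
  shows "tri \<Theta> \<Omega> t = (osc (\<Theta> + \<Omega>) t - osc \<Theta> t) / (\<i> * of_real \<Omega>)"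
proof -
  have "cis (\<tau> * \<Theta>) * osc \<Omega> \<tau> = (cis (\<tau> * (\<Theta> + \<Omega>)) - cis (\<tau> * \<Theta>)) / (\<i> * of_real \<Omega>)" for \<tau>
    using assms(2) by (simp add: osc_def right_diff_distrib cis_mult distrib_left)
  then have "tri \<Theta> \<Omega> t = (LINT \<tau>:{0..t}|lborel. (cis (\<tau> * (\<Theta> + \<Omega>)) - cis (\<tau> * \<Theta>)) / (\<i> * of_real \<Omega>))"
    by (simp only: tri_def)
  also have "\<dots> = (LINT \<tau>:{0..t}|lborel. (cis (\<tau> * (\<Theta> + \<Omega>)) - cis (\<tau> * \<Theta>))) / (\<i> * of_real \<Omega>)"
    by (rule set_integral_divide_zero)
  also have "(LINT \<tau>:{0..t}|lborel. (cis (\<tau> * (\<Theta> + \<Omega>)) - cis (\<tau> * \<Theta>))) = osc (\<Theta> + \<Omega>) t - osc \<Theta> t"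
    using osc_integral[OF t] by (subst set_integral_diff) auto
  finally show ?thesis .
qed

lemma time_space_swap:
  fixes h :: "real \<Rightarrow> plane \<Rightarrow> complex"
  assumes t: "0 \<le> t"
    and [measurable]: "(\<lambda>x. h (fst x) (snd x)) \<in> borel_measurable (lborel \<Otimes>\<^sub>M lborel)"
    and g: "integrable lborel g" and le: "\<And>\<tau> z. 0 \<le> \<tau> \<Longrightarrow> \<tau> \<le> t \<Longrightarrow> norm (h \<tau> z) \<le> g z"
  shows "(LINT \<tau>:{0..t}|lborel. LINT z|lborel. h \<tau> z) = (LINT z|lborel. (LINT \<tau>:{0..t}|lborel. h \<tau> z))"
proof -
  have i: "integrable lborel (indicat_real {0..t})"
    using power_time_integrable[OF t, of 0 1] by (simp add: set_integrable_def)
  have le': "norm (indicator {0..t} \<tau> *\<^sub>R h \<tau> z) \<le> indicator {0..t} \<tau> * g z" for \<tau> z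
    using le[of \<tau> z] by (auto simp: indicator_def)
  have "integrable (lborel \<Otimes>\<^sub>M lborel) (\<lambda>(\<tau>, z). indicator {0..t} \<tau> *\<^sub>R h \<tau> z)"
  proof (rule Bochner_Integration.integrable_bound[OF integrable_tensor[OF i g]])
    show "(\<lambda>(\<tau>, z). indicator {0..t} \<tau> *\<^sub>R h \<tau> z) \<in> borel_measurable (lborel \<Otimes>\<^sub>M lborel)"
      unfolding case_prod_beta' by measurable
    show "AE x in lborel \<Otimes>\<^sub>M lborel. norm (case x of (\<tau>, z) \<Rightarrow> indicator {0..t} \<tau> *\<^sub>R h \<tau> z) \<le>
        norm (indicat_real {0..t} (fst x) * g (snd x))"
      using le' by (intro AE_I2) (auto intro: order_trans[OF _ abs_ge_self])
  qed
  from lborel_pair.Fubini_integral[OF this] show ?thesis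
    unfolding set_lebesgue_integral_def by simp
qed

context fourier_data
begin

lemma iterate_1_norm: "norm (U 1 t z) = norm (f z)"
  by (simp only: iterate_1 norm_mult norm_cis mult_1_left)

lemma norm_f_integrable: "integrable lborel (\<lambda>z. norm (f z))"
  using f_integrable by simp

text \<open>The mismatch between the phase of two waves and that of their product.\<close>

definition defect :: "plane \<Rightarrow> plane \<Rightarrow> real" where
  "defect z1 z2 = p z1 + p z2 - p (z1 + z2)"

text \<open>After interchanging the integrals, the time integration acts on the phase mismatch
  alone.\<close>

lemma second_iterate:
  assumes \<tau>: "0 \<le> \<tau>"
  shows "U 2 \<tau> z = cis (\<tau> * p z) * (- (\<i> * of_real (fst z) / of_real (2 * pi))) *
    (LINT w|lborel. f w * f (z - w) * osc (defect w (z - w)) \<tau>)"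
proof -
  define h where "h = (\<lambda>\<sigma> w. cis ((\<tau> - \<sigma>) * p z) * (cis (\<sigma> * p w) * f w * (cis (\<sigma> * p (z - w)) * f (z - w))))"
  have hb: "norm (h \<sigma> w) \<le> norm (f w) * A" for \<sigma> w
    using f_bound[of "z - w"] by (simp add: h_def norm_mult mult_left_mono)
  have "(LINT \<sigma>:{0..\<tau>}|lborel. cis ((\<tau> - \<sigma>) * p z) * (\<Sum>j\<in>{1..<2}. conv (U j \<sigma>) (U (2 - j) \<sigma>) z)) =
      (LINT \<sigma>:{0..\<tau>}|lborel. LINT w|lborel. h \<sigma> w)"
  proof -
    have "{1..<2::nat} = {1}" by auto
    then show ?thesis
      by (simp only: sum.insert sum.empty finite.emptyI empty_iff not_False_eq_True add_0_right
          conv_def iterate_1 h_def integral_mult_right_zero diff_Suc_1 numeral_2_eq_2 One_nat_def[symmetric] if_False)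
  qed
  also have "\<dots> = (LINT w|lborel. (LINT \<sigma>:{0..\<tau>}|lborel. h \<sigma> w))"
  proof (rule time_space_swap[OF \<tau>])
    show "(\<lambda>x. h (fst x) (snd x)) \<in> borel_measurable (lborel \<Otimes>\<^sub>M lborel)"
      unfolding h_def by measurable
    show "integrable lborel (\<lambda>w. norm (f w) * A)" using f_integrable by simp
  qed (rule hb)
  also have "\<dots> = (LINT w|lborel. cis (\<tau> * p z) * (f w * f (z - w) * osc (defect w (z - w)) \<tau>))"
  proof (rule Bochner_Integration.integral_cong[OF refl])
    fix w
    have "h \<sigma> w = cis (\<tau> * p z) * (f w * f (z - w)) * cis (\<sigma> * defect w (z - w))" for \<sigma>
    proof -
      have "cis ((\<tau> - \<sigma>) * p z) * cis (\<sigma> * p w) * cis (\<sigma> * p (z - w)) = cis (\<tau> * p z) * cis (\<sigma> * defect w (z - w))"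
        unfolding cis_mult defect_def by (simp add: algebra_simps)
      then show ?thesis by (simp add: h_def) (metis (no_types, opaque_lifting) mult.assoc mult.commute)
    qed
    then have "(LINT \<sigma>:{0..\<tau>}|lborel. h \<sigma> w) =
        (LINT \<sigma>:{0..\<tau>}|lborel. cis (\<tau> * p z) * (f w * f (z - w)) * cis (\<sigma> * defect w (z - w)))"
      by (simp only:)
    also have "\<dots> = cis (\<tau> * p z) * (f w * f (z - w)) * osc (defect w (z - w)) \<tau>"
      unfolding osc_integral(2)[OF \<tau>, symmetric] by (rule set_integral_mult_right)
    finally show "(LINT \<sigma>:{0..\<tau>}|lborel. h \<sigma> w) = cis (\<tau> * p z) * (f w * f (z - w) * osc (defect w (z - w)) \<tau>)"
      by (simp only: mult.assoc)
  qed
  also have "\<dots> = cis (\<tau> * p z) * (LINT w|lborel. f w * f (z - w) * osc (defect w (z - w)) \<tau>)"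
    by (rule integral_mult_right_zero)
  finally show ?thesis using iterate_Suc[of 2 \<tau> z] by (simp only: mult_ac)
qed

text \<open>In the third iterate the waves \<open>w\<close> and \<open>z' - w\<close> interact
  first and produce \<open>z'\<close>, which then interacts with \<open>z - z'\<close> and
  produces \<open>z\<close>. The factor \<open>fst z * fst z'\<close> comes from the two
  derivatives.\<close>

definition triple_kernel :: "real \<Rightarrow> plane \<Rightarrow> plane \<Rightarrow> plane \<Rightarrow> complex" where
  "triple_kernel t w z' z = - of_real (fst z * fst z' / (2 * pi\<^sup>2)) *
     tri (defect z' (z - z')) (defect w (z' - w)) t"

text \<open>The order of the interacting pair in the second step does not matter, which gives the
  factor 2. The free evolution is factored out, so that only phase mismatches remain.\<close>

lemma third_iterate:
  assumes t: "0 \<le> t"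
  shows "cis (- t * p z) * U 3 t z =
    (LINT z'|lborel. LINT w|lborel. f w * f (z' - w) * f (z - z') * triple_kernel t w z' z)"
proof -
  define c where "c = (\<lambda>z::plane. - (\<i> * of_real (fst z) / of_real (2 * pi)))"
  have mU: "(\<lambda>x. U n (fst x) (g (snd x))) \<in> borel_measurable (lborel \<Otimes>\<^sub>M lborel)"
    if [measurable]: "g \<in> borel_measurable borel" for n and g :: "plane \<Rightarrow> plane"
    using measurable_compose[OF _ iterate_measurable_pair, of "\<lambda>x. (fst x, g (snd x))" "lborel \<Otimes>\<^sub>M lborel"] by simp
  define h where "h = (\<lambda>\<tau> z'. cis (- \<tau> * p z) * (U 2 \<tau> z' * U 1 \<tau> (z - z')))"
  have "U 3 t z = c z * (LINT \<tau>:{0..t}|lborel. cis ((t - \<tau>) * p z) * (\<Sum>j\<in>{1..<3}. conv (U j \<tau>) (U (3 - j) \<tau>) z))"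
    unfolding c_def by (rule iterate_Suc) simp
  also have "(\<lambda>\<tau>. cis ((t - \<tau>) * p z) * (\<Sum>j\<in>{1..<3}. conv (U j \<tau>) (U (3 - j) \<tau>) z)) =
      (\<lambda>\<tau>. 2 * cis (t * p z) * (LINT z'|lborel. h \<tau> z'))"
  proof
    fix \<tau>
    have "{1..<3::nat} = {1, 2}" by auto
    then have "(\<Sum>j\<in>{1..<3}. conv (U j \<tau>) (U (3 - j) \<tau>) z) = conv (U 1 \<tau>) (U 2 \<tau>) z + conv (U 2 \<tau>) (U 1 \<tau>) z"
      by simp
    also have "\<dots> = 2 * conv (U 2 \<tau>) (U 1 \<tau>) z"
      using conv_commute[of "U 1 \<tau>" "U 2 \<tau>" z] by simp
    finally have "cis ((t - \<tau>) * p z) * (\<Sum>j\<in>{1..<3}. conv (U j \<tau>) (U (3 - j) \<tau>) z) =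
        2 * (cis ((t - \<tau>) * p z) * conv (U 2 \<tau>) (U 1 \<tau>) z)" by simp
    moreover have "cis ((t - \<tau>) * p z) = cis (t * p z) * cis (- \<tau> * p z)"
      unfolding cis_mult by (simp add: algebra_simps)
    ultimately show "cis ((t - \<tau>) * p z) * (\<Sum>j\<in>{1..<3}. conv (U j \<tau>) (U (3 - j) \<tau>) z) =
        2 * cis (t * p z) * (LINT z'|lborel. h \<tau> z')"
      by (simp only: h_def conv_def integral_mult_right_zero mult.assoc)
  qed
  also have "(LINT \<tau>:{0..t}|lborel. 2 * cis (t * p z) * (LINT z'|lborel. h \<tau> z')) =
      2 * cis (t * p z) * (LINT \<tau>:{0..t}|lborel. LINT z'|lborel. h \<tau> z')"
    by (rule set_integral_mult_right)
  also have "(LINT \<tau>:{0..t}|lborel. LINT z'|lborel. h \<tau> z') = (LINT z'|lborel. (LINT \<tau>:{0..t}|lborel. h \<tau> z'))"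
  proof (rule time_space_swap[OF t])
    show "(\<lambda>x. h (fst x) (snd x)) \<in> borel_measurable (lborel \<Otimes>\<^sub>M lborel)"
      unfolding h_def using mU[of "\<lambda>z. z"] mU[of "\<lambda>z'. z - z'"] by measurable
    show "integrable lborel (\<lambda>z'. t * A * B 2 z')" using majorant_integrable by simp
    fix \<tau> z' assume \<tau>: "0 \<le> \<tau>" "\<tau> \<le> t"
    have "norm (U 2 \<tau> z') \<le> \<tau> ^ (2 - 1) * B 2 z'" by (rule iterate_bound[OF \<tau>(1)])
    also have "\<dots> \<le> t * B 2 z'" using \<tau> majorant_nonneg by (simp add: mult_right_mono)
    finally have "norm (U 2 \<tau> z') * norm (U 1 \<tau> (z - z')) \<le> t * B 2 z' * A"
      using f_bound majorant_nonneg t unfolding iterate_1_norm by (intro mult_mono) auto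
    then show "norm (h \<tau> z') \<le> t * A * B 2 z'"
      by (simp add: h_def norm_mult mult_ac)
  qed
  also have "\<dots> = (LINT z'|lborel. c z' * (LINT w|lborel. f w * f (z' - w) * f (z - z') *
      tri (defect z' (z - z')) (defect w (z' - w)) t))"
  proof (rule Bochner_Integration.integral_cong[OF refl])
    fix z'
    define k where "k = (\<lambda>\<tau> w. f w * f (z' - w) * f (z - z') * (cis (\<tau> * defect z' (z - z')) * osc (defect w (z' - w)) \<tau>))"
    have hk: "h \<tau> z' = c z' * (LINT w|lborel. k \<tau> w)" if \<tau>: "0 \<le> \<tau>" for \<tau>
    proof -
      have e: "cis (- \<tau> * p z) * (cis (\<tau> * p z') * cis (\<tau> * p (z - z'))) = cis (\<tau> * defect z' (z - z'))"
        unfolding cis_mult defect_def by (simp add: algebra_simps)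
      have "h \<tau> z' = c z' * (cis (- \<tau> * p z) * (cis (\<tau> * p z') * cis (\<tau> * p (z - z'))) * f (z - z') *
          (LINT w|lborel. f w * f (z' - w) * osc (defect w (z' - w)) \<tau>))"
        unfolding h_def second_iterate[OF \<tau>] iterate_1 c_def by (simp only: mult_ac)
      also have "\<dots> = c z' * (LINT w|lborel. cis (\<tau> * defect z' (z - z')) * f (z - z') *
          (f w * f (z' - w) * osc (defect w (z' - w)) \<tau>))"
        unfolding e by (simp only: integral_mult_right_zero)
      also have "\<dots> = c z' * (LINT w|lborel. k \<tau> w)"
        unfolding k_def by (simp only: mult_ac)
      finally show ?thesis .
    qed
    have "(LINT \<tau>:{0..t}|lborel. h \<tau> z') = (LINT \<tau>:{0..t}|lborel. c z' * (LINT w|lborel. k \<tau> w))"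
      by (rule set_lebesgue_integral_cong) (auto simp: hk)
    also have "\<dots> = c z' * (LINT \<tau>:{0..t}|lborel. LINT w|lborel. k \<tau> w)"
      by (rule set_integral_mult_right)
    also have "(LINT \<tau>:{0..t}|lborel. LINT w|lborel. k \<tau> w) = (LINT w|lborel. (LINT \<tau>:{0..t}|lborel. k \<tau> w))"
    proof (rule time_space_swap[OF t])
      show "(\<lambda>x. k (fst x) (snd x)) \<in> borel_measurable (lborel \<Otimes>\<^sub>M lborel)"
        unfolding k_def defect_def by measurable
      show "integrable lborel (\<lambda>w. norm (f w) * A * A * t)" using f_integrable by simp
      fix \<tau> w assume \<tau>: "0 \<le> \<tau>" "\<tau> \<le> t"
      have "norm (k \<tau> w) = norm (f w) * norm (f (z' - w)) * norm (f (z - z')) * norm (osc (defect w (z' - w)) \<tau>)"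
        by (simp add: k_def norm_mult)
      also have "\<dots> \<le> norm (f w) * A * A * t"
        using f_bound A \<tau> osc_norm_le[OF \<tau>(1)] by (intro mult_mono) (auto intro: order_trans)
      finally show "norm (k \<tau> w) \<le> norm (f w) * A * A * t" .
    qed
    also have "\<dots> = (LINT w|lborel. f w * f (z' - w) * f (z - z') * tri (defect z' (z - z')) (defect w (z' - w)) t)"
      unfolding k_def tri_def set_integral_mult_right ..
    finally show "(LINT \<tau>:{0..t}|lborel. h \<tau> z') = c z' * (LINT w|lborel. f w * f (z' - w) * f (z - z') *
        tri (defect z' (z - z')) (defect w (z' - w)) t)" .
  qed
  finally have "cis (- t * p z) * U 3 t z = cis (- t * p z) * (c z * (2 * cis (t * p z) *
      (LINT z'|lborel. c z' * (LINT w|lborel. f w * f (z' - w) * f (z - z') *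
        tri (defect z' (z - z')) (defect w (z' - w)) t))))" by (simp only:)
  also have "\<dots> = (cis (- t * p z) * cis (t * p z)) * ((LINT z'|lborel. LINT w|lborel. 2 * c z * c z' * (f w * f (z' - w) * f (z - z') *
        tri (defect z' (z - z')) (defect w (z' - w)) t)))"
  proof -
    have "(LINT z'|lborel. LINT w|lborel. 2 * c z * c z' * (f w * f (z' - w) * f (z - z') *
        tri (defect z' (z - z')) (defect w (z' - w)) t)) =
      2 * c z * (LINT z'|lborel. c z' * (LINT w|lborel. f w * f (z' - w) * f (z - z') *
        tri (defect z' (z - z')) (defect w (z' - w)) t))"
      by (simp only: integral_mult_right_zero mult.assoc)
    then show ?thesis by (simp only: mult_ac)
  qed
  also have "cis (- t * p z) * cis (t * p z) = 1" by (simp add: cis_mult)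
  also have "(\<lambda>z' w. 2 * c z * c z' * (f w * f (z' - w) * f (z - z') * tri (defect z' (z - z')) (defect w (z' - w)) t)) =
      (\<lambda>z' w. f w * f (z' - w) * f (z - z') * triple_kernel t w z' z)"
  proof (intro ext)
    fix z' w
    have "2 * c z * c z' = - of_real (fst z * fst z' / (2 * pi\<^sup>2))"
      by (simp add: c_def field_simps power2_eq_square)
    then show "2 * c z * c z' * (f w * f (z' - w) * f (z - z') * tri (defect z' (z - z')) (defect w (z' - w)) t) =
      f w * f (z' - w) * f (z - z') * triple_kernel t w z' z"
      unfolding triple_kernel_def by (simp only: mult_ac)
  qed
  finally show ?thesis by (simp only: mult_1_left)
qed

end


section \<open>Lower bound for the third coefficient\<close>

abbreviation triple_lborel :: "((plane \<times> plane) \<times> plane) measure" where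
  "triple_lborel \<equiv> lborel \<Otimes>\<^sub>M lborel"

text \<open>The successive substitutions are shears, which preserve Lebesgue measure.\<close>

lemma
  fixes F1 F2 F3 :: "plane \<Rightarrow> real"
  assumes F: "integrable lborel F1" "integrable lborel F2" "integrable lborel F3"
  shows triple_product_integrable: "integrable triple_lborel
      (\<lambda>x. F1 (fst (fst x)) * F2 (snd (fst x) - fst (fst x)) * F3 (snd x - snd (fst x)))" (is "integrable ?M ?G")
    and triple_product_integral: "(LINT x|triple_lborel.
      F1 (fst (fst x)) * F2 (snd (fst x) - fst (fst x)) * F3 (snd x - snd (fst x))) =
      (LINT z|lborel. F1 z) * (LINT z|lborel. F2 z) * (LINT z|lborel. F3 z)"
proof -
  have [measurable]: "F1 \<in> borel_measurable borel" "F2 \<in> borel_measurable borel" "F3 \<in> borel_measurable borel"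
    using F by (auto simp: borel_measurable_integrable)
  have [measurable]: "(fst :: plane \<times> plane \<Rightarrow> plane) \<in> borel_measurable borel"
    "(snd :: plane \<times> plane \<Rightarrow> plane) \<in> borel_measurable borel"
    by (intro borel_measurable_continuous_onI continuous_intros)+
  define k where "k = (\<lambda>y::plane \<times> plane. F1 (fst y) * F2 (snd y - fst y))"
  have k0: "integrable (lborel \<Otimes>\<^sub>M lborel) (\<lambda>(w, z). F1 w * F2 (z - w))"
    by (rule conv_kernel_integrable[OF F(1,2)])
  then have k: "integrable lborel k"
    by (simp add: k_def lborel_prod case_prod_beta')
  have ik: "(LINT y|lborel. k y) = (LINT z|lborel. F1 z) * (LINT z|lborel. F2 z)"
    using lborel_pair.integral_fst[OF k0] integral_shift[of F2]
    by (simp add: k_def lborel_prod case_prod_beta')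
  show i: "integrable ?M ?G"
  proof (rule lborel_pair.Fubini_integrable)
    show "integrable lborel (\<lambda>y. LINT z|lborel. norm (F1 (fst (fst (y, z))) * F2 (snd (fst (y, z)) - fst (fst (y, z))) *
        F3 (snd (y, z) - snd (fst (y, z)))))"
    proof -
      have "(LINT z|lborel. norm (F1 (fst (fst (y, z))) * F2 (snd (fst (y, z)) - fst (fst (y, z))) *
        F3 (snd (y, z) - snd (fst (y, z))))) = norm (k y) * (LINT z|lborel. norm (F3 z))" for y :: "plane \<times> plane"
        using integral_shift[of "\<lambda>z. norm (F3 z)" "snd y"] by (simp add: k_def abs_mult)
      then show ?thesis using k by simp
    qed
    show "AE y in lborel. integrable lborel (\<lambda>z. F1 (fst (fst (y, z))) * F2 (snd (fst (y, z)) - fst (fst (y, z))) *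
        F3 (snd (y, z) - snd (fst (y, z))))"
      using F(3) integrable_shift[of F3] by (intro AE_I2) simp
  qed measurable
  have "integral\<^sup>L ?M ?G = (LINT y|lborel. LINT z|lborel. k y * F3 (z - snd y))"
    using lborel_pair.integral_fst[of "\<lambda>y z. k y * F3 (z - snd y)"] i
    by (simp add: k_def case_prod_beta')
  also have "\<dots> = (LINT y|lborel. k y) * (LINT z|lborel. F3 z)"
    using integral_shift[of F3] by simp
  finally show "integral\<^sup>L ?M ?G = (LINT z|lborel. F1 z) * (LINT z|lborel. F2 z) * (LINT z|lborel. F3 z)"
    by (simp add: ik)
qed

lemma integral_triple_iterated:
  fixes M :: "plane \<Rightarrow> plane \<Rightarrow> plane \<Rightarrow> complex"
  assumes M: "integrable triple_lborel
    (\<lambda>x. M (fst (fst x)) (snd (fst x)) (snd x))"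
  shows "(LINT z|lborel. LINT z'|lborel. LINT w|lborel. M w z' z) =
    (LINT x|triple_lborel. M (fst (fst x)) (snd (fst x)) (snd x))"
proof -
  let ?k = "\<lambda>(y :: plane \<times> plane) z. M (fst y) (snd y) z"
  have M': "integrable (lborel \<Otimes>\<^sub>M lborel) (case_prod ?k)"
    using M by (simp add: case_prod_beta')
  have meas: "(\<lambda>x. M (fst (fst x)) (snd (fst x)) (snd x)) \<in> borel_measurable ((borel \<Otimes>\<^sub>M borel) \<Otimes>\<^sub>M borel)"
  proof -
    have "sets triple_lborel = sets (((borel :: plane measure) \<Otimes>\<^sub>M (borel :: plane measure)) \<Otimes>\<^sub>M (borel :: plane measure))"
      by (intro sets_pair_measure_cong) (simp_all only: sets_lborel borel_prod)
    then show ?thesis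
      using borel_measurable_integrable[OF M] measurable_cong_sets[OF _ refl] by blast
  qed
  have m1: "(\<lambda>x. ((snd x, snd (fst x)), fst (fst x))) \<in> (borel \<Otimes>\<^sub>M borel) \<Otimes>\<^sub>M lborel \<rightarrow>\<^sub>M
      ((borel :: plane measure) \<Otimes>\<^sub>M (borel :: plane measure)) \<Otimes>\<^sub>M (borel :: plane measure)"
    by measurable
  have "(\<lambda>x. M (snd x) (snd (fst x)) (fst (fst x))) \<in> borel_measurable ((borel \<Otimes>\<^sub>M borel) \<Otimes>\<^sub>M lborel)"
    using measurable_compose[OF m1 meas] by simp
  then have "(\<lambda>x. LINT w|lborel. M w (snd x) (fst x)) \<in> borel_measurable (borel \<Otimes>\<^sub>M borel)"
    by (intro sigma_finite_measure.borel_measurable_lebesgue_integral[OF sigma_finite_lborel])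
       (simp add: case_prod_beta')
  then have lhs: "(\<lambda>z. LINT z'|lborel. LINT w|lborel. M w z' z) \<in> borel_measurable lborel"
    by (intro sigma_finite_measure.borel_measurable_lebesgue_integral[OF sigma_finite_lborel])
       (simp add: case_prod_beta' cong: measurable_cong_sets)
  have rhs: "(\<lambda>z. LINT y|lborel. ?k y z) \<in> borel_measurable lborel"
    using lborel_pair.integrable_snd[OF M'] by (simp add: borel_measurable_integrable)
  have "AE z in lborel. (LINT z'|lborel. LINT w|lborel. M w z' z) = (LINT y|lborel. ?k y z)"
    using lborel_pair.AE_integrable_snd[OF M']
  proof eventually_elim
    case (elim z)
    then have "integrable (lborel \<Otimes>\<^sub>M lborel) (case_prod (\<lambda>w z'. M w z' z))"
      by (simp add: lborel_prod case_prod_beta')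
    from lborel_pair.integral_snd[OF this] show ?case
      by (simp add: lborel_prod case_prod_beta')
  qed
  then have "(LINT z|lborel. LINT z'|lborel. LINT w|lborel. M w z' z) = (LINT z|lborel. LINT y|lborel. ?k y z)"
    by (rule integral_cong_AE[OF lhs rhs])
  also have "\<dots> = integral\<^sup>L (lborel \<Otimes>\<^sub>M lborel) (case_prod ?k)"
    by (rule lborel_pair.integral_snd[OF M'])
  finally show ?thesis by (simp add: case_prod_beta')
qed

text \<open>As an integral over triples of interacting waves, the tested third iterate is bounded
  below by a pointwise lower bound for its kernel. The three types of triples are distinguished by
  the position of the wave that is weighted by \<open>b\<close>.\<close>

lemma (in fourier_data) third_coefficient_lower_bound:
  fixes a b :: "plane \<Rightarrow> real"
  assumes t: "0 \<le> t" and [measurable]: "E \<in> sets borel"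
    and a: "integrable lborel a" "(LINT z|lborel. a z) = S" and b: "integrable lborel b" "(LINT z|lborel. b z) = S"
    and le: "\<And>x1 x2 x3. \<kappa>1 * (a x1 * a x2 * b x3) - \<kappa>2 * (a x1 * b x2 * a x3) - \<kappa>2 * (b x1 * a x2 * a x3) \<le>
      - Im (indicator E (x1 + x2 + x3) *\<^sub>R (f x1 * f x2 * f x3 * triple_kernel t x1 (x1 + x2) (x1 + x2 + x3)))"
  shows "(\<kappa>1 - 2 * \<kappa>2) * S ^ 3 \<le> norm (LINT z|lborel. indicator E z * cis (- t * p z) * U 3 t z)"
proof -
  define M where "M = (\<lambda>w z' z. indicator E z *\<^sub>R (f w * f (z' - w) * f (z - z') * triple_kernel t w z' z))"
  let ?P = triple_lborel
  have [measurable]: "(fst :: plane \<times> plane \<Rightarrow> plane) \<in> borel_measurable borel"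
    "(snd :: plane \<times> plane \<Rightarrow> plane) \<in> borel_measurable borel"
    by (intro borel_measurable_continuous_onI continuous_intros)+
  \<comment> \<open>Where the product of the three data values is nonzero, \<open>z'\<close> and \<open>z\<close> are sums of two and of three frequencies of size at most \<open>R\<close>.\<close>
  define C where "C = 3 * R * (2 * R) / (2 * pi\<^sup>2) * (t * t)"
  have Mb: "norm (M w z' z) \<le> C * (norm (f w) * norm (f (z' - w)) * norm (f (z - z')))" for w z' z
  proof (cases "f w * f (z' - w) * f (z - z') = 0")
    case True
    then show ?thesis by (auto simp: M_def)
  next
    case False
    then have "\<bar>fst w\<bar> \<le> R" "\<bar>fst (z' - w)\<bar> \<le> R" "\<bar>fst (z - z')\<bar> \<le> R"
      using f_support[of w] f_support[of "z' - w"] f_support[of "z - z'"] by simp_all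
    then have "\<bar>fst z'\<bar> \<le> 2 * R" "\<bar>fst z\<bar> \<le> 3 * R" by auto
    then have "\<bar>fst z\<bar> * \<bar>fst z'\<bar> / (2 * pi\<^sup>2) \<le> 3 * R * (2 * R) / (2 * pi\<^sup>2)"
      using R by (intro divide_right_mono mult_mono) auto
    then have K: "norm (triple_kernel t w z' z) \<le> C"
      unfolding C_def triple_kernel_def norm_mult norm_minus_cancel
      by (intro mult_mono tri_norm_le[OF t]) (auto simp: norm_divide norm_mult norm_power abs_mult)
    have "norm (M w z' z) \<le> norm (f w) * norm (f (z' - w)) * norm (f (z - z')) * norm (triple_kernel t w z' z)"
      by (simp add: M_def norm_mult indicator_def)
    also have "\<dots> \<le> norm (f w) * norm (f (z' - w)) * norm (f (z - z')) * C"
      using K by (intro mult_left_mono) auto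
    finally show ?thesis by (simp only: mult_ac)
  qed
  have Mm: "(\<lambda>x. M (fst (fst x)) (snd (fst x)) (snd x)) \<in> borel_measurable ?P"
    unfolding M_def triple_kernel_def defect_def by measurable
  have Mi: "integrable ?P (\<lambda>x. M (fst (fst x)) (snd (fst x)) (snd x))"
  proof (rule Bochner_Integration.integrable_bound[OF _ Mm])
    show "integrable ?P (\<lambda>x. C * (norm (f (fst (fst x))) * norm (f (snd (fst x) - fst (fst x))) * norm (f (snd x - snd (fst x)))))"
      by (intro integrable_mult_right triple_product_integrable norm_f_integrable)
    show "AE x in ?P. norm (M (fst (fst x)) (snd (fst x)) (snd x)) \<le>
        norm (C * (norm (f (fst (fst x))) * norm (f (snd (fst x) - fst (fst x))) * norm (f (snd x - snd (fst x)))))"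
      by (intro AE_I2 order_trans[OF Mb]) simp
  qed
  define Tr :: "(plane \<Rightarrow> real) \<Rightarrow> (plane \<Rightarrow> real) \<Rightarrow> (plane \<Rightarrow> real) \<Rightarrow> (plane \<times> plane) \<times> plane \<Rightarrow> real"
    where "Tr = (\<lambda>F1 F2 F3 x. F1 (fst (fst x)) * F2 (snd (fst x) - fst (fst x)) * F3 (snd x - snd (fst x)))"
  have Tri: "integrable ?P (Tr F1 F2 F3)" "integral\<^sup>L ?P (Tr F1 F2 F3) = S ^ 3"
    if "F1 = a \<or> F1 = b" "F2 = a \<or> F2 = b" "F3 = a \<or> F3 = b" for F1 F2 F3
  proof -
    have i: "integrable lborel F" "(LINT z|lborel. F z) = S" if "F = a \<or> F = b" for F
      using that a b by auto
    show "integrable ?P (Tr F1 F2 F3)"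
      unfolding Tr_def by (intro triple_product_integrable i that)
    show "integral\<^sup>L ?P (Tr F1 F2 F3) = S ^ 3"
      unfolding Tr_def triple_product_integral[OF i(1)[OF that(1)] i(1)[OF that(2)] i(1)[OF that(3)]]
        i(2)[OF that(1)] i(2)[OF that(2)] i(2)[OF that(3)] by (simp add: power3_eq_cube)
  qed
  have "(\<kappa>1 - 2 * \<kappa>2) * S ^ 3 = (LINT x|?P. \<kappa>1 * Tr a a b x - \<kappa>2 * Tr a b a x - \<kappa>2 * Tr b a a x)"
    using Tri by (simp add: algebra_simps)
  also have "\<dots> \<le> (LINT x|?P. - Im (M (fst (fst x)) (snd (fst x)) (snd x)))"
  proof (rule integral_mono)
    show "integrable ?P (\<lambda>x. \<kappa>1 * Tr a a b x - \<kappa>2 * Tr a b a x - \<kappa>2 * Tr b a a x)"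
      using Tri by simp
    show "integrable ?P (\<lambda>x. - Im (M (fst (fst x)) (snd (fst x)) (snd x)))"
      using Mi by simp
    show "\<kappa>1 * Tr a a b x - \<kappa>2 * Tr a b a x - \<kappa>2 * Tr b a a x \<le> - Im (M (fst (fst x)) (snd (fst x)) (snd x))" for x
      using le[of "fst (fst x)" "snd (fst x) - fst (fst x)" "snd x - snd (fst x)"] by (simp add: Tr_def M_def)
  qed
  also have "\<dots> = - Im (LINT x|?P. M (fst (fst x)) (snd (fst x)) (snd x))"
    using integral_Im[OF Mi] by simp
  also have "(LINT x|?P. M (fst (fst x)) (snd (fst x)) (snd x)) = (LINT z|lborel. indicator E z * cis (- t * p z) * U 3 t z)"
    unfolding integral_triple_iterated[OF Mi, symmetric]
  proof (rule Bochner_Integration.integral_cong[OF refl])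
    fix z
    have "(LINT z'|lborel. LINT w|lborel. M w z' z) =
        indicator E z *\<^sub>R (LINT z'|lborel. LINT w|lborel. f w * f (z' - w) * f (z - z') * triple_kernel t w z' z)"
      unfolding M_def by simp
    also have "\<dots> = indicator E z * cis (- t * p z) * U 3 t z"
      unfolding third_iterate[OF t, symmetric] by (simp add: indicator_def)
    finally show "(LINT z'|lborel. LINT w|lborel. M w z' z) = indicator E z * cis (- t * p z) * U 3 t z" .
  qed
  also have "- Im (LINT z|lborel. indicator E z * cis (- t * p z) * U 3 t z) \<le>
      norm (LINT z|lborel. indicator E z * cis (- t * p z) * U 3 t z)"
    using abs_Im_le_cmod[of "LINT z|lborel. indicator E z * cis (- t * p z) * U 3 t z"] by linarith
  finally show ?thesis .
qed

text \<open>The numerator of the phase mismatch; it is a sum of terms of one sign when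
  \<open>b\<close> and \<open>\<gamma>\<close> are positive.\<close>

definition resonance :: "real \<Rightarrow> real \<Rightarrow> plane \<Rightarrow> plane \<Rightarrow> real" where
  "resonance b \<gamma> z1 z2 = 3 * b * (fst z1 * fst z2 * (fst z1 + fst z2))\<^sup>2 +
     (snd z1 * fst z2 - snd z2 * fst z1)\<^sup>2 + \<gamma> * ((fst z1)\<^sup>2 + fst z1 * fst z2 + (fst z2)\<^sup>2)"

text \<open>The cubic, the quadratic and the constant part of the symbol are treated separately;
  each contributes one term with the common denominator.\<close>

lemma symb_defect:
  assumes "fst z1 \<noteq> 0" "fst z2 \<noteq> 0" "fst z1 + fst z2 \<noteq> 0"
  shows "symb \<beta> \<gamma> z1 + symb \<beta> \<gamma> z2 - symb \<beta> \<gamma> (z1 + z2) =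
    - resonance (- \<beta>) \<gamma> z1 z2 / (fst z1 * fst z2 * (fst z1 + fst z2))"
proof -
  obtain x1 y1 x2 y2 where z: "z1 = (x1, y1)" "z2 = (x2, y2)" by (cases z1, cases z2) auto
  have nz: "x1 \<noteq> 0" "x2 \<noteq> 0" "x1 + x2 \<noteq> 0" using assms by (auto simp: z)
  have g: "\<gamma> / x1 + \<gamma> / x2 - \<gamma> / (x1 + x2) = \<gamma> * (x1\<^sup>2 + x1 * x2 + x2\<^sup>2) / (x1 * x2 * (x1 + x2))"
    using nz by (simp add: divide_simps) (simp add: algebra_simps power2_eq_square)
  have e: "y1\<^sup>2 / x1 + y2\<^sup>2 / x2 - (y1 + y2)\<^sup>2 / (x1 + x2) = (y1 * x2 - y2 * x1)\<^sup>2 / (x1 * x2 * (x1 + x2))"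
    using nz by (simp add: divide_simps) (simp add: algebra_simps power2_eq_square)
  have c: "- \<beta> * x1 ^ 3 - \<beta> * x2 ^ 3 + \<beta> * (x1 + x2) ^ 3 = - (3 * (- \<beta>) * (x1 * x2 * (x1 + x2))\<^sup>2 / (x1 * x2 * (x1 + x2)))"
  proof -
    have "(x1 * x2 * (x1 + x2))\<^sup>2 / (x1 * x2 * (x1 + x2)) = x1 * x2 * (x1 + x2)"
      using nz by (simp add: power2_eq_square)
    then have "3 * (- \<beta>) * (x1 * x2 * (x1 + x2))\<^sup>2 / (x1 * x2 * (x1 + x2)) = 3 * (- \<beta>) * (x1 * x2 * (x1 + x2))"
      by (simp only: times_divide_eq_right[symmetric])
    then show ?thesis by (simp only:) (simp add: algebra_simps power3_eq_cube)
  qed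
  have "symb \<beta> \<gamma> z1 + symb \<beta> \<gamma> z2 - symb \<beta> \<gamma> (z1 + z2) =
      (- \<beta> * x1 ^ 3 - \<beta> * x2 ^ 3 + \<beta> * (x1 + x2) ^ 3) -
      (y1\<^sup>2 / x1 + y2\<^sup>2 / x2 - (y1 + y2)\<^sup>2 / (x1 + x2)) - (\<gamma> / x1 + \<gamma> / x2 - \<gamma> / (x1 + x2))"
    by (simp add: symb_def z add_divide_distrib)
  also have "\<dots> = - resonance (- \<beta>) \<gamma> z1 z2 / (fst z1 * fst z2 * (fst z1 + fst z2))"
    unfolding g e c by (simp add: resonance_def z add_divide_distrib diff_divide_distrib)
  finally show ?thesis .
qed

lemma sum_of_squares_form_nonneg: "0 \<le> x\<^sup>2 + x * y + (y::real)\<^sup>2"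
proof -
  have "x\<^sup>2 + x * y + y\<^sup>2 = (x + y / 2)\<^sup>2 + 3 / 4 * y\<^sup>2" by (simp add: power2_eq_square algebra_simps)
  then show ?thesis by (metis add_nonneg_nonneg mult_nonneg_nonneg zero_le_power2 zero_le_divide_iff zero_le_numeral)
qed

text \<open>Two waves near \<open>N\<close>: the numerator is of order \<open>N\<^sup>6\<close>
  and the denominator \<open>P\<close> of order \<open>N\<^sup>3\<close>.\<close>

lemma high_resonance:
  assumes b: "0 < b" and \<gamma>: "0 < \<gamma>" and N: "1 \<le> N" and H: "H\<^sup>2 \<le> N"
    and x: "N \<le> x1" "x1 \<le> 2 * N" "N \<le> x2" "x2 \<le> 2 * N" and y: "0 \<le> y1" "y1 \<le> H" "0 \<le> y2" "y2 \<le> H"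
  defines "P \<equiv> x1 * x2 * (x1 + x2)" and "D \<equiv> resonance b \<gamma> (x1, y1) (x2, y2)"
  shows "6 * b * N ^ 3 \<le> D / P" and "4 / ((768 * b + 4 + 12 * \<gamma>) * N\<^sup>2) \<le> (x1 + x2) * P / D"
proof -
  have N0: "0 < N" using N by simp
  have x0: "0 < x1" "0 < x2" using x N by auto
  have P: "2 * N ^ 3 \<le> P"
  proof -
    have "N * N * (N + N) \<le> x1 * x2 * (x1 + x2)" using x N by (intro mult_mono add_mono) auto
    then show ?thesis by (simp add: P_def power3_eq_cube)
  qed
  have P0: "0 < P" using x0 by (simp add: P_def)
  have D: "D = 3 * b * P\<^sup>2 + (y1 * x2 - y2 * x1)\<^sup>2 + \<gamma> * (x1\<^sup>2 + x1 * x2 + x2\<^sup>2)"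
    by (simp add: D_def resonance_def P_def)
  have DP: "3 * b * P\<^sup>2 \<le> D"
    unfolding D using \<gamma> sum_of_squares_form_nonneg[of x1 x2] by simp
  have D0: "0 < D" using DP b P0 by (intro less_le_trans[OF _ DP]) simp
  have "6 * b * N ^ 3 = 3 * b * (2 * N ^ 3)" by simp
  also have "\<dots> \<le> 3 * b * P" using P b by (intro mult_left_mono) auto
  also have "\<dots> = 3 * b * P\<^sup>2 / P" using P0 by (simp add: power2_eq_square)
  also have "\<dots> \<le> D / P" using DP P0 by (intro divide_right_mono) auto
  finally show "6 * b * N ^ 3 \<le> D / P" .
  have "D \<le> (768 * b + 4 + 12 * \<gamma>) * N ^ 6"
  proof -
    have "P \<le> (2 * N) * (2 * N) * (2 * N + 2 * N)"
      unfolding P_def using x x0 N0 by (intro mult_mono add_mono) auto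
    then have "P \<le> 16 * N ^ 3" by (simp add: power3_eq_cube)
    then have "P\<^sup>2 \<le> (16 * N ^ 3)\<^sup>2" using P0 by (intro power_mono) auto
    then have 1: "3 * b * P\<^sup>2 \<le> 768 * b * N ^ 6" using b by (simp add: power_mult_distrib)
    have N6: "N ^ 2 \<le> N ^ 6" "N ^ 3 \<le> N ^ 6" using N by (auto intro: power_increasing)
    have "\<bar>y1 * x2 - y2 * x1\<bar> \<le> H * (2 * N)"
    proof -
      have "0 \<le> y1 * x2" "0 \<le> y2 * x1" using y x0 by auto
      moreover have "y1 * x2 \<le> H * (2 * N)" "y2 * x1 \<le> H * (2 * N)"
        using y x x0 by (auto intro!: mult_mono)
      ultimately show ?thesis by linarith
    qed
    then have "(y1 * x2 - y2 * x1)\<^sup>2 \<le> (H * (2 * N))\<^sup>2"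
      using y N0 by (subst abs_le_square_iff[symmetric]) auto
    also have "\<dots> = 4 * N\<^sup>2 * H\<^sup>2" by (simp add: power_mult_distrib)
    also have "\<dots> \<le> 4 * N\<^sup>2 * N" using H by (intro mult_left_mono) auto
    also have "\<dots> = 4 * N ^ 3" by (simp add: power2_eq_square power3_eq_cube)
    finally have 2: "(y1 * x2 - y2 * x1)\<^sup>2 \<le> 4 * N ^ 6" using N6 by simp
    have "x1\<^sup>2 \<le> (2 * N)\<^sup>2" "x2\<^sup>2 \<le> (2 * N)\<^sup>2" "x1 * x2 \<le> (2 * N) * (2 * N)"
      using x x0 N0 by (intro power_mono mult_mono; simp)+
    then have "x1\<^sup>2 + x1 * x2 + x2\<^sup>2 \<le> 12 * N ^ 2" by (simp add: power2_eq_square)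
    then have "\<gamma> * (x1\<^sup>2 + x1 * x2 + x2\<^sup>2) \<le> \<gamma> * (12 * N ^ 6)"
      using \<gamma> N6 by (intro mult_left_mono) auto
    with 1 2 show ?thesis unfolding D by (simp add: algebra_simps)
  qed
  moreover have "4 * N ^ 4 \<le> (x1 + x2) * P"
  proof -
    have "(N + N) * (2 * N ^ 3) \<le> (x1 + x2) * P" using P x N0 x0 by (intro mult_mono add_mono) auto
    then show ?thesis by (simp add: power3_eq_cube power4_eq_xxxx)
  qed
  ultimately have "4 * N ^ 4 / ((768 * b + 4 + 12 * \<gamma>) * N ^ 6) \<le> (x1 + x2) * P / D"
    using D0 b \<gamma> N0 x0 P0 by (intro frac_le) auto
  moreover have "4 * N ^ 4 / ((768 * b + 4 + 12 * \<gamma>) * N ^ 6) = 4 / ((768 * b + 4 + 12 * \<gamma>) * N\<^sup>2)"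
    using N0 by (simp add: divide_simps)
  ultimately show "4 / ((768 * b + 4 + 12 * \<gamma>) * N\<^sup>2) \<le> (x1 + x2) * P / D" by simp
qed

text \<open>Two waves near \<open>N\<close> and \<open>- N\<close>: of the numerator only the
  square \<open>(y\<^sub>1 x\<^sub>2 - y\<^sub>2 x\<^sub>1)\<^sup>2\<close> is kept. It is at
  least \<open>(N H)\<^sup>2\<close> because the terms \<open>- y\<^sub>1 x\<^sub>2\<close> and
  \<open>y\<^sub>2 x\<^sub>1\<close> have the same sign.\<close>

lemma low_resonance:
  assumes b: "0 < b" and \<gamma>: "0 < \<gamma>" and N: "1 \<le> N" and H: "0 < H" and w: "0 < w" "w \<le> N"
    and x: "N \<le> x1" "x1 \<le> N + w" "- N - w \<le> x2" "x2 \<le> - N" and y: "0 \<le> y1" "H \<le> y2"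
  defines "P \<equiv> x1 * x2 * (x1 + x2)" and "D \<equiv> resonance b \<gamma> (x1, y1) (x2, y2)"
  shows "0 < D" and "\<bar>(x1 + x2) * P / D\<bar> \<le> 4 * w\<^sup>2 / H\<^sup>2"
proof -
  have "H * N \<le> y2 * x1" using x y N H by (intro mult_mono) auto
  moreover have "0 \<le> y1 * (- x2)" using x y N by (intro mult_nonneg_nonneg) auto
  ultimately have "N * H \<le> y2 * x1 - y1 * x2" by (simp add: mult.commute)
  then have "(N * H)\<^sup>2 \<le> (y2 * x1 - y1 * x2)\<^sup>2"
    using N H by (intro power_mono) auto
  also have "\<dots> = (y1 * x2 - y2 * x1)\<^sup>2" by (simp add: power2_commute)
  also have "\<dots> \<le> D"
    unfolding D_def resonance_def using b \<gamma> sum_of_squares_form_nonneg[of x1 x2] by simp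
  finally have D: "(N * H)\<^sup>2 \<le> D" .
  have NH: "0 < (N * H)\<^sup>2" using N H by simp
  with D show D0: "0 < D" by linarith
  have "\<bar>(x1 + x2) * P\<bar> = \<bar>x1 + x2\<bar>\<^sup>2 * (\<bar>x1\<bar> * \<bar>x2\<bar>)"
    by (simp add: P_def abs_mult power2_eq_square)
  also have "\<dots> \<le> w\<^sup>2 * ((2 * N) * (2 * N))"
  proof -
    have "\<bar>x1 + x2\<bar> \<le> w" "\<bar>x1\<bar> \<le> 2 * N" "\<bar>x2\<bar> \<le> 2 * N" using x w N by auto
    then show ?thesis by (intro mult_mono power_mono mult_nonneg_nonneg abs_ge_zero) auto
  qed
  finally have "\<bar>(x1 + x2) * P\<bar> / D \<le> w\<^sup>2 * ((2 * N) * (2 * N)) / (N * H)\<^sup>2"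
    using D NH by (intro frac_le) auto
  also have "\<dots> = 4 * w\<^sup>2 / H\<^sup>2" using N H by (simp add: field_simps power2_eq_square)
  finally show "\<bar>(x1 + x2) * P / D\<bar> \<le> 4 * w\<^sup>2 / H\<^sup>2" using D0 by (simp add: abs_divide)
qed

text \<open>The cubic part is three times \<open>(x\<^sub>1 + x\<^sub>2) (x\<^sub>2 + x\<^sub>3)
  (x\<^sub>1 + x\<^sub>3)\<close>, in which two factors are at most \<open>w\<close> in size; the
  remaining parts are small one by one.\<close>

lemma symb_triple_defect:
  assumes b: "\<beta> < 0" and \<gamma>: "0 < \<gamma>" and N: "1 \<le> N" and H: "0 < H" and w: "0 < w" "2 * w \<le> N"
    and x: "N \<le> x1" "x1 \<le> N + w" "N \<le> x2" "x2 \<le> N + w" "- N - w \<le> x3" "x3 \<le> - N"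
    and y: "0 \<le> y1" "y1 \<le> H" "0 \<le> y2" "y2 \<le> H" "H \<le> y3" "y3 \<le> 2 * H"
  shows "\<bar>symb \<beta> \<gamma> (x1, y1) + symb \<beta> \<gamma> (x2, y2) + symb \<beta> \<gamma> (x3, y3) - symb \<beta> \<gamma> (x1 + x2 + x3, y1 + y2 + y3)\<bar>
    \<le> 12 * (- \<beta>) * (N * w\<^sup>2) + 44 * (H\<^sup>2 / N) + 5 * \<gamma> / N"
proof -
  define x4 where "x4 = x1 + x2 + x3"
  define y4 where "y4 = y1 + y2 + y3"
  define q where "q = (\<lambda>x y :: real. (y\<^sup>2 + \<gamma>) / x)"
  have N0: "0 < N" using N by simp
  have small: "\<bar>q x y\<bar> \<le> (4 * H\<^sup>2 + \<gamma>) / N" if "N \<le> \<bar>x\<bar>" "0 \<le> y" "y \<le> 2 * H" for x y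
  proof -
    have "y\<^sup>2 \<le> (2 * H)\<^sup>2" using that by (intro power_mono) auto
    then have "(y\<^sup>2 + \<gamma>) / \<bar>x\<bar> \<le> (4 * H\<^sup>2 + \<gamma>) / N"
      using that N0 \<gamma> by (intro frac_le) (auto simp: power_mult_distrib)
    then show ?thesis using \<gamma> by (simp add: q_def abs_divide)
  qed
  have q4: "\<bar>q x4 y4\<bar> \<le> (16 * H\<^sup>2 + \<gamma>) / (N / 2)"
  proof -
    have "y4\<^sup>2 \<le> (4 * H)\<^sup>2" using y H by (intro power_mono) (auto simp: y4_def)
    moreover have "N / 2 \<le> \<bar>x4\<bar>" using x w by (auto simp: x4_def)
    ultimately have "(y4\<^sup>2 + \<gamma>) / \<bar>x4\<bar> \<le> (16 * H\<^sup>2 + \<gamma>) / (N / 2)"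
      using N0 \<gamma> by (intro frac_le) (auto simp: power_mult_distrib)
    then show ?thesis using \<gamma> by (simp add: q_def abs_divide)
  qed
  have "symb \<beta> \<gamma> (x1, y1) + symb \<beta> \<gamma> (x2, y2) + symb \<beta> \<gamma> (x3, y3) - symb \<beta> \<gamma> (x4, y4) =
      - \<beta> * (x1 ^ 3 + x2 ^ 3 + x3 ^ 3 - x4 ^ 3) - q x1 y1 - q x2 y2 - q x3 y3 + q x4 y4"
    by (simp add: symb_def q_def algebra_simps)
  also have "x1 ^ 3 + x2 ^ 3 + x3 ^ 3 - x4 ^ 3 = - (3 * ((x1 + x2) * ((x2 + x3) * (x1 + x3))))"
    by (simp add: x4_def power3_eq_cube algebra_simps)
  finally have eq: "symb \<beta> \<gamma> (x1, y1) + symb \<beta> \<gamma> (x2, y2) + symb \<beta> \<gamma> (x3, y3) - symb \<beta> \<gamma> (x4, y4) =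
      3 * \<beta> * ((x1 + x2) * ((x2 + x3) * (x1 + x3))) - q x1 y1 - q x2 y2 - q x3 y3 + q x4 y4" by simp
  have "\<bar>(x1 + x2) * ((x2 + x3) * (x1 + x3))\<bar> = \<bar>x1 + x2\<bar> * (\<bar>x2 + x3\<bar> * \<bar>x1 + x3\<bar>)" by (simp add: abs_mult)
  also have "\<dots> \<le> (4 * N) * (w * w)" using x w by (intro mult_mono) auto
  finally have "(- 3 * \<beta>) * \<bar>(x1 + x2) * ((x2 + x3) * (x1 + x3))\<bar> \<le> (- 3 * \<beta>) * (4 * N * (w * w))"
    using b by (intro mult_left_mono) auto
  then have cub: "\<bar>3 * \<beta> * ((x1 + x2) * ((x2 + x3) * (x1 + x3)))\<bar> \<le> 12 * (- \<beta>) * (N * w\<^sup>2)"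
    using b by (simp add: abs_mult power2_eq_square)
  have "\<bar>q x1 y1\<bar> \<le> (4 * H\<^sup>2 + \<gamma>) / N" "\<bar>q x2 y2\<bar> \<le> (4 * H\<^sup>2 + \<gamma>) / N" "\<bar>q x3 y3\<bar> \<le> (4 * H\<^sup>2 + \<gamma>) / N"
    using x y H N0 by (auto intro!: small)
  then have "\<bar>q x1 y1\<bar> + \<bar>q x2 y2\<bar> + \<bar>q x3 y3\<bar> + \<bar>q x4 y4\<bar> \<le> 3 * ((4 * H\<^sup>2 + \<gamma>) / N) + (16 * H\<^sup>2 + \<gamma>) / (N / 2)"
    using q4 by linarith
  also have "\<dots> = 44 * (H\<^sup>2 / N) + 5 * \<gamma> / N" using N0 by (simp add: field_simps)
  finally show ?thesis using cub unfolding x4_def[symmetric] y4_def[symmetric] eq by linarith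
qed

text \<open>The integrand stays in the sector where the cosine is at least \<open>1 / 2\<close>,
  since \<open>1 \<le> \<pi> / 3\<close>.\<close>

lemma Re_osc_lower_bound:
  assumes t: "0 \<le> t" and \<Omega>: "\<bar>\<Omega>\<bar> * t \<le> 1"
  shows "t / 2 \<le> Re (osc \<Omega> t)"
proof -
  have i: "integrable lborel (\<lambda>\<sigma>. indicator {0..t} \<sigma> *\<^sub>R cis (\<sigma> * \<Omega>))"
    using osc_integral(1)[OF t] by (simp add: set_integrable_def)
  have c: "1 / 2 \<le> cos (\<sigma> * \<Omega>)" if "0 \<le> \<sigma>" "\<sigma> \<le> t" for \<sigma>
  proof -
    have "\<bar>\<sigma> * \<Omega>\<bar> \<le> t * \<bar>\<Omega>\<bar>" using that by (simp add: abs_mult mult_right_mono)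
    then have "\<bar>\<sigma> * \<Omega>\<bar> \<le> pi / 3" using \<Omega> pi_gt3 by (simp add: mult.commute)
    then have "cos (pi / 3) \<le> cos \<bar>\<sigma> * \<Omega>\<bar>" by (intro cos_monotone_0_pi_le) auto
    then show ?thesis by (simp add: cos_60)
  qed
  have ii: "integrable lborel (indicat_real {0..t})"
    using power_time_integrable[OF t, of 0 1] by (simp add: set_integrable_def)
  have "t / 2 = (LINT \<sigma>|lborel. indicator {0..t} \<sigma> * (1 / 2))" using t by simp
  also have "\<dots> \<le> (LINT \<sigma>|lborel. Re (indicator {0..t} \<sigma> *\<^sub>R cis (\<sigma> * \<Omega>)))"
  proof (rule integral_mono)
    show "integrable lborel (\<lambda>\<sigma>. indicat_real {0..t} \<sigma> * (1 / 2))" using ii by (rule integrable_mult_left)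
    show "integrable lborel (\<lambda>\<sigma>. Re (indicator {0..t} \<sigma> *\<^sub>R cis (\<sigma> * \<Omega>)))" using i by (rule integrable_Re)
    show "indicat_real {0..t} \<sigma> * (1 / 2) \<le> Re (indicator {0..t} \<sigma> *\<^sub>R cis (\<sigma> * \<Omega>))" for \<sigma>
      using c[of \<sigma>] by (simp add: indicator_def)
  qed
  also have "\<dots> = Re (osc \<Omega> t)"
    using integral_Re[OF i] osc_integral(2)[OF t] by (simp add: set_lebesgue_integral_def)
  finally show ?thesis .
qed


section \<open>Data concentrated on two boxes\<close>

lemma mem_plane_box: "z \<in> cbox (a, c) (b, d) \<longleftrightarrow> a \<le> fst z \<and> fst z \<le> b \<and> c \<le> snd z \<and> snd z \<le> (d::real)"
  for a b :: real
  by (cases z) (auto simp: cbox_Pair_eq)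

lemma
  fixes a b c d :: real
  assumes "a \<le> b" "c \<le> d"
  shows integrable_indicator_plane_box: "integrable lborel (indicat_real (cbox (a, c) (b, d)))"
    and integral_indicator_plane_box: "(LINT z|lborel. indicat_real (cbox (a, c) (b, d)) z) = (b - a) * (d - c)"
proof -
  show "integrable lborel (indicat_real (cbox (a, c) (b, d)))"
    by (rule integrable_real_indicator) (simp_all add: emeasure_lborel_cbox_finite[unfolded infinity_ennreal_def])
  show "(LINT z|lborel. indicat_real (cbox (a, c) (b, d)) z) = (b - a) * (d - c)"
    using assms by (simp add: content_Pair)
qed

text \<open>Width \<open>w\<close> and height \<open>H\<close> of the boxes. The inequality
  \<open>coherent\<close> keeps the total phase of a resonant triple below 1 up to the time
  \<open>t\<close>, \<open>large\<close> makes the rapidly oscillating part negligible, and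
  \<open>flat\<close> makes the boxes so narrow compared with their height that the interactions
  of opposite frequencies are dominated.\<close>

locale resonant_data =
  fixes \<beta> \<gamma> t w H N :: real
  assumes \<beta>: "\<beta> < 0" and \<gamma>: "0 < \<gamma>" and t: "0 < t" and N: "1 \<le> N" and w: "0 < w" "2 * w \<le> N"
    and H: "0 < H" "H\<^sup>2 \<le> N"
    and coherent: "12 * (- \<beta>) * (N * w\<^sup>2) + 44 * (H\<^sup>2 / N) + 5 * \<gamma> / N \<le> 1 / t"
    and large: "9 / t \<le> 6 * (- \<beta>) * N ^ 3"
    and flat: "192 * (768 * (- \<beta>) + 4 + 12 * \<gamma>) * (N * w)\<^sup>2 \<le> H\<^sup>2"
begin

definition "box_plus = cbox (N, 0) (N + w, H)"
definition "box_minus = cbox (- N - w, H) (- N, 2 * H)"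
text \<open>The sums of two points of \<open>box_plus\<close> and one point of
  \<open>box_minus\<close> lie in this box.\<close>

definition "box_out = cbox (N - w, H) (N + 2 * w, 4 * H)"

definition profile :: "plane \<Rightarrow> complex" where
  "profile z = of_real (indicator box_plus z + indicator box_minus z)"

definition "D0 = 768 * (- \<beta>) + 4 + 12 * \<gamma>"
definition "\<kappa>1 = t / (4 * pi\<^sup>2 * D0 * N)"
definition "\<kappa>2 = 12 * N * t * (w\<^sup>2 / H\<^sup>2) / pi\<^sup>2"

lemma D0: "4 \<le> D0"
  using \<beta> \<gamma> by (simp add: D0_def)

lemma box_sets [measurable]: "box_plus \<in> sets borel" "box_minus \<in> sets borel" "box_out \<in> sets borel"
  by (simp_all add: box_plus_def box_minus_def box_out_def)

lemma
  shows box_plus_integrable: "integrable lborel (indicat_real box_plus)"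
    and box_minus_integrable: "integrable lborel (indicat_real box_minus)"
    and box_out_integrable: "integrable lborel (indicat_real box_out)"
    and box_plus_integral: "(LINT z|lborel. indicat_real box_plus z) = w * H"
    and box_minus_integral: "(LINT z|lborel. indicat_real box_minus z) = w * H"
    and box_out_integral: "(LINT z|lborel. indicat_real box_out z) = 9 * (w * H)"
  unfolding box_plus_def box_minus_def box_out_def
  by (intro integrable_indicator_plane_box; use w H in simp)+
     (subst integral_indicator_plane_box; use w H in \<open>simp add: algebra_simps\<close>)+

lemma boxes_disjoint: "z \<in> box_plus \<Longrightarrow> z \<notin> box_minus"
  using N by (auto simp: box_plus_def box_minus_def mem_plane_box)

lemma norm_profile: "norm (profile z) = indicator box_plus z + indicator box_minus z"
  by (simp add: profile_def flip: of_real_add)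

lemma norm_profile_square: "(norm (profile z))\<^sup>2 = indicator box_plus z + indicator box_minus z"
  using boxes_disjoint[of z] by (auto simp: norm_profile indicator_def)

sublocale fourier_data "symb \<beta> \<gamma>" profile "N + w + 2 * H" "2 + 2 * (w * H)"
proof
  show "profile \<in> borel_measurable borel" unfolding profile_def by measurable
  show "norm (profile z) \<le> 2 + 2 * (w * H)" for z
  proof -
    have "norm (profile z) \<le> 1 + 1" unfolding norm_profile by (intro add_mono) auto
    moreover have "0 \<le> w * H" using w H by simp
    ultimately show ?thesis by linarith
  qed
  show "integrable lborel profile"
    unfolding profile_def using box_plus_integrable box_minus_integrable by simp
  show "(LINT z|lborel. norm (profile z)) \<le> 2 + 2 * (w * H)"
    unfolding norm_profile using box_plus_integrable box_minus_integrable
    by (simp add: box_plus_integral[simplified] box_minus_integral[simplified])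
  show "profile z \<noteq> 0 \<Longrightarrow> \<bar>fst z\<bar> \<le> N + w + 2 * H \<and> \<bar>snd z\<bar> \<le> N + w + 2 * H" for z
  proof -
    assume "profile z \<noteq> 0"
    then have "z \<in> box_plus \<or> z \<in> box_minus" by (auto simp: profile_def indicator_def)
    then show "\<bar>fst z\<bar> \<le> N + w + 2 * H \<and> \<bar>snd z\<bar> \<le> N + w + 2 * H"
      using N w H by (auto simp: box_plus_def box_minus_def mem_plane_box)
  qed
  show "0 < N + w + 2 * H" using N w H by simp
  show "0 < 2 + 2 * (w * H)" using w H by (simp add: add_pos_pos)
qed measurable

lemma triple_kernel_sum:
  "triple_kernel t x1 (x1 + x2) (x1 + x2 + x3) =
    - of_real (fst (x1 + x2 + x3) * fst (x1 + x2) / (2 * pi\<^sup>2)) * tri (defect (x1 + x2) x3) (defect x1 x2) t"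
  by (simp add: triple_kernel_def)

text \<open>By \<open>tri_eq\<close> the kernel is \<open>\<i> \<xi> / (2 \<pi>\<^sup>2)\<close>
  times \<open>\<xi>' / \<Omega> < 0\<close> times the difference of a coherent and a rapidly
  oscillating integral. The real part of the former is at least \<open>t / 2\<close>, the latter
  is at most \<open>t / 4\<close> in size.\<close>

lemma kernel_high:
  assumes x1: "x1 \<in> box_plus" and x2: "x2 \<in> box_plus" and x3: "x3 \<in> box_minus"
  shows "\<kappa>1 \<le> - Im (triple_kernel t x1 (x1 + x2) (x1 + x2 + x3))"
proof -
  note m1 = x1[unfolded box_plus_def mem_plane_box] and m2 = x2[unfolded box_plus_def mem_plane_box]
    and m3 = x3[unfolded box_minus_def mem_plane_box]
  have N0: "0 < N" using N by simp
  define \<xi> where "\<xi> = fst (x1 + x2 + x3)"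
  define \<xi>' where "\<xi>' = fst (x1 + x2)"
  define \<Omega> where "\<Omega> = defect x1 x2"
  define \<Theta> where "\<Theta> = defect (x1 + x2) x3"
  define P where "P = fst x1 * fst x2 * (fst x1 + fst x2)"
  define D where "D = resonance (- \<beta>) \<gamma> x1 x2"
  have P0: "0 < P" using m1 m2 N by (auto simp: P_def)
  have \<Omega>: "\<Omega> = - D / P"
    unfolding \<Omega>_def defect_def P_def D_def using m1 m2 N by (intro symb_defect) auto
  have hi: "6 * (- \<beta>) * N ^ 3 \<le> D / P" "4 / (D0 * N\<^sup>2) \<le> \<xi>' * P / D"
    using high_resonance[of "- \<beta>" \<gamma> N H "fst x1" "fst x2" "snd x1" "snd x2"] m1 m2 N \<beta> \<gamma> H w
    by (simp_all add: P_def D_def D0_def \<xi>'_def)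
  have sum: "\<Theta> + \<Omega> = symb \<beta> \<gamma> x1 + symb \<beta> \<gamma> x2 + symb \<beta> \<gamma> x3 - symb \<beta> \<gamma> (x1 + x2 + x3)"
    by (simp add: \<Theta>_def \<Omega>_def defect_def)
  have "\<bar>\<Theta> + \<Omega>\<bar> \<le> 12 * (- \<beta>) * (N * w\<^sup>2) + 44 * (H\<^sup>2 / N) + 5 * \<gamma> / N"
    using symb_triple_defect[OF \<beta> \<gamma> N H(1) w, of "fst x1" "fst x2" "fst x3" "snd x1" "snd x2" "snd x3"] m1 m2 m3
    unfolding sum by (simp add: plus_prod_def)
  then have small: "\<bar>\<Theta> + \<Omega>\<bar> \<le> 1 / t" using coherent by linarith
  have \<Omega>big: "9 / t \<le> - \<Omega>" using hi(1) large \<Omega> by simp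
  then have \<Omega>0: "\<Omega> \<noteq> 0" using t by (auto simp: field_simps)
  have "8 / t = 9 / t - 1 / t" by (simp add: diff_divide_distrib[symmetric])
  \<comment> \<open>The phase of the second interaction almost cancels the large mismatch of the first.\<close>
  then have \<Theta>big: "8 / t \<le> \<bar>\<Theta>\<bar>" using \<Omega>big small by linarith
  have \<Theta>0: "\<Theta> \<noteq> 0" using \<Theta>big t by (auto simp: field_simps)
  have "t / 2 \<le> Re (osc (\<Theta> + \<Omega>) t)"
    using small t by (intro Re_osc_lower_bound) (auto simp: field_simps)
  moreover have "norm (osc \<Theta> t) \<le> t / 4"
  proof -
    have "norm (osc \<Theta> t) \<le> 2 / \<bar>\<Theta>\<bar>" by (rule osc_norm_le_inverse[OF \<Theta>0])
    also have "\<dots> \<le> 2 / (8 / t)" using \<Theta>big t \<Theta>0 by (intro divide_left_mono) auto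
    finally show ?thesis by simp
  qed
  ultimately have ReX: "t / 4 \<le> Re (osc (\<Theta> + \<Omega>) t - osc \<Theta> t)"
    using complex_Re_le_cmod[of "osc \<Theta> t"] by simp
  have q: "- (\<xi>' / \<Omega>) = \<xi>' * P / D" using P0 by (simp add: \<Omega>)
  have "triple_kernel t x1 (x1 + x2) (x1 + x2 + x3) =
      - of_real (\<xi> * \<xi>' / (2 * pi\<^sup>2)) * ((osc (\<Theta> + \<Omega>) t - osc \<Theta> t) / (\<i> * of_real \<Omega>))"
    unfolding triple_kernel_sum \<xi>_def[symmetric] \<xi>'_def[symmetric] \<Omega>_def[symmetric] \<Theta>_def[symmetric]
    by (simp only: tri_eq[OF less_imp_le[OF t] \<Omega>0])
  also have "\<dots> = \<i> * of_real (\<xi> / (2 * pi\<^sup>2) * (\<xi>' / \<Omega>)) * (osc (\<Theta> + \<Omega>) t - osc \<Theta> t)"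
  proof -
    have "X / (\<i> * of_real \<Omega>) = - \<i> * X / of_real \<Omega>" for X
      by (simp add: divide_inverse)
    then show ?thesis by (simp add: mult_ac)
  qed
  finally have "- Im (triple_kernel t x1 (x1 + x2) (x1 + x2 + x3)) =
      \<xi> / (2 * pi\<^sup>2) * (\<xi>' * P / D) * Re (osc (\<Theta> + \<Omega>) t - osc \<Theta> t)"
    unfolding q[symmetric] by (simp add: mult.assoc)
  moreover have "(N / 2) / (2 * pi\<^sup>2) * (4 / (D0 * N\<^sup>2)) * (t / 4) \<le>
      \<xi> / (2 * pi\<^sup>2) * (\<xi>' * P / D) * Re (osc (\<Theta> + \<Omega>) t - osc \<Theta> t)"
  proof -
    have \<xi>N: "N / 2 \<le> \<xi>" using m1 m2 m3 w by (simp add: \<xi>_def)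
    then have \<xi>0: "0 \<le> \<xi> / (2 * pi\<^sup>2)" using N by simp
    have q0: "0 \<le> 4 / (D0 * N\<^sup>2)" using D0 by simp
    have 1: "(N / 2) / (2 * pi\<^sup>2) \<le> \<xi> / (2 * pi\<^sup>2)" using \<xi>N by (intro divide_right_mono) auto
    have 2: "(N / 2) / (2 * pi\<^sup>2) * (4 / (D0 * N\<^sup>2)) \<le> \<xi> / (2 * pi\<^sup>2) * (\<xi>' * P / D)"
      by (rule mult_mono[OF 1 hi(2) \<xi>0 q0])
    have 3: "0 \<le> \<xi> / (2 * pi\<^sup>2) * (\<xi>' * P / D)"
      using \<xi>0 order_trans[OF q0 hi(2)] by (rule mult_nonneg_nonneg)
    show ?thesis by (rule mult_mono[OF 2 ReX 3]) (use t in simp)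
  qed
  moreover have "(N / 2) / (2 * pi\<^sup>2) * (4 / (D0 * N\<^sup>2)) * (t / 4) = \<kappa>1"
    using N0 D0 by (simp add: \<kappa>1_def field_simps power2_eq_square)
  ultimately show ?thesis by simp
qed

text \<open>Here the size of the mismatch alone suffices: the inner time integral is at most
  \<open>2 / \<bar>\<Omega>\<bar>\<close>.\<close>

lemma kernel_low:
  assumes x1: "x1 \<in> box_plus" and x2: "x2 \<in> box_minus" and \<xi>: "\<bar>\<xi>\<bar> \<le> 3 * N"
  shows "norm (- complex_of_real (\<xi> * fst (x1 + x2) / (2 * pi\<^sup>2)) * tri \<Theta> (defect x1 x2) t) \<le> \<kappa>2"
proof (cases "fst x1 + fst x2 = 0")
  case True
  have "0 \<le> \<kappa>2" using N t by (simp add: \<kappa>2_def)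
  with True show ?thesis by simp
next
  case False
  note m1 = x1[unfolded box_plus_def mem_plane_box] and m2 = x2[unfolded box_minus_def mem_plane_box]
  define \<Omega> where "\<Omega> = defect x1 x2"
  define P where "P = fst x1 * fst x2 * (fst x1 + fst x2)"
  define D where "D = resonance (- \<beta>) \<gamma> x1 x2"
  have P0: "P \<noteq> 0" using m1 m2 N False by (auto simp: P_def)
  have \<Omega>: "\<Omega> = - D / P"
    unfolding \<Omega>_def defect_def P_def D_def using m1 m2 N False by (intro symb_defect) auto
  have lo: "0 < D" "\<bar>(fst x1 + fst x2) * P / D\<bar> \<le> 4 * w\<^sup>2 / H\<^sup>2"
    using low_resonance[of "- \<beta>" \<gamma> N H w "fst x1" "fst x2" "snd x1" "snd x2"] m1 m2 N \<beta> \<gamma> H w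
    by (simp_all add: P_def D_def)
  have \<Omega>0: "\<Omega> \<noteq> 0" using lo P0 by (simp add: \<Omega>)
  have "norm (- complex_of_real (\<xi> * fst (x1 + x2) / (2 * pi\<^sup>2)) * tri \<Theta> \<Omega> t) =
      \<bar>\<xi>\<bar> / (2 * pi\<^sup>2) * (\<bar>fst x1 + fst x2\<bar> * norm (tri \<Theta> \<Omega> t))"
    by (simp add: norm_mult norm_divide norm_power abs_mult flip: of_real_add)
  also have "\<dots> \<le> (3 * N) / (2 * pi\<^sup>2) * (\<bar>fst x1 + fst x2\<bar> * (t * (2 / \<bar>\<Omega>\<bar>)))"
    using t \<xi> by (intro mult_mono divide_right_mono tri_norm_le_inverse \<Omega>0) auto
  also have "\<dots> = (3 * N) / (2 * pi\<^sup>2) * (2 * t) * \<bar>(fst x1 + fst x2) * P / D\<bar>"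
    by (simp add: \<Omega> abs_mult abs_divide)
  also have "\<dots> \<le> (3 * N) / (2 * pi\<^sup>2) * (2 * t) * (4 * w\<^sup>2 / H\<^sup>2)"
    using t N by (intro mult_left_mono lo) auto
  also have "\<dots> = \<kappa>2" by (simp add: \<kappa>2_def mult_ac)
  finally show ?thesis by (simp only: \<Omega>_def)
qed

lemma \<kappa>2_le: "2 * \<kappa>2 \<le> \<kappa>1 / 2"
proof -
  have pos: "0 < H\<^sup>2" "0 < D0" "0 < N" using H D0 N by auto
  have "w\<^sup>2 / H\<^sup>2 * (192 * D0 * N\<^sup>2) \<le> 1"
    using flat pos by (simp add: D0_def power_mult_distrib mult_ac)
  then have le: "w\<^sup>2 / H\<^sup>2 \<le> 1 / (192 * D0 * N\<^sup>2)"
    using pos by (simp add: pos_le_divide_eq)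
  have "2 * \<kappa>2 = 24 * N * t / pi\<^sup>2 * (w\<^sup>2 / H\<^sup>2)" by (simp add: \<kappa>2_def mult_ac)
  also have "\<dots> \<le> 24 * N * t / pi\<^sup>2 * (1 / (192 * D0 * N\<^sup>2))"
    using le t pos by (intro mult_left_mono) auto
  also have "\<dots> = \<kappa>1 / 2" using pos by (simp add: \<kappa>1_def power2_eq_square)
  finally show ?thesis .
qed

lemma box_out_fst:
  assumes "z \<in> box_out" shows "N - w \<le> fst z" "fst z \<le> N + 2 * w"
  using assms by (auto simp: box_out_def mem_plane_box)

lemma sum_in_box:
  assumes "x1 \<in> box_plus" "x2 \<in> box_plus" "x3 \<in> box_minus"
  shows "x1 + x2 + x3 \<in> box_out"
  using assms H by (auto simp: box_plus_def box_minus_def box_out_def mem_plane_box)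

text \<open>Among the eight ways of distributing three waves over the two boxes, exactly those
  with a single wave near \<open>- N\<close> produce a frequency in \<open>box_out\<close>.\<close>

lemma kernel_inequality:
  "\<kappa>1 * (indicator box_plus x1 * indicator box_plus x2 * indicator box_minus x3) -
   \<kappa>2 * (indicator box_plus x1 * indicator box_minus x2 * indicator box_plus x3) -
   \<kappa>2 * (indicator box_minus x1 * indicator box_plus x2 * indicator box_plus x3) \<le>
   - Im (indicator box_out (x1 + x2 + x3) *\<^sub>R
     (profile x1 * profile x2 * profile x3 * triple_kernel t x1 (x1 + x2) (x1 + x2 + x3)))"
proof -
  let ?K = "triple_kernel t x1 (x1 + x2) (x1 + x2 + x3)"
  have fplus: "N \<le> fst z" "fst z \<le> N + w" if "z \<in> box_plus" for z
    using that by (auto simp: box_plus_def mem_plane_box)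
  have fminus: "- N - w \<le> fst z" "fst z \<le> - N" if "z \<in> box_minus" for z
    using that by (auto simp: box_minus_def mem_plane_box)
  have pplus: "profile z = 1" "indicat_real box_plus z = 1" "indicat_real box_minus z = 0" if "z \<in> box_plus" for z
    using that boxes_disjoint[OF that] by (auto simp: profile_def indicator_def)
  have pminus: "profile z = 1" "indicat_real box_plus z = 0" "indicat_real box_minus z = 1" if "z \<in> box_minus" for z
    using that boxes_disjoint[of z] by (auto simp: profile_def indicator_def)
  have pnone: "profile z = 0" "indicat_real box_plus z = 0" "indicat_real box_minus z = 0"
    if "z \<notin> box_plus" "z \<notin> box_minus" for z
    using that by (auto simp: profile_def)
  have out: "indicat_real box_out (x1 + x2 + x3) = 0"
    if "fst x1 + fst x2 + fst x3 < N - w \<or> N + 2 * w < fst x1 + fst x2 + fst x3"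
    using that box_out_fst[of "x1 + x2 + x3"] by (auto simp: indicator_def)
  have Im_le: "- norm ?K \<le> - Im ?K" using abs_Im_le_cmod[of ?K] by linarith
  consider "x1 \<notin> box_plus \<and> x1 \<notin> box_minus" | "x2 \<notin> box_plus \<and> x2 \<notin> box_minus" | "x3 \<notin> box_plus \<and> x3 \<notin> box_minus"
    | (ppp) "x1 \<in> box_plus" "x2 \<in> box_plus" "x3 \<in> box_plus"
    | (ppm) "x1 \<in> box_plus" "x2 \<in> box_plus" "x3 \<in> box_minus"
    | (pmp) "x1 \<in> box_plus" "x2 \<in> box_minus" "x3 \<in> box_plus"
    | (mpp) "x1 \<in> box_minus" "x2 \<in> box_plus" "x3 \<in> box_plus"
    | (pmm) "x1 \<in> box_plus" "x2 \<in> box_minus" "x3 \<in> box_minus"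
    | (mpm) "x1 \<in> box_minus" "x2 \<in> box_plus" "x3 \<in> box_minus"
    | (mmp) "x1 \<in> box_minus" "x2 \<in> box_minus" "x3 \<in> box_plus"
    | (mmm) "x1 \<in> box_minus" "x2 \<in> box_minus" "x3 \<in> box_minus"
    by blast
  then show ?thesis
  proof cases
    case ppp
    have "indicat_real box_out (x1 + x2 + x3) = 0"
      using fplus[OF ppp(1)] fplus[OF ppp(2)] fplus[OF ppp(3)] w N by (intro out) auto
    with ppp show ?thesis by (simp add: pplus)
  next
    case ppm
    then have "indicat_real box_out (x1 + x2 + x3) = 1" using sum_in_box by simp
    with ppm kernel_high[OF ppm] show ?thesis by (simp add: pplus pminus)
  next
    case pmp
    then have "indicat_real box_out (x1 + x2 + x3) = 1" using sum_in_box[of x1 x3 x2] by (simp add: ac_simps)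
    moreover have "norm ?K \<le> \<kappa>2"
      unfolding triple_kernel_sum
      using fplus[OF pmp(1)] fminus[OF pmp(2)] fplus[OF pmp(3)] w N by (intro kernel_low pmp) auto
    ultimately show ?thesis using pmp Im_le by (simp add: pplus pminus)
  next
    case mpp
    then have "indicat_real box_out (x1 + x2 + x3) = 1" using sum_in_box[of x2 x3 x1] by (simp add: ac_simps)
    moreover have "norm ?K \<le> \<kappa>2"
    proof -
      have d: "defect x2 x1 = defect x1 x2" by (simp add: defect_def add.commute)
      show ?thesis
        unfolding triple_kernel_sum
        by (rule kernel_low[OF mpp(2,1), unfolded add.commute[of x2 x1] d])
           (use fminus[OF mpp(1)] fplus[OF mpp(2)] fplus[OF mpp(3)] w N in auto)
    qed
    ultimately show ?thesis using mpp Im_le by (simp add: pplus pminus)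
  next
    case pmm
    have "indicat_real box_out (x1 + x2 + x3) = 0"
      using fplus[OF pmm(1)] fminus[OF pmm(2)] fminus[OF pmm(3)] w N by (intro out) auto
    with pmm show ?thesis by (simp add: pplus pminus)
  next
    case mpm
    have "indicat_real box_out (x1 + x2 + x3) = 0"
      using fminus[OF mpm(1)] fplus[OF mpm(2)] fminus[OF mpm(3)] w N by (intro out) auto
    with mpm show ?thesis by (simp add: pplus pminus)
  next
    case mmp
    have "indicat_real box_out (x1 + x2 + x3) = 0"
      using fminus[OF mmp(1)] fminus[OF mmp(2)] fplus[OF mmp(3)] w N by (intro out) auto
    with mmp show ?thesis by (simp add: pplus pminus)
  next
    case mmm
    have "indicat_real box_out (x1 + x2 + x3) = 0"
      using fminus[OF mmm(1)] fminus[OF mmm(2)] fminus[OF mmm(3)] w N by (intro out) auto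
    with mmm show ?thesis by (simp add: pminus)
  qed (simp_all add: pnone)
qed

lemma third_coefficient_large:
  "\<kappa>1 / 2 * (w * H) ^ 3 \<le> norm (LINT z|lborel. indicator box_out z * cis (- t * symb \<beta> \<gamma> z) * U 3 t z)"
proof -
  have "\<kappa>1 / 2 * (w * H) ^ 3 \<le> (\<kappa>1 - 2 * \<kappa>2) * (w * H) ^ 3"
    using \<kappa>2_le w H by (intro mult_right_mono) auto
  also have "\<dots> \<le> norm (LINT z|lborel. indicator box_out z * cis (- t * symb \<beta> \<gamma> z) * U 3 t z)"
    using t by (intro third_coefficient_lower_bound[OF _ _ box_plus_integrable box_plus_integral
        box_minus_integrable box_minus_integral kernel_inequality]) auto
  finally show ?thesis .
qed

lemma profile_sobolev:
  assumes s: "s < 0"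
  shows "integrable lborel (\<lambda>z. (wt s z * norm (profile z))\<^sup>2)"
    and "(LINT z|lborel. (wt s z * norm (profile z))\<^sup>2) \<le> 2 * (w * H) * (N powr s)\<^sup>2"
proof -
  have le: "(wt s z * norm (profile z))\<^sup>2 \<le> (N powr s)\<^sup>2 * (indicator box_plus z + indicator box_minus z)" for z
  proof (cases "z \<in> box_plus \<or> z \<in> box_minus")
    case True
    then have "N \<le> \<bar>fst z\<bar>" by (auto simp: box_plus_def box_minus_def mem_plane_box)
    then have "wt s z \<le> N powr s" unfolding wt_def using N s by (intro powr_mono2') auto
    then have "(wt s z)\<^sup>2 \<le> (N powr s)\<^sup>2" using wt_pos[of s z] by (intro power_mono) auto
    then show ?thesis unfolding power_mult_distrib norm_profile_square by (intro mult_right_mono) auto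
  qed (auto simp: norm_profile)
  have i: "integrable lborel (\<lambda>z. (N powr s)\<^sup>2 * (indicat_real box_plus z + indicator box_minus z))"
    using box_plus_integrable box_minus_integrable by simp
  have [measurable]: "profile \<in> borel_measurable borel" by (rule f_measurable)
  show i': "integrable lborel (\<lambda>z. (wt s z * norm (profile z))\<^sup>2)"
    by (rule Bochner_Integration.integrable_bound[OF i])
       (use le in \<open>auto intro!: AE_I2 intro: order_trans[OF _ abs_ge_self]\<close>)
  have "(LINT z|lborel. (wt s z * norm (profile z))\<^sup>2) \<le>
      (LINT z|lborel. (N powr s)\<^sup>2 * (indicat_real box_plus z + indicator box_minus z))"
    by (rule integral_mono[OF i' i le])
  also have "\<dots> = 2 * (w * H) * (N powr s)\<^sup>2"
    using box_plus_integrable box_minus_integrable by (simp add: box_plus_integral[simplified] box_minus_integral[simplified])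
  finally show "(LINT z|lborel. (wt s z * norm (profile z))\<^sup>2) \<le> 2 * (w * H) * (N powr s)\<^sup>2" .
qed

lemma dual_weight_box_out:
  assumes s: "s < 0"
  defines "\<theta> \<equiv> \<lambda>z. indicator box_out z * cis (- t * symb \<beta> \<gamma> z)"
  shows "integrable lborel (\<lambda>z. (norm (\<theta> z) / wt s z)\<^sup>2)"
    and "(LINT z|lborel. (norm (\<theta> z) / wt s z)\<^sup>2) \<le> 9 * (w * H) * ((4 * N) powr (- s))\<^sup>2"
proof -
  have le: "(norm (\<theta> z) / wt s z)\<^sup>2 \<le> ((4 * N) powr (- s))\<^sup>2 * indicator box_out z" for z
  proof (cases "z \<in> box_out")
    case True
    have "1 + \<bar>fst z\<bar> \<le> 4 * N" using box_out_fst[OF True] N w by auto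
    then have "(1 + \<bar>fst z\<bar>) powr (- s) \<le> (4 * N) powr (- s)" using s by (intro powr_mono2) auto
    then have "1 / wt s z \<le> (4 * N) powr (- s)" by (simp add: wt_def powr_minus_divide)
    then have "(1 / wt s z)\<^sup>2 \<le> ((4 * N) powr (- s))\<^sup>2" using wt_pos[of s z] by (intro power_mono) auto
    with True show ?thesis by (simp add: \<theta>_def norm_mult)
  qed (simp add: \<theta>_def)
  have i: "integrable lborel (\<lambda>z. ((4 * N) powr (- s))\<^sup>2 * indicat_real box_out z)"
    using box_out_integrable by simp
  have [measurable]: "\<theta> \<in> borel_measurable borel" unfolding \<theta>_def by measurable
  show i': "integrable lborel (\<lambda>z. (norm (\<theta> z) / wt s z)\<^sup>2)"
    by (rule Bochner_Integration.integrable_bound[OF i])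
       (use le in \<open>auto intro!: AE_I2 intro: order_trans[OF _ abs_ge_self]\<close>)
  have "(LINT z|lborel. (norm (\<theta> z) / wt s z)\<^sup>2) \<le> (LINT z|lborel. ((4 * N) powr (- s))\<^sup>2 * indicat_real box_out z)"
    by (rule integral_mono[OF i' i le])
  also have "\<dots> = 9 * (w * H) * ((4 * N) powr (- s))\<^sup>2" by (simp add: box_out_integral[simplified])
  finally show "(LINT z|lborel. (norm (\<theta> z) / wt s z)\<^sup>2) \<le> 9 * (w * H) * ((4 * N) powr (- s))\<^sup>2" .
qed

end


section \<open>Ill-posedness\<close>

text \<open>The data are the value of the solution at time 0.\<close>

lemma (in small_fourier_data) scaled_data_le_total: "norm (of_real \<delta> * f z) \<le> total z"
  using sol_bound[of 0 z] sol_duhamel[of 0 z] T by (simp add: time_integral_point)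

text \<open>For small \<open>\<delta>\<close> the data \<open>\<delta> f\<close> are smooth and
  lie in the ball on which the solution map is pinned down, so its value is that of the
  constructed solution. The tested values are then a power series in \<open>\<delta>\<close>, and
  the assumption \<open>C\<close>, which expresses the third-order smoothness, bounds its third
  coefficient.\<close>

lemma (in fourier_data) third_coefficient_upper_bound:
  assumes p: "p = symb \<beta> \<gamma>" and T: "0 < T" and S: "solution_map \<beta> \<gamma> s T S"
    and C: "\<And>v L \<Lambda> a \<rho>. v \<in> sob_space s \<Longrightarrow> bounded_functional (sob_space s) (sob_norm s) L \<Lambda> \<Longrightarrow> 0 < \<rho> \<Longrightarrow>
      (\<And>r. \<bar>r\<bar> < \<rho> \<Longrightarrow> (\<lambda>k. a k * of_real r ^ k) sums \<Lambda> (S (r *\<^sub>R v) T)) \<Longrightarrow>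
      norm (a 3) \<le> C * L * sob_norm s v ^ 3"
    and f: "integrable lborel (\<lambda>z. (wt s z * norm (f z))\<^sup>2)"
    and [measurable]: "\<theta> \<in> borel_measurable borel" and \<theta>: "\<And>z. norm (\<theta> z) \<le> 1"
    and \<theta>s: "integrable lborel (\<lambda>z. (norm (\<theta> z) / wt s z)\<^sup>2)"
  shows "norm (LINT z|lborel. \<theta> z * U 3 T z) \<le>
    C * sqrt (LINT z|lborel. (norm (\<theta> z) / wt s z)\<^sup>2) * sqrt (LINT z|lborel. (wt s z * norm (f z))\<^sup>2) ^ 3"
proof -
  define v where "v = regular (inv_fourier_fun f)"
  have hv: "has_fourier v f" unfolding v_def by (rule has_fourier_regular[OF f_integrable])
  have v: "v \<in> sob_space s" by (rule sob_spaceI[OF hv f])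
  have Nv: "sob_norm s v = sqrt (LINT z|lborel. (wt s z * norm (f z))\<^sup>2)" by (rule sob_norm_fourier[OF hv])
  then have Nv0: "0 \<le> sob_norm s v" by simp
  have \<Lambda>: "bounded_functional (sob_space s) (sob_norm s) (sqrt (LINT z|lborel. (norm (\<theta> z) / wt s z)\<^sup>2)) (fourier_pairing \<theta>)"
    unfolding bounded_functional_def
    using fourier_pairing_add[OF _ _ _ \<theta>s] fourier_pairing_scaleR[OF _ v _ \<theta>s] fourier_pairing_bound[OF _ _ \<theta>s]
    by simp
  obtain r where r: "0 < r" and sol: "\<And>u0. u0 \<in> H_inf \<Longrightarrow> regular u0 \<in> sob_space s \<Longrightarrow> sob_norm s (regular u0) < r \<Longrightarrow>
      (\<forall>u. smooth_solution \<beta> \<gamma> T u0 u \<longrightarrow> (\<forall>t\<in>{0..T}. S (regular u0) t = regular (u t)))"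
    using S unfolding solution_map_def by blast
  define \<Lambda>0 where "\<Lambda>0 = T * (8 * R / pi * A)"
  have \<Lambda>0: "0 < \<Lambda>0" using T R A by (simp add: \<Lambda>0_def)
  \<comment> \<open>The first bound makes the series converge, the second keeps the data in the ball.\<close>
  define \<rho> where "\<rho> = min (1 / (2 * \<Lambda>0)) (r / (sob_norm s v + 1))"
  have \<rho>: "0 < \<rho>" using \<Lambda>0 r Nv0 by (simp add: \<rho>_def add_nonneg_pos)
  have "(\<lambda>k. (LINT z|lborel. \<theta> z * U k T z) * of_real \<delta> ^ k) sums fourier_pairing \<theta> (S (\<delta> *\<^sub>R v) T)"
    if \<delta>: "\<bar>\<delta>\<bar> < \<rho>" for \<delta>
  proof -
    have "\<bar>\<delta>\<bar> \<le> 1 / (2 * \<Lambda>0)" using \<delta> by (simp add: \<rho>_def)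
    then have "\<bar>\<delta>\<bar> * \<Lambda>0 \<le> 1 / 2" using \<Lambda>0 by (simp add: field_simps)
    then interpret small_fourier_data p f R A \<delta> T
      by unfold_locales (use T in \<open>simp_all add: \<Lambda>0_def mult.assoc\<close>)
    interpret fourier_solution \<beta> \<gamma> T total sol "\<lambda>z. of_real \<delta> * f z"
      by unfold_locales (use rapid_total sol_measurable_pair sol_bound T sol_duhamel p in auto)
    define u0 where "u0 = inv_fourier_fun (\<lambda>z. of_real \<delta> * f z)"
    have "regular u0 = \<delta> *\<^sub>R v"
      unfolding u0_def v_def regular_inv_fourier_fun[OF f_integrable]
      using f_integrable by (subst regular_inv_fourier_fun)
        (auto simp: inv_fourier_def scaleR_fun_def fun_eq_iff mult.assoc scaleR_conv_of_real)
    moreover have "u0 \<in> H_inf"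
      unfolding u0_def by (intro H_inf_inv_fourier_fun[OF rapid_total _ scaled_data_le_total]) measurable
    moreover have "\<delta> *\<^sub>R v \<in> sob_space s" using v by (rule sob_space_scaleR)
    moreover have "sob_norm s (\<delta> *\<^sub>R v) < r"
    proof -
      have "\<bar>\<delta>\<bar> * sob_norm s v \<le> \<bar>\<delta>\<bar> * (sob_norm s v + 1)" by (simp add: mult_left_mono)
      also have "\<dots> < r" using \<delta> Nv0 by (simp add: \<rho>_def pos_less_divide_eq)
      finally show ?thesis by (simp add: sob_norm_scaleR[OF v])
    qed
    ultimately have "S (\<delta> *\<^sub>R v) T = regular (inv_fourier_fun (sol T))"
      using sol[of u0] smooth_solution_inv_fourier T unfolding u0_def by auto
    then have "fourier_pairing \<theta> (S (\<delta> *\<^sub>R v) T) = (LINT z|lborel. \<theta> z * sol T z)"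
      using V_integrable[of T] T by (simp add: fourier_pairing_eq[OF has_fourier_regular])
    then show ?thesis using pairing_sums[of T \<theta> 1] \<theta> T by simp
  qed
  from C[OF v \<Lambda> \<rho> this] show ?thesis by (simp add: Nv)
qed

theorem theorem1p3:
  fixes \<beta> \<gamma> s1 :: real
  assumes "\<beta> < 0" and "\<gamma> > 0" and "s1 < - 1 / 2"
  shows "\<not> (\<exists>T>0. \<exists>S. solution_map \<beta> \<gamma> s1 T S \<and>
    (\<forall>t\<in>{0..T}. C3_at_zero (sob_space s1) (sob_norm s1) (\<lambda>u0. S u0 t)))"
proof
  assume "\<exists>T>0. \<exists>S. solution_map \<beta> \<gamma> s1 T S \<and>
    (\<forall>t\<in>{0..T}. C3_at_zero (sob_space s1) (sob_norm s1) (\<lambda>u0. S u0 t))"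
  then obtain T S where T: "0 < T" and S: "solution_map \<beta> \<gamma> s1 T S"
    and C3: "C3_at_zero (sob_space s1) (sob_norm s1) (\<lambda>u0. S u0 T)"
    by auto
  obtain C where C: "\<And>v L \<Lambda> a \<rho>. v \<in> sob_space s1 \<Longrightarrow> bounded_functional (sob_space s1) (sob_norm s1) L \<Lambda> \<Longrightarrow> 0 < \<rho> \<Longrightarrow>
      (\<And>r. \<bar>r\<bar> < \<rho> \<Longrightarrow> (\<lambda>k. a k * of_real r ^ k) sums \<Lambda> (S (r *\<^sub>R v) T)) \<Longrightarrow>
      norm (a 3) \<le> C * L * sob_norm s1 v ^ 3"
    using C3_at_zero_coefficient_bound[OF quasinormed_sobolev C3] by blast
  define D where "D = 768 * (- \<beta>) + 4 + 12 * \<gamma>"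
  have D: "4 \<le> D" using assms by (simp add: D_def)
  define c where "c = 12 * (- \<beta>) + 44"
  have c: "44 < c" using assms by (simp add: c_def)
  \<comment> \<open>The phase of a resonant triple is at most \<open>c h\<^sup>2\<close> plus a term that tends to zero as \<open>N\<close> grows.\<close>
  define h where "h = min 1 (sqrt (1 / (2 * T * c)))"
  have h: "0 < h" "h \<le> 1" using T c by (auto simp: h_def)
  have "h\<^sup>2 \<le> (sqrt (1 / (2 * T * c)))\<^sup>2" using h by (intro power_mono) (auto simp: h_def)
  then have h2: "c * h\<^sup>2 \<le> 1 / (2 * T)" using T c by (simp add: field_simps)
  \<comment> \<open>The interactions of opposite frequencies are smaller by \<open>(\<epsilon> / h)\<^sup>2\<close>, to be compared with \<open>1 / D\<close>.\<close>
  define \<epsilon> where "\<epsilon> = h / (192 * D)"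
  have "h / (192 * D) \<le> h / (192 * 4)" using h D by (intro divide_left_mono) auto
  then have \<epsilon>: "0 < \<epsilon>" "\<epsilon> \<le> h / 768" using h D by (auto simp: \<epsilon>_def)
  \<comment> \<open>The area of each box, the same for all \<open>N\<close>.\<close>
  define A where "A = \<epsilon> * h"
  have A_pos: "0 < A" using \<epsilon> h by (simp add: A_def)
  define K where "K = \<bar>C\<bar> * (3 * sqrt A * 4 powr (- s1)) * sqrt (2 * A) ^ 3"
  \<comment> \<open>The lower and the upper bound for the third coefficient, multiplied by \<open>N\<close>.\<close>
  have bound: "T / (8 * pi\<^sup>2 * D) * A ^ 3 \<le> K * N powr (1 + 2 * s1)"
    if N: "1 \<le> N" "10 * \<gamma> * T \<le> N" "9 / (T * (6 * (- \<beta>))) \<le> N" for N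
  proof -
    have N0: "0 < N" using N by simp
    define w where "w = \<epsilon> / sqrt N"
    define H where "H = h * sqrt N"
    have sq: "1 \<le> sqrt N" "(sqrt N)\<^sup>2 = N" using N by auto
    have w: "0 < w" "w\<^sup>2 = \<epsilon>\<^sup>2 / N" "w \<le> \<epsilon>"
      using \<epsilon> sq N0 by (auto simp: w_def power_divide divide_le_eq intro: order_trans[of _ "\<epsilon> * 1"])
    have H: "0 < H" "H\<^sup>2 = h\<^sup>2 * N" using h N0 by (auto simp: H_def power_mult_distrib)
    have wH: "w * H = A" using N0 by (simp add: w_def H_def A_def)
    interpret resonant_data \<beta> \<gamma> T w H N
    proof
      show "2 * w \<le> N" using w(3) \<epsilon> h N by linarith
      show "H\<^sup>2 \<le> N" using h N0 by (simp add: H(2) power_le_one mult_le_cancel_right1)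
      have "12 * (- \<beta>) * \<epsilon>\<^sup>2 + 44 * h\<^sup>2 \<le> 12 * (- \<beta>) * h\<^sup>2 + 44 * h\<^sup>2"
        using \<epsilon> h assms(1) by (intro add_right_mono mult_left_mono power_mono) auto
      also have "\<dots> \<le> 1 / (2 * T)" using h2 by (simp add: c_def algebra_simps)
      finally have 1: "12 * (- \<beta>) * \<epsilon>\<^sup>2 + 44 * h\<^sup>2 \<le> 1 / (2 * T)" .
      have "5 * \<gamma> / N \<le> 1 / (2 * T)" using N(2) N0 T by (simp add: field_simps)
      then show "12 * (- \<beta>) * (N * w\<^sup>2) + 44 * (H\<^sup>2 / N) + 5 * \<gamma> / N \<le> 1 / T"
        using 1 N0 T by (simp add: w(2) H(2))
      have "0 < T * (6 * (- \<beta>))" using T assms(1) by (intro mult_pos_pos) auto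
      from N(3)[unfolded pos_divide_le_eq[OF this]] have "9 / T \<le> 6 * (- \<beta>) * N"
        unfolding pos_divide_le_eq[OF T] by (simp add: mult_ac)
      also have "\<dots> \<le> 6 * (- \<beta>) * N ^ 3"
        using assms(1) power_increasing[of 1 3 N] N by (intro mult_left_mono) auto
      finally show "9 / T \<le> 6 * (- \<beta>) * N ^ 3" .
      have "192 * D * \<epsilon>\<^sup>2 * N = h\<^sup>2 / (192 * D) * N"
        using D by (simp add: \<epsilon>_def power_divide power2_eq_square)
      also have "\<dots> \<le> h\<^sup>2 / 1 * N"
        using D N0 by (intro mult_right_mono divide_left_mono) auto
      finally have "192 * D * \<epsilon>\<^sup>2 * N \<le> h\<^sup>2 * N" by simp
      moreover have "(N * w)\<^sup>2 = \<epsilon>\<^sup>2 * N"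
        unfolding power_mult_distrib w(2) using N0 by (simp add: power2_eq_square)
      ultimately show "192 * (768 * (- \<beta>) + 4 + 12 * \<gamma>) * (N * w)\<^sup>2 \<le> H\<^sup>2"
        unfolding D_def[symmetric] H(2) by (simp only: mult.assoc)
    qed (use assms T N w H in auto)
    have s: "s1 < 0" using assms by simp
    define \<theta> where "\<theta> = (\<lambda>z. indicator box_out z * cis (- T * symb \<beta> \<gamma> z))"
    have [measurable]: "\<theta> \<in> borel_measurable borel" unfolding \<theta>_def by measurable
    define L where "L = sqrt (LINT z|lborel. (norm (\<theta> z) / wt s1 z)\<^sup>2)"
    define M where "M = sqrt (LINT z|lborel. (wt s1 z * norm (profile z))\<^sup>2)"
    have LM0: "0 \<le> L" "0 \<le> M" by (auto simp: L_def M_def)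
    have "L \<le> sqrt (9 * A * ((4 * N) powr (- s1))\<^sup>2)"
      unfolding L_def \<theta>_def using dual_weight_box_out(2)[OF s] by (simp only: wH real_sqrt_le_iff)
    also have "\<dots> = 3 * sqrt A * 4 powr (- s1) * N powr (- s1)"
      using N0 by (simp add: real_sqrt_mult powr_mult)
    finally have L: "L \<le> 3 * sqrt A * 4 powr (- s1) * N powr (- s1)" .
    have "M \<le> sqrt (2 * A * (N powr s1)\<^sup>2)"
      unfolding M_def using profile_sobolev(2)[OF s] by (simp only: wH real_sqrt_le_iff)
    also have "\<dots> = sqrt (2 * A) * N powr s1" by (simp add: real_sqrt_mult)
    finally have M: "M ^ 3 \<le> (sqrt (2 * A) * N powr s1) ^ 3" using LM0 by (intro power_mono)
    have "\<kappa>1 / 2 * A ^ 3 \<le> norm (LINT z|lborel. \<theta> z * U 3 T z)"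
      using third_coefficient_large by (simp only: wH \<theta>_def)
    also have "\<dots> \<le> C * L * M ^ 3"
      unfolding L_def M_def
    proof (rule third_coefficient_upper_bound[where s = s1 and C = C and S = S, OF refl T S])
      show "integrable lborel (\<lambda>z. (wt s1 z * norm (profile z))\<^sup>2)" by (rule profile_sobolev(1)[OF s])
      show "integrable lborel (\<lambda>z. (norm (\<theta> z) / wt s1 z)\<^sup>2)"
        unfolding \<theta>_def by (rule dual_weight_box_out(1)[OF s])
      show "norm (\<theta> z) \<le> 1" for z by (simp add: \<theta>_def norm_mult indicator_def)
    qed (fact C | simp)+
    also have "\<dots> \<le> \<bar>C\<bar> * L * M ^ 3" using LM0 by (intro mult_right_mono) auto
    also have "\<dots> \<le> \<bar>C\<bar> * (3 * sqrt A * 4 powr (- s1) * N powr (- s1)) * (sqrt (2 * A) * N powr s1) ^ 3"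
      using L M LM0 A_pos by (intro mult_mono mult_left_mono) (auto intro!: mult_nonneg_nonneg)
    also have "\<dots> = K * (N powr (- s1) * (N powr s1) ^ 3)"
      by (simp add: K_def power_mult_distrib)
    also have "N powr (- s1) * (N powr s1) ^ 3 = N powr (2 * s1)"
      using N0 by (simp add: powr_power flip: powr_add)
    finally have "N * (\<kappa>1 / 2 * A ^ 3) \<le> N * (K * N powr (2 * s1))" using N0 by (intro mult_left_mono) auto
    moreover have "N * (\<kappa>1 / 2 * A ^ 3) = T / (8 * pi\<^sup>2 * D) * A ^ 3"
      using N0 by (simp add: \<kappa>1_def D0_def D_def)
    moreover have "N * (K * N powr (2 * s1)) = K * N powr (1 + 2 * s1)"
      using N0 by (simp add: powr_add)
    ultimately show ?thesis by (simp only:)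
  qed
  have "((\<lambda>N. K * N powr (1 + 2 * s1)) \<longlongrightarrow> K * 0) at_top"
    using assms by (intro tendsto_mult tendsto_const tendsto_neg_powr filterlim_ident) auto
  moreover have "\<forall>\<^sub>F N in at_top. T / (8 * pi\<^sup>2 * D) * A ^ 3 \<le> K * N powr (1 + 2 * s1)"
    using eventually_ge_at_top[of 1] eventually_ge_at_top[of "10 * \<gamma> * T"]
      eventually_ge_at_top[of "9 / (T * (6 * (- \<beta>)))"]
    by eventually_elim (rule bound)
  ultimately have "T / (8 * pi\<^sup>2 * D) * A ^ 3 \<le> K * 0"
    by (intro tendsto_lowerbound) auto
  moreover have "0 < T / (8 * pi\<^sup>2 * D) * A ^ 3" using T A_pos D by simp
  ultimately show False by simp
qed

end
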